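(* Let $G=\mathrm{SL}(2,\mathbb{K})$ with $\mathbb{K}$ equal to either $\mathbb{R}$ or $\mathbb{C}$. Let $N<G$ be the group of upper unipotent triangular matrices, with Lie algebra $\mathfrak{n}\cong\mathbb{K}$, and identify $G/N$ with $\mathbb{K}^2\setminus\{0\}$ via $gN\mapsto ge_1$. The inclusion $$i:H^1_m(N)\longrightarrow H^2_m\big(G\curvearrowright(\mathbb{K}^2\setminus\{0\})\big)$$ of the short exact sequence $0\to H^1_m(N)\overset{i}{\to}H^2_m(G\curvearrowright G/N)\to H^2_m(G)\to 0$ is given by sending an $\mathbb{R}$-linear form $\alpha_{\mathfrak{n}}\in\mathfrak{n}^*\cong H^1_m(N)$ to (the class of) the measurable, almost everywhere defined, $G$-invariant cocycle $$i(\alpha_{\mathfrak{n}}):(\mathbb{K}^2\setminus\{0\})^3\longrightarrow\mathbb{R},$$ $$(v_0,v_1,v_2)\longmapsto\sum_{0\le i<j\le 2}(-1)^{i+j}\left[\alpha_{\mathfrak{n}}\left(\left\langle\frac{v_i}{d_{v_i,v_j}},\frac{v_j}{\|v_j\|^2}\right\rangle\right)+\alpha_{\mathfrak{n}}\left(\left\langle\frac{v_j}{d_{v_i,v_j}},\frac{v_i}{\|v_i\|^2}\right\rangle\right)\right],$$ where $\langle\cdot,\cdot\rangle$ is the standard scalar product on $\mathbb{K}^2$ if $\mathbb{K}=\mathbb{R}$ and the standard Hermitian product (linear in the first variable) if $\mathbb{K}=\mathbb{C}$, and $d_{v_i,v_j}$ is the determinant of the matrix with columns $(v_i|v_j)$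.
   Context: $L^0(X)$ denotes real-valued measurable functions on $X$ modulo equality almost everywhere. $H^*_m(H)$ is the cohomology of $(L^0(H^{*+1})^H,d^* )$ with homogeneous coboundary $d^*$, and for a closed subgroup $L<G$, $H^*_m(G\curvearrowright G/L)$ is the cohomology of $(L^0((G/L)^{*+1})^G,d^* )$; the map $H^2_m(G\curvearrowright G/L)\to H^2_m(G)$ is evaluation on a basepoint $x$: $f\mapsto\big((g_0,g_1,g_2)\mapsto f(g_0x,g_1x,g_2x)\big)$. The Lie algebra $\mathfrak{n}$ and the group $N$ are identified with $\mathbb{K}$ via the upper right entry; $\mathfrak{n}^*$ is the real dual of $\mathfrak{n}$, and $\alpha_{\mathfrak{n}}\in\mathfrak{n}^*$ corresponds to the class in $H^1_m(N)$ of the homomorphism $\overline\alpha(n)=\alpha_{\mathfrak{n}}(\log n)$ (homogeneous cocycle $(n_0,n_1)\mapsto\overline\alpha(n_0^{-1}n_1)$). The map $i$ is the one coming from the following bicomplex, with $L=N$. Let $C^{p,q}=L^0(G^{p+1}\times(G/L)^q)^G$, let $d^\uparrow:C^{p,q}\to C^{p+1,q}$ be the homogeneous differential in the $G$-variables and $d^\rightarrow:C^{p,q}\to C^{p,q+1}$ the homogeneous differential in the $G/L$-variables multiplied by $(-1)^{p+1}$. The Eckmann–Shapiro induction identifies $L^0(G^{p+1})^L$ with $C^{p,1}$ by $\overline{f}(g_0,\dots,g_p)(hL)=f(h^{-1}g_0,\dots,h^{-1}g_p)$, and $H^p_m(L)$ is the cohomology of $(L^0(G^{*+1})^L,d^*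 )\cong(C^{*,1},d^\uparrow)$; a continuous homomorphism $\varphi:L\to\mathbb{R}$ is represented there by any $a(g_0,g_1)=F(g_1)-F(g_0)$ with $F:G\to\mathbb{R}$ measurable and $F(lg)=\varphi(l)+F(g)$ for $l\in L$. Given a class in $H^1_m(L)$ represented by $a\in C^{1,1}$ with $d^\uparrow a=0$, there is $\beta\in C^{0,2}$ with $d^\uparrow\beta=d^\rightarrow a$; then $\omega=d^\rightarrow\beta\in C^{0,3}$ satisfies $d^\uparrow\omega=0$, hence is constant in the $G$-variable and defines a cocycle in $L^0((G/L)^3)^G$, whose class in $H^2_m(G\curvearrowright G/L)$ is the image of the given class under $i$. *)

theory Defs
  imports "HOL-Analysis.Analysis" "HOL-Algebra.Exact_Sequence"
begin

section \<open>The groups and their measures\<close>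

definition SL2 :: "('k::{real_normed_field,euclidean_space}^2^2) set" where
  "SL2 = {g. det g = 1}"

definition unip :: "'k::{real_normed_field,euclidean_space} \<Rightarrow> 'k^2^2" where
  "unip t = vector [vector [1, t], vector [0, 1]]"

text \<open>The group \<open>N\<close>. The logarithm of \<open>unip t\<close> is the nilpotent matrix with upper right
  entry \<open>t\<close>, so under the identification of the Lie algebra with the field, \<open>log (unip t) = t\<close>.\<close>

definition Unip :: "('k::{real_normed_field,euclidean_space}^2^2) set" where
  "Unip = range unip"

text \<open>Haar measure on \<open>SL2\<close>. Dividing the first column by the determinant maps the invertible
  matrices to \<open>SL2\<close>, and this map commutes with left multiplication by \<open>SL2\<close>, which also preserves
  Lebesgue measure and the determinant. The push-forward of Lebesgue measure on the matrices with
  \<open>0 < norm (det M) \<le> 1\<close> is therefore left invariant; the bound on the determinant makes it finite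
  on compact sets.\<close>

definition unit_det :: "'k::{real_normed_field,euclidean_space}^2^2 \<Rightarrow> 'k^2^2" where
  "unit_det M = (\<chi> i j. if j = 1 then M $ i $ j / det M else M $ i $ j)"

definition haar :: "('k::{real_normed_field,euclidean_space}^2^2) measure" where
  "haar = distr (restrict_space lborel {M. det M \<noteq> 0 \<and> norm (det M) \<le> 1})
            (restrict_space borel SL2) unit_det"

text \<open>The homogeneous space \<open>SL2 / Unip\<close> is the punctured plane, via \<open>g Unip \<mapsto> g *v e1\<close>;
  its invariant measure class is that of Lebesgue measure.\<close>

abbreviation e1 :: "'k::{real_normed_field,euclidean_space}^2" where
  "e1 \<equiv> axis 1 1"

definition plane :: "('k::{real_normed_field,euclidean_space}^2) measure" where
  "plane = restrict_space lborel (- {0})"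

section \<open>Cochains\<close>

text \<open>A point of \<open>SL2\<^sup>m \<times> (SL2/Unip)\<^sup>q\<close> is a pair of tuples, indexed by \<open>{..<m}\<close> and \<open>{..<q}\<close>.
  The space written \<open>C\<^sup>p\<^sup>,\<^sup>q\<close> in the usual numbering has \<open>m = p + 1\<close>; \<open>m = 0\<close> or \<open>q = 0\<close> means
  that the respective variables are absent.\<close>

type_synonym 'k point = "(nat \<Rightarrow> 'k^2^2) \<times> (nat \<Rightarrow> 'k^2)"
type_synonym 'k cochain = "'k point \<Rightarrow> real"

definition pts :: "nat \<Rightarrow> nat \<Rightarrow> 'k::{real_normed_field,euclidean_space} point measure" where
  "pts m q = (\<Pi>\<^sub>M i\<in>{..<m}. haar) \<Otimes>\<^sub>M (\<Pi>\<^sub>M j\<in>{..<q}. plane)"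

definition act :: "nat \<Rightarrow> nat \<Rightarrow> 'k::{real_normed_field,euclidean_space}^2^2 \<Rightarrow> 'k point \<Rightarrow> 'k point"
  where "act m q g = (\<lambda>(y, x). (\<lambda>i\<in>{..<m}. g ** y i, \<lambda>j\<in>{..<q}. g *v x j))"

text \<open>Representatives of the \<open>L\<close>-invariant elements of \<open>L\<^sup>0\<close>. Equality almost everywhere is
  divided out when passing to cohomology.\<close>

definition L0inv ::
  "('k::{real_normed_field,euclidean_space}^2^2) set \<Rightarrow> nat \<Rightarrow> nat \<Rightarrow> 'k cochain set" where
  "L0inv L m q = {f \<in> borel_measurable (pts m q).
     \<forall>g\<in>L. AE z in pts m q. f (act m q g z) = f z}"

text \<open>From \<open>Suc n\<close> variables to the \<open>n\<close> variables that remain when number \<open>j\<close> is left out.\<close>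

definition face :: "nat \<Rightarrow> nat \<Rightarrow> (nat \<Rightarrow> 'a) \<Rightarrow> nat \<Rightarrow> 'a" where
  "face n j x = (\<lambda>i\<in>{..<n}. if i < j then x i else x (Suc i))"

text \<open>The differentials on cochains with \<open>m\<close> variables in \<open>SL2\<close> and \<open>q\<close> variables in \<open>SL2/Unip\<close>.
  Note that \<open>d_up 0\<close> is the inclusion of the functions that do not depend on a variable in \<open>SL2\<close>,
  and that \<open>d_right 0\<close> carries no sign.\<close>

definition d_up :: "nat \<Rightarrow> 'k cochain \<Rightarrow> 'k cochain" where
  "d_up m f = (\<lambda>(y, x). \<Sum>j\<le>m. (-1) ^ j * f (face m j y, x))"

definition d_right :: "nat \<Rightarrow> nat \<Rightarrow> 'k cochain \<Rightarrow> 'k cochain" where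
  "d_right m q f = (\<lambda>(y, x). (-1) ^ m * (\<Sum>j\<le>q. (-1) ^ j * f (y, face q j x)))"

section \<open>Cohomology\<close>

definition fun_group :: "('a \<Rightarrow> real) set \<Rightarrow> ('a \<Rightarrow> real) monoid" where
  "fun_group S = \<lparr>carrier = S, mult = (\<lambda>f g z. f z + g z), one = (\<lambda>_. 0)\<rparr>"

text \<open>Cocycles and coboundaries of degree \<open>n > 0\<close> in \<open>L\<^sup>0(SL2\<^sup>*\<^sup>+\<^sup>1)\<^sup>L\<close>.\<close>

definition Z_grp :: "('k::{real_normed_field,euclidean_space}^2^2) set \<Rightarrow> nat \<Rightarrow> 'k cochain set" where
  "Z_grp L n = {f \<in> L0inv L (n + 1) 0. AE z in pts (n + 2) 0. d_up (n + 1) f z = 0}"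

definition B_grp :: "('k::{real_normed_field,euclidean_space}^2^2) set \<Rightarrow> nat \<Rightarrow> 'k cochain set" where
  "B_grp L n = {f \<in> L0inv L (n + 1) 0. \<exists>b \<in> L0inv L n 0. AE z in pts (n + 1) 0. f z = d_up n b z}"

definition H_grp :: "('k::{real_normed_field,euclidean_space}^2^2) set \<Rightarrow> nat \<Rightarrow> 'k cochain set monoid"
  where "H_grp L n = fun_group (Z_grp L n) Mod B_grp L n"

text \<open>Cocycles and coboundaries of degree \<open>n > 0\<close> in \<open>L\<^sup>0((SL2/Unip)\<^sup>*\<^sup>+\<^sup>1)\<close>, invariant under \<open>SL2\<close>.\<close>

definition Z_hom :: "nat \<Rightarrow> 'k::{real_normed_field,euclidean_space} cochain set" where
  "Z_hom n = {f \<in> L0inv SL2 0 (n + 1). AE z in pts 0 (n + 2). d_right 0 (n + 1) f z = 0}"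

definition B_hom :: "nat \<Rightarrow> 'k::{real_normed_field,euclidean_space} cochain set" where
  "B_hom n = {f \<in> L0inv SL2 0 (n + 1). \<exists>b \<in> L0inv SL2 0 n. AE z in pts 0 (n + 1). f z = d_right 0 n b z}"

definition H_hom :: "nat \<Rightarrow> 'k::{real_normed_field,euclidean_space} cochain set monoid" where
  "H_hom n = fun_group (Z_hom n) Mod B_hom n"

definition class_grp ::
  "('k::{real_normed_field,euclidean_space}^2^2) set \<Rightarrow> nat \<Rightarrow> 'k cochain \<Rightarrow> 'k cochain set" where
  "class_grp L n f = B_grp L n #>\<^bsub>fun_group (Z_grp L n)\<^esub> f"

definition class_hom :: "nat \<Rightarrow> 'k::{real_normed_field,euclidean_space} cochain \<Rightarrow> 'k cochain set" where
  "class_hom n f = B_hom n #>\<^bsub>fun_group (Z_hom n)\<^esub> f"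

section \<open>The maps\<close>

text \<open>Maps between cohomology groups are given by relations between cocycles. They send a class to
  the union of the classes of all cocycles related to one of its elements; this union is a single
  class exactly when that class exists and is independent of all choices.\<close>

text \<open>The class of the homomorphism \<open>\<alpha> \<circ> log\<close> on \<open>Unip\<close>.\<close>

definition lin_class :: "('k::{real_normed_field,euclidean_space} \<Rightarrow> real) \<Rightarrow> 'k cochain set" where
  "lin_class \<alpha> = (\<Union>F \<in> {F \<in> borel_measurable haar. \<forall>t. \<forall>g\<in>SL2. F (unip t ** g) = \<alpha> t + F g}.
     class_grp Unip 1 (\<lambda>(y, x). F (y 1) - F (y 0)))"

text \<open>Eckmann--Shapiro induction: \<open>f'(g\<^sub>0, \<dots>, h Unip) = f(h\<inverse> g\<^sub>0, \<dots>)\<close>, for \<open>f\<close> in \<open>m\<close> variables.\<close>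

definition shapiro :: "nat \<Rightarrow> 'k::{real_normed_field,euclidean_space} cochain \<Rightarrow> 'k cochain \<Rightarrow> bool" where
  "shapiro m f f' \<longleftrightarrow> f \<in> L0inv Unip m 0 \<and> f' \<in> L0inv SL2 m 1 \<and>
     (AE (h, y, x) in haar \<Otimes>\<^sub>M pts m 0.
        f' (y, \<lambda>j\<in>{..<1}. h *v e1) = f (\<lambda>i\<in>{..<m}. matrix_inv h ** y i, x))"

definition incl :: "'k::{real_normed_field,euclidean_space} cochain set \<Rightarrow> 'k cochain set" where
  "incl A = (\<Union>\<omega> \<in> {\<omega> \<in> Z_hom 2. \<exists>f\<in>A. \<exists>a \<beta>. shapiro 2 f a \<and> \<beta> \<in> L0inv SL2 1 2 \<and>
       (AE z in pts 2 2. d_up 1 \<beta> z = d_right 2 1 a z) \<and>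
       (AE z in pts 1 3. d_up 0 \<omega> z = d_right 1 2 \<beta> z)}.
     class_hom 2 \<omega>)"

text \<open>Evaluation of cochains of degree \<open>n\<close> on the base point \<open>e1\<close>.\<close>

definition orbit_eval ::
  "nat \<Rightarrow> 'k::{real_normed_field,euclidean_space} cochain \<Rightarrow> 'k cochain" where
  "orbit_eval n f = (\<lambda>(y, x). f (restrict y {}, \<lambda>j\<in>{..<n + 1}. y j *v e1))"

definition eval_class ::
  "nat \<Rightarrow> 'k::{real_normed_field,euclidean_space} cochain set \<Rightarrow> 'k cochain set" where
  "eval_class n A = (\<Union>f\<in>A. class_grp SL2 n (orbit_eval n f))"

section \<open>The explicit cocycle\<close>

definition herm :: "complex^2 \<Rightarrow> complex^2 \<Rightarrow> complex" where
  "herm v w = (\<Sum>k\<in>UNIV. v $ k * cnj (w $ k))"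

definition det2 :: "'k::{real_normed_field,euclidean_space}^2 \<Rightarrow> 'k^2 \<Rightarrow> 'k" where
  "det2 v w = det (\<chi> i j. if j = 1 then v $ i else w $ i)"

definition explicit_cocycle ::
  "('k::{real_normed_field,euclidean_space}^2 \<Rightarrow> 'k^2 \<Rightarrow> 'k) \<Rightarrow> ('k \<Rightarrow> real) \<Rightarrow> 'k cochain" where
  "explicit_cocycle sp \<alpha> = (\<lambda>(y, v). \<Sum>j\<le>2. \<Sum>i<j. (-1) ^ (i + j) *
     (\<alpha> (sp ((1 / det2 (v i) (v j)) *s v i) (v j /\<^sub>R (norm (v j))\<^sup>2)) +
      \<alpha> (sp ((1 / det2 (v i) (v j)) *s v j) (v i /\<^sub>R (norm (v i))\<^sup>2))))"

end

theory Submission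
  imports Defs
begin

text \<open>The groups \<open>L0inv SL2 m q\<close> form a double complex. A generic pair of vectors has trivial
  stabiliser, so its columns with \<open>q \<ge> 2\<close> are exact, and its rows with \<open>m \<ge> 1\<close> are exact because
  \<open>SL2\<close> acts freely on itself; in both cases a contraction inserts one further variable, translated
  by a generic group element so that null sets are avoided. The column \<open>q = 1\<close> computes the
  cohomology of \<open>Unip\<close>. Hence the sequence is a diagram chase, once two facts are known: the first
  cohomology of \<open>SL2\<close> vanishes, and the restriction from \<open>SL2\<close> to \<open>Unip\<close> vanishes in degree two.
  Both rest on the diagonal matrices, conjugation by which dilates \<open>Unip\<close>: a homomorphism
  \<open>\<chi>\<close> on \<open>SL2\<close> satisfies \<open>\<chi> (unip (4 * t)) = \<chi> (unip t)\<close>, and a central extension of \<open>Unip\<close> to which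
  doubling lifts is split.

  For the explicit formula, let \<open>F g = \<alpha> (n)\<close>, where \<open>n\<close> is the unipotent part of \<open>g\<close> in the Iwasawa
  decomposition, and let \<open>frame v w\<close> be the matrix with columns \<open>v\<close> and \<open>w / det2 v w\<close>. Then
  \<open>\<beta> (y; v, w) = F (inverse (frame w v) y) - F (inverse (frame v w) y)\<close> is invariant and its vertical
  differential is the horizontal one of the cocycle induced by \<open>\<alpha>\<close>; at \<open>y = 1\<close> it is the bracket in
  the formula.\<close>

section \<open>Nonsingular maps\<close>

text \<open>Cochains agree only almost everywhere, and each group element has its own null set on
  which invariance may fail. The chase, however, evaluates cochains on null sets: at an inserted
  variable, on the coset of \<open>e1\<close>, along \<open>Unip\<close>. Three devices bridge the
  gap. Maps must pull null sets back to null sets (\<open>nonsing\<close>), so that composition with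
  them respects equality almost everywhere. A cochain with a group variable has a representative
  invariant at every point (\<open>strict\<close>), found by normalising the first group variable.
  Statements about almost all pairs are exchanged by Fubini until one generic element serves almost
  all points. The hardest case is the restriction to \<open>Unip\<close> in degree two: primitives
  chosen for one group element at a time do not depend measurably on it, and measurability must be
  regained before they can be corrected. The two vanishing facts enter at opposite ends: the one in
  degree one makes the map from the cohomology of \<open>Unip\<close> injective, the one in degree
  two makes evaluation surjective.\<close>

definition nonsing :: "'a measure \<Rightarrow> 'b measure \<Rightarrow> ('a \<Rightarrow> 'b) \<Rightarrow> bool" where
  "nonsing A B T \<longleftrightarrow> T \<in> A \<rightarrow>\<^sub>M B \<and> (\<forall>N\<in>null_sets B. T -` N \<inter> space A \<in> null_sets A)"

lemma nonsing_measurable: "nonsing A B T \<Longrightarrow> T \<in> A \<rightarrow>\<^sub>M B"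
  by (simp add: nonsing_def)

lemma nonsing_AE:
  assumes "nonsing A B T" "AE b in B. P b"
  shows "AE a in A. P (T a)"
proof -
  obtain N where N: "N \<in> null_sets B" "{b \<in> space B. \<not> P b} \<subseteq> N"
    using assms(2) unfolding eventually_ae_filter by blast
  have "T -` N \<inter> space A \<in> null_sets A" using assms(1) N(1) by (auto simp: nonsing_def)
  moreover have "{a \<in> space A. \<not> P (T a)} \<subseteq> T -` N \<inter> space A"
    using N(2) measurable_space[OF nonsing_measurable[OF assms(1)]] by auto
  ultimately show ?thesis unfolding eventually_ae_filter by blast
qed

lemma nonsingI:
  assumes T: "T \<in> A \<rightarrow>\<^sub>M B"
    and AE: "\<And>P. Measurable.pred B P \<Longrightarrow> AE b in B. P b \<Longrightarrow> AE a in A. P (T a)"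
  shows "nonsing A B T"
  unfolding nonsing_def
proof (intro conjI ballI T)
  fix N assume N: "N \<in> null_sets B"
  have "Measurable.pred B (\<lambda>b. b \<notin> N)" using N by (auto simp: null_sets_def)
  from AE[OF this] have "AE a in A. T a \<notin> N" using AE_not_in[OF N] by auto
  moreover have "T -` N \<inter> space A \<in> sets A" using T N by (auto simp: null_sets_def)
  ultimately show "T -` N \<inter> space A \<in> null_sets A"
    by (auto simp: AE_iff_null_sets)
qed

lemma nonsing_compose:
  assumes "nonsing A B S" "nonsing B C T"
  shows "nonsing A C (\<lambda>a. T (S a))"
  using nonsing_AE[OF assms(1)] nonsing_AE[OF assms(2)] assms
  by (intro nonsingI) (auto simp: nonsing_def)

lemma nonsing_cong:
  assumes "\<And>a. a \<in> space A \<Longrightarrow> S a = T a"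
  shows "nonsing A B S = nonsing A B T"
proof -
  have "S -` N \<inter> space A = T -` N \<inter> space A" for N using assms by auto
  then show ?thesis unfolding nonsing_def using assms by (simp cong: measurable_cong)
qed

lemma nonsing_eq:
  "nonsing A B S \<Longrightarrow> (\<And>a. a \<in> space A \<Longrightarrow> S a = T a) \<Longrightarrow> nonsing A B T"
  using nonsing_cong by blast

lemma nonsing_ident: "nonsing A A (\<lambda>a. a)"
  by (rule nonsingI) auto

lemma nonsing_distr:
  assumes T: "T \<in> A \<rightarrow>\<^sub>M B" and "distr A B T = B"
  shows "nonsing A B T"
proof (rule nonsingI[OF T])
  fix P assume "Measurable.pred B P" "AE b in B. P b"
  then have "AE b in distr A B T. P b" by (subst assms(2))
  then show "AE a in A. P (T a)" using AE_distrD[OF T] by blast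
qed

section \<open>Fubini, and products of nonsingular maps\<close>

lemma AE_Fubini:
  assumes "sigma_finite_measure A" "sigma_finite_measure B" "AE z in A \<Otimes>\<^sub>M B. P z"
  shows "AE a in A. AE b in B. P (a, b)"
  using pair_sigma_finite.AE_pair[OF pair_sigma_finite.intro[OF assms(1,2)] assms(3)] .

lemma AE_Tonelli:
  assumes "sigma_finite_measure A" "sigma_finite_measure B" "Measurable.pred (A \<Otimes>\<^sub>M B) P"
    and "AE a in A. AE b in B. P (a, b)"
  shows "AE z in A \<Otimes>\<^sub>M B. P z"
  using pair_sigma_finite.AE_pair_measure[OF pair_sigma_finite.intro[OF assms(1,2)] _ assms(4)] assms(3)
  by (simp add: pred_def)

lemma AE_swap:
  assumes "sigma_finite_measure A" "sigma_finite_measure B"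
    and P: "Measurable.pred (A \<Otimes>\<^sub>M B) (\<lambda>(a, b). P a b)"
    and "AE a in A. AE b in B. P a b"
  shows "AE b in B. AE a in A. P a b"
  using pair_sigma_finite.AE_commute[OF pair_sigma_finite.intro[OF assms(1,2)], of P] P assms(4)
  by (simp add: pred_def case_prod_beta)

text \<open>A skew product. Fubini splits a full measure set of the target into base and fibre;
  \<open>S\<close> pulls back the base part, \<open>t a\<close> the fibre over \<open>S a\<close>,
  and Tonelli reassembles them. Most substitutions below, in which a generic parameter is shifted by
  a function of the point, have this form.\<close>

lemma nonsing_pair:
  assumes \<sigma>: "sigma_finite_measure A" "sigma_finite_measure M" "sigma_finite_measure B" "sigma_finite_measure M'"
    and S: "nonsing A B S"
    and t: "(\<lambda>(a, m). t a m) \<in> A \<Otimes>\<^sub>M M \<rightarrow>\<^sub>M M'"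
    and fib: "\<And>a. a \<in> space A \<Longrightarrow> nonsing M M' (t a)"
  shows "nonsing (A \<Otimes>\<^sub>M M) (B \<Otimes>\<^sub>M M') (\<lambda>(a, m). (S a, t a m))"
proof (rule nonsingI)
  note [measurable] = nonsing_measurable[OF S] t
  have t'[measurable]: "(\<lambda>x. t (fst x) (snd x)) \<in> A \<Otimes>\<^sub>M M \<rightarrow>\<^sub>M M'"
    using t by (simp add: case_prod_beta')
  show T[measurable]: "(\<lambda>(a, m). (S a, t a m)) \<in> A \<Otimes>\<^sub>M M \<rightarrow>\<^sub>M B \<Otimes>\<^sub>M M'"
    by (simp add: case_prod_beta')
  fix P assume P[measurable]: "Measurable.pred (B \<Otimes>\<^sub>M M') P" and AE: "AE z in B \<Otimes>\<^sub>M M'. P z"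
  have "AE b in B. AE m in M'. P (b, m)" by (rule AE_Fubini[OF \<sigma>(3,4) AE])
  from nonsing_AE[OF S this] have "AE a in A. AE m in M'. P (S a, m)" .
  then have "AE a in A. AE m in M. P (S a, t a m)"
    using AE_space
  proof eventually_elim
    fix a assume a: "AE m in M'. P (S a, m)" "a \<in> space A"
    show "AE m in M. P (S a, t a m)" by (rule nonsing_AE[OF fib[OF a(2)] a(1)])
  qed
  then show "AE z in A \<Otimes>\<^sub>M M. P ((\<lambda>(a, m). (S a, t a m)) z)"
    by (intro AE_Tonelli[OF \<sigma>(1,2)]) (auto intro: measurable_compose[OF T P])
qed

lemma nonsing_swap:
  assumes \<sigma>: "sigma_finite_measure A" "sigma_finite_measure B"
  shows "nonsing (A \<Otimes>\<^sub>M B) (B \<Otimes>\<^sub>M A) (\<lambda>(a, b). (b, a))"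
proof (rule nonsingI)
  fix P assume [measurable]: "Measurable.pred (B \<Otimes>\<^sub>M A) P" and AE: "AE z in B \<Otimes>\<^sub>M A. P z"
  have "AE b in B. AE a in A. P (b, a)" by (rule AE_Fubini[OF \<sigma>(2,1) AE])
  then have "AE a in A. AE b in B. P (b, a)" by (rule AE_swap[OF \<sigma>(2,1), rotated]) simp
  then show "AE z in A \<Otimes>\<^sub>M B. P ((\<lambda>(a, b). (b, a)) z)"
    by (intro AE_Tonelli[OF \<sigma>(1,2)]) (auto simp: case_prod_beta')
qed simp

lemma sigma_finite_pair:
  assumes "sigma_finite_measure A" "sigma_finite_measure B"
  shows "sigma_finite_measure (A \<Otimes>\<^sub>M B)"
  using assms by (intro sigma_finite_pair_measure)

lemma nonsing_pair_left:
  assumes \<sigma>: "sigma_finite_measure A" "sigma_finite_measure M" "sigma_finite_measure M'"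
    and t: "(\<lambda>(m, a). t m a) \<in> M \<Otimes>\<^sub>M A \<rightarrow>\<^sub>M M'"
    and fib: "\<And>a. a \<in> space A \<Longrightarrow> nonsing M M' (\<lambda>m. t m a)"
  shows "nonsing (M \<Otimes>\<^sub>M A) (M' \<Otimes>\<^sub>M A) (\<lambda>(m, a). (t m a, a))"
proof -
  have "(\<lambda>(a, m). t m a) \<in> A \<Otimes>\<^sub>M M \<rightarrow>\<^sub>M M'"
    using measurable_compose[OF measurable_pair_swap' t] by (simp add: case_prod_beta')
  note a = nonsing_pair[OF \<sigma>(1,2,1,3) nonsing_ident this fib, simplified]
  show ?thesis
    using nonsing_compose[OF nonsing_compose[OF nonsing_swap[OF \<sigma>(2,1)] a] nonsing_swap[OF \<sigma>(1,3)]]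
    by (simp add: case_prod_beta')
qed

lemma nonsing_snd:
  assumes "sigma_finite_measure A" "sigma_finite_measure B"
  shows "nonsing (A \<Otimes>\<^sub>M B) B snd"
proof (rule nonsingI)
  fix P assume "Measurable.pred B P" "AE b in B. P b"
  then show "AE z in A \<Otimes>\<^sub>M B. P (snd z)"
    by (intro AE_Tonelli[OF assms]) auto
qed simp

lemma nonsing_fst:
  assumes "sigma_finite_measure A" "sigma_finite_measure B"
  shows "nonsing (A \<Otimes>\<^sub>M B) A fst"
proof (rule nonsingI)
  fix P assume [measurable]: "Measurable.pred A P" and P: "AE b in A. P b"
  show "AE z in A \<Otimes>\<^sub>M B. P (fst z)"
    by (intro AE_Tonelli[OF assms]) (use P in auto)
qed simp

lemma nonsing_map_fst:
  assumes \<sigma>: "sigma_finite_measure A" "sigma_finite_measure B" "sigma_finite_measure C"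
    and S: "nonsing A B S"
  shows "nonsing (A \<Otimes>\<^sub>M C) (B \<Otimes>\<^sub>M C) (\<lambda>(a, c). (S a, c))"
  using nonsing_pair[OF \<sigma>(1,3,2,3) S, of "\<lambda>a c. c"] nonsing_ident by (auto simp: case_prod_beta')

lemma nonsing_map_snd:
  assumes \<sigma>: "sigma_finite_measure A" "sigma_finite_measure B" "sigma_finite_measure C"
    and S: "nonsing A B S"
  shows "nonsing (C \<Otimes>\<^sub>M A) (C \<Otimes>\<^sub>M B) (\<lambda>(c, a). (c, S a))"
  using nonsing_pair[OF \<sigma>(3,1,3,2) nonsing_ident, of "\<lambda>a c. S c"] nonsing_measurable[OF S] S
  by (auto simp: case_prod_beta')

lemma nonsing_assoc:
  assumes \<sigma>: "sigma_finite_measure A" "sigma_finite_measure B" "sigma_finite_measure C"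
  shows "nonsing (A \<Otimes>\<^sub>M (B \<Otimes>\<^sub>M C)) ((A \<Otimes>\<^sub>M B) \<Otimes>\<^sub>M C) (\<lambda>(a, b, c). ((a, b), c))"
proof (rule nonsingI)
  fix P assume [measurable]: "Measurable.pred ((A \<Otimes>\<^sub>M B) \<Otimes>\<^sub>M C) P" and AE: "AE z in (A \<Otimes>\<^sub>M B) \<Otimes>\<^sub>M C. P z"
  have "AE ab in A \<Otimes>\<^sub>M B. AE c in C. P (ab, c)"
    by (rule AE_Fubini[OF sigma_finite_pair[OF \<sigma>(1,2)] \<sigma>(3) AE])
  then have "AE a in A. AE b in B. AE c in C. P ((a, b), c)"
    by (rule AE_Fubini[OF \<sigma>(1,2)])
  then have "AE a in A. AE z in B \<Otimes>\<^sub>M C. P ((a, fst z), snd z)"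
    using AE_space
  proof eventually_elim
    case (elim a)
    then have [measurable]: "a \<in> space A" by simp
    show ?case by (rule AE_Tonelli[OF \<sigma>(2,3)]) (use elim in auto)
  qed
  then show "AE z in A \<Otimes>\<^sub>M (B \<Otimes>\<^sub>M C). P ((\<lambda>(a, b, c). ((a, b), c)) z)"
    by (intro AE_Tonelli[OF \<sigma>(1) sigma_finite_pair[OF \<sigma>(2,3)]]) (auto simp: case_prod_beta')
qed simp

lemma nonsing_assoc':
  assumes \<sigma>: "sigma_finite_measure A" "sigma_finite_measure B" "sigma_finite_measure C"
  shows "nonsing ((A \<Otimes>\<^sub>M B) \<Otimes>\<^sub>M C) (A \<Otimes>\<^sub>M (B \<Otimes>\<^sub>M C)) (\<lambda>((a, b), c). (a, b, c))"
proof -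
  note s = sigma_finite_pair[OF \<sigma>(1,2)] sigma_finite_pair[OF \<sigma>(3,1)] sigma_finite_pair[OF \<sigma>(2,3)]
  note 1 = nonsing_compose[OF nonsing_swap[OF s(1) \<sigma>(3)] nonsing_assoc[OF \<sigma>(3,1,2)]]
  note 2 = nonsing_compose[OF nonsing_swap[OF s(2) \<sigma>(2)] nonsing_assoc[OF \<sigma>(2,3,1)]]
  note 3 = nonsing_compose[OF nonsing_compose[OF 1 2] nonsing_swap[OF s(3) \<sigma>(1)]]
  show ?thesis using 3 by (simp add: case_prod_beta')
qed

text \<open>The preimage of a null set under \<open>f\<close> is its image under the inverse
  \<open>g\<close>, and differentiable maps send negligible sets to negligible sets. This works on
  any Euclidean space, in particular on matrices over the field.\<close>

lemma nonsing_lborel_linear: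
  fixes f :: "'a::euclidean_space \<Rightarrow> 'a"
  assumes f: "linear f" and g: "linear g" and gf: "\<And>x. g (f x) = x" and fg: "\<And>x. f (g x) = x"
  shows "nonsing lborel lborel f"
  unfolding nonsing_def
proof (intro conjI ballI)
  show m: "f \<in> lborel \<rightarrow>\<^sub>M lborel"
    using borel_measurable_continuous_onI[OF linear_continuous_on[of f UNIV]] f
    by (simp add: linear_conv_bounded_linear)
  fix N :: "'a set" assume N: "N \<in> null_sets lborel"
  have eq: "f -` N = g ` N" using gf fg by (auto simp: image_iff) metis
  have "negligible N"
    using N by (simp add: negligible_iff_null_sets null_sets_completionI)
  then have "negligible (g ` N)"
    using g by (intro negligible_differentiable_image_negligible linear_imp_differentiable_on) auto
  moreover have "f -` N \<inter> space lborel \<in> sets lborel" using measurable_sets[OF m, of N] N by (simp add: null_sets_def)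
  ultimately show "f -` N \<inter> space lborel \<in> null_sets lborel"
    by (subst null_sets_completion_iff[symmetric]) (simp_all add: eq negligible_iff_null_sets)
qed

lemma nonsing_lborel_affine:
  fixes f :: "'a::euclidean_space \<Rightarrow> 'a"
  assumes f: "linear f" and g: "linear g" and gf: "\<And>x. g (f x) = x" and fg: "\<And>x. f (g x) = x"
  shows "nonsing lborel lborel (\<lambda>x. c + f x)"
proof (rule nonsing_compose[OF nonsing_lborel_linear[OF assms]])
  show "nonsing lborel lborel ((+) c)"
    using lborel_distr_plus[of c] by (intro nonsing_distr) (simp_all cong: distr_cong)
qed

section \<open>Tuples\<close>

abbreviation pow_measure :: "nat \<Rightarrow> 'a measure \<Rightarrow> (nat \<Rightarrow> 'a) measure" where
  "pow_measure n M \<equiv> \<Pi>\<^sub>M i\<in>{..<n}. M"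

definition ins :: "nat \<Rightarrow> nat \<Rightarrow> 'a \<Rightarrow> (nat \<Rightarrow> 'a) \<Rightarrow> nat \<Rightarrow> 'a" where
  "ins n j u y = (\<lambda>i\<in>{..n}. if i < j then y i else if i = j then u else y (i - 1))"

lemma face_ins:
  assumes "y \<in> extensional {..<n}" "j \<le> n" shows "face n j (ins n j u y) = y"
  by (rule extensionalityI[of _ "{..<n}"]) (use assms in \<open>auto simp: face_def ins_def\<close>)

lemma face_Suc_ins_0: "j \<le> n \<Longrightarrow> face (Suc n) (Suc j) (ins (Suc n) 0 u y) = ins n 0 u (face n j y)"
  by (rule extensionalityI[of _ "{..<Suc n}"]) (auto simp: face_def ins_def)

text \<open>The simplicial identity behind the vanishing of both squared differentials.\<close>

lemma face_face:
  assumes "i \<le> j" "j \<le> n"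
  shows "face n j (face (Suc n) i y) = face n i (face (Suc n) (Suc j) y)"
  by (rule extensionalityI[of _ "{..<n}"]) (use assms in \<open>auto simp: face_def\<close>)

lemma measurable_ins [measurable (raw)]:
  assumes [measurable]: "u \<in> A \<rightarrow>\<^sub>M M" "y \<in> A \<rightarrow>\<^sub>M (\<Pi>\<^sub>M i\<in>{..<n}. M)" and "j \<le> n"
  shows "(\<lambda>a. ins n j (u a) (y a)) \<in> A \<rightarrow>\<^sub>M (\<Pi>\<^sub>M i\<in>{..<Suc n}. M)"
proof (rule measurable_PiM_single')
  show "(\<lambda>a. ins n j (u a) (y a)) \<in> space A \<rightarrow> {..<Suc n} \<rightarrow>\<^sub>E space M"
  proof (intro PiE_I Pi_I)
    fix a i assume a: "a \<in> space A" and i: "i \<in> {..<Suc n}"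
    have "y a \<in> {..<n} \<rightarrow>\<^sub>E space M" using measurable_space[OF assms(2) a] by (simp add: space_PiM)
    moreover have "(if i < j then i else i - 1) \<in> {..<n}" if "i \<noteq> j" using that i assms(3) by auto
    ultimately have "y a (if i < j then i else i - 1) \<in> space M" if "i \<noteq> j" using PiE_mem that by blast
    then show "ins n j (u a) (y a) i \<in> space M"
      using measurable_space[OF assms(1) a] i by (auto simp: ins_def)
  qed (auto simp: ins_def)
  fix i assume "i \<in> {..<Suc n}"
  then show "(\<lambda>a. ins n j (u a) (y a) i) \<in> A \<rightarrow>\<^sub>M M"
    using assms(3) by (cases "i < j"; cases "i = j") (auto simp: ins_def)
qed

lemma measurable_face [measurable (raw)]:
  assumes [measurable]: "y \<in> A \<rightarrow>\<^sub>M (\<Pi>\<^sub>M i\<in>{..<Suc n}. M)"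
  shows "(\<lambda>a. face n j (y a)) \<in> A \<rightarrow>\<^sub>M (\<Pi>\<^sub>M i\<in>{..<n}. M)"
  unfolding face_def by (rule measurable_restrict) auto

text \<open>A product measure is determined by its values on boxes, and the preimage of a box is the
  product of the same sides with side \<open>j\<close> split off.\<close>

lemma distr_ins:
  assumes \<sigma>: "sigma_finite_measure M" and j: "j \<le> n"
  shows "distr (M \<Otimes>\<^sub>M (\<Pi>\<^sub>M i\<in>{..<n}. M)) (\<Pi>\<^sub>M i\<in>{..<Suc n}. M) (\<lambda>(u, y). ins n j u y) = (\<Pi>\<^sub>M i\<in>{..<Suc n}. M)"
proof -
  interpret P: product_sigma_finite "\<lambda>_. M" using \<sigma> by (simp add: product_sigma_finite_def)
  interpret F: finite_product_sigma_finite "\<lambda>_. M" "{..<n}" by standard simp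
  interpret sigma_finite_measure M by fact
  show ?thesis
  proof (rule P.PiM_eqI)
    fix A :: "nat \<Rightarrow> 'a set" assume A: "\<And>i. i \<in> {..<Suc n} \<Longrightarrow> A i \<in> sets M"
    define B where "B i = A (if i < j then i else Suc i)" for i
    have B: "B i \<in> sets M" if "i < n" for i using A that j by (auto simp: B_def)
    have eq: "(\<lambda>(u, y). ins n j u y) -` Pi\<^sub>E {..<Suc n} A \<inter> space (M \<Otimes>\<^sub>M (\<Pi>\<^sub>M i\<in>{..<n}. M)) = A j \<times> Pi\<^sub>E {..<n} B"
    proof (intro equalityI subrelI)
      fix u y assume "(u, y) \<in> (\<lambda>(u, y). ins n j u y) -` Pi\<^sub>E {..<Suc n} A \<inter> space (M \<Otimes>\<^sub>M (\<Pi>\<^sub>M i\<in>{..<n}. M))"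
      then have h: "ins n j u y \<in> Pi\<^sub>E {..<Suc n} A" "(u, y) \<in> space (M \<Otimes>\<^sub>M (\<Pi>\<^sub>M i\<in>{..<n}. M))" by auto
      have y: "y \<in> {..<n} \<rightarrow>\<^sub>E space M" using h(2) by (simp add: space_pair_measure space_PiM)
      have "ins n j u y j \<in> A j" using j by (intro PiE_mem[OF h(1)]) auto
      moreover have "y i \<in> B i" if "i < n" for i
        using PiE_mem[OF h(1), of "if i < j then i else Suc i"] that j by (auto simp: ins_def B_def split: if_splits)
      ultimately show "(u, y) \<in> A j \<times> Pi\<^sub>E {..<n} B" using y j by (auto simp: ins_def PiE_iff)
    next
      fix u y assume "(u, y) \<in> A j \<times> Pi\<^sub>E {..<n} B"
      then have h: "u \<in> A j" "y \<in> Pi\<^sub>E {..<n} B" by auto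
      have yB: "y i \<in> B i" if "i < n" for i using PiE_mem[OF h(2)] that by auto
      have "ins n j u y i \<in> A i" if "i \<le> n" for i
      proof (cases "i < j \<or> i = j")
        case True
        then show ?thesis using h(1) j yB[of i] by (auto simp: ins_def B_def)
      next
        case False
        then obtain k where "i = Suc k" "k < n" "\<not> k < j" using \<open>i \<le> n\<close> by (cases i) auto
        then show ?thesis using False yB[of k] by (auto simp: ins_def B_def)
      qed
      moreover have "u \<in> space M" using h(1) sets.sets_into_space[OF A[of j]] j by auto
      moreover have "y \<in> space (\<Pi>\<^sub>M i\<in>{..<n}. M)"
        using h(2) sets.sets_into_space[OF B] by (auto simp: space_PiM PiE_iff)
      ultimately show "(u, y) \<in> (\<lambda>(u, y). ins n j u y) -` Pi\<^sub>E {..<Suc n} A \<inter> space (M \<Otimes>\<^sub>M (\<Pi>\<^sub>M i\<in>{..<n}. M))"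
        by (auto simp: PiE_iff space_pair_measure ins_def less_Suc_eq_le)
    qed
    have m: "(\<lambda>(u, y). ins n j u y) \<in> M \<Otimes>\<^sub>M (\<Pi>\<^sub>M i\<in>{..<n}. M) \<rightarrow>\<^sub>M (\<Pi>\<^sub>M i\<in>{..<Suc n}. M)"
      using j by (simp add: case_prod_beta')
    \<comment> \<open>\<open>s\<close> enumerates the indices other than \<open>j\<close> in
      increasing order.\<close>
    define s where "s i = (if i < j then i else Suc i)" for i
    have split: "{..<Suc n} = insert j (s ` {..<n})"
    proof (intro equalityI subsetI)
      fix i assume "i \<in> {..<Suc n}"
      then show "i \<in> insert j (s ` {..<n})"
        using j by (cases "i < j"; cases "i = j") (auto simp: image_iff s_def intro: bexI[of _ i] bexI[of _ "i - 1"])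
    qed (use j in \<open>auto simp: s_def split: if_splits\<close>)
    have inj: "inj_on s {..<n}" by (auto simp: inj_on_def s_def split: if_splits)
    have Bs: "B i = A (s i)" for i by (simp add: B_def s_def)
    have jn: "j \<notin> s ` {..<n}" by (auto simp: s_def split: if_splits)
    have FB: "emeasure (\<Pi>\<^sub>M i\<in>{..<n}. M) (Pi\<^sub>E {..<n} B) = (\<Prod>i<n. emeasure M (B i))"
      using B by (intro F.measure_times) auto
    have "emeasure (distr (M \<Otimes>\<^sub>M (\<Pi>\<^sub>M i\<in>{..<n}. M)) (\<Pi>\<^sub>M i\<in>{..<Suc n}. M) (\<lambda>(u, y). ins n j u y)) (Pi\<^sub>E {..<Suc n} A)
      = emeasure M (A j) * (\<Prod>i<n. emeasure M (B i))"
      using A B j by (subst emeasure_distr[OF m])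
        (auto simp: eq F.emeasure_pair_measure_Times FB intro!: sets_PiM_I_finite)
    also have "\<dots> = (\<Prod>i<Suc n. emeasure M (A i))"
      unfolding split using jn by (simp add: prod.reindex[OF inj] Bs)
    finally show "emeasure (distr (M \<Otimes>\<^sub>M (\<Pi>\<^sub>M i\<in>{..<n}. M)) (\<Pi>\<^sub>M i\<in>{..<Suc n}. M) (\<lambda>(u, y). ins n j u y)) (Pi\<^sub>E {..<Suc n} A)
      = (\<Prod>i<Suc n. emeasure M (A i))" .
  qed simp_all
qed

lemma sigma_finite_PiM:
  assumes "sigma_finite_measure M" "finite I"
  shows "sigma_finite_measure (\<Pi>\<^sub>M i\<in>I. M)"
  using assms by (intro product_sigma_finite.sigma_finite) (simp_all add: product_sigma_finite_def)

text \<open>Reduces a claim about tuples to one about a product of two factors, where Fubini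
  applies; \<open>nonsing_ins\<close> goes the other way.\<close>

lemma AE_PiM_SucI:
  assumes \<sigma>: "sigma_finite_measure M" and j: "j \<le> n"
    and P: "Measurable.pred (\<Pi>\<^sub>M i\<in>{..<Suc n}. M) P"
    and AE: "AE z in M \<Otimes>\<^sub>M (\<Pi>\<^sub>M i\<in>{..<n}. M). P (ins n j (fst z) (snd z))"
  shows "AE y in (\<Pi>\<^sub>M i\<in>{..<Suc n}. M). P y"
proof -
  have m: "(\<lambda>(u, y). ins n j u y) \<in> M \<Otimes>\<^sub>M (\<Pi>\<^sub>M i\<in>{..<n}. M) \<rightarrow>\<^sub>M (\<Pi>\<^sub>M i\<in>{..<Suc n}. M)"
    using j by (simp add: case_prod_beta')
  have "AE y in distr (M \<Otimes>\<^sub>M (\<Pi>\<^sub>M i\<in>{..<n}. M)) (\<Pi>\<^sub>M i\<in>{..<Suc n}. M) (\<lambda>(u, y). ins n j u y). P y"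
    by (subst AE_distr_iff[OF m]) (use P AE in \<open>simp_all add: pred_def case_prod_beta'\<close>)
  then show ?thesis by (subst (asm) distr_ins[OF \<sigma> j])
qed

lemma nonsing_ins:
  assumes \<sigma>: "sigma_finite_measure M" and j: "j \<le> n"
  shows "nonsing (M \<Otimes>\<^sub>M (\<Pi>\<^sub>M i\<in>{..<n}. M)) (\<Pi>\<^sub>M i\<in>{..<Suc n}. M) (\<lambda>(u, y). ins n j u y)"
proof (rule nonsing_distr[OF _ distr_ins[OF \<sigma> j]])
  show "(\<lambda>(u, y). ins n j u y) \<in> M \<Otimes>\<^sub>M (\<Pi>\<^sub>M i\<in>{..<n}. M) \<rightarrow>\<^sub>M (\<Pi>\<^sub>M i\<in>{..<Suc n}. M)"
    using j by (simp add: case_prod_beta')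
qed

lemma nonsing_from_Suc:
  assumes \<sigma>: "sigma_finite_measure M" and j: "j \<le> n"
    and m: "T \<in> (\<Pi>\<^sub>M i\<in>{..<Suc n}. M) \<rightarrow>\<^sub>M B"
    and T: "nonsing (M \<Otimes>\<^sub>M (\<Pi>\<^sub>M i\<in>{..<n}. M)) B (\<lambda>z. T (ins n j (fst z) (snd z)))"
  shows "nonsing (\<Pi>\<^sub>M i\<in>{..<Suc n}. M) B T"
proof (rule nonsingI[OF m])
  fix P assume P: "Measurable.pred B P" and AE: "AE b in B. P b"
  show "AE y in (\<Pi>\<^sub>M i\<in>{..<Suc n}. M). P (T y)"
    by (rule AE_PiM_SucI[OF \<sigma> j measurable_compose[OF m P] nonsing_AE[OF T AE]])
qed

lemma PiM_extensional: "y \<in> space (Pi\<^sub>M I M) \<Longrightarrow> y \<in> extensional I"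
  by (simp add: space_PiM PiE_iff)

lemma nonsing_face:
  assumes \<sigma>: "sigma_finite_measure M" and j: "j \<le> n"
  shows "nonsing (\<Pi>\<^sub>M i\<in>{..<Suc n}. M) (\<Pi>\<^sub>M i\<in>{..<n}. M) (face n j)"
proof (rule nonsing_from_Suc[OF \<sigma> j])
  show "face n j \<in> (\<Pi>\<^sub>M i\<in>{..<Suc n}. M) \<rightarrow>\<^sub>M (\<Pi>\<^sub>M i\<in>{..<n}. M)"
    by (intro measurable_face measurable_ident_sets refl)
  show "nonsing (M \<Otimes>\<^sub>M (\<Pi>\<^sub>M i\<in>{..<n}. M)) (\<Pi>\<^sub>M i\<in>{..<n}. M) (\<lambda>z. face n j (ins n j (fst z) (snd z)))"
  proof (rule nonsing_eq[OF nonsing_snd[OF \<sigma> sigma_finite_PiM[OF \<sigma> finite_lessThan]]])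
    fix z :: "'a \<times> (nat \<Rightarrow> 'a)"
    assume "z \<in> space (M \<Otimes>\<^sub>M (\<Pi>\<^sub>M i\<in>{..<n}. M))"
    then have "snd z \<in> extensional {..<n}"
      by (auto simp: space_pair_measure intro: PiM_extensional)
    then show "snd z = face n j (ins n j (fst z) (snd z))" by (simp add: face_ins j)
  qed
qed

text \<open>The empty product is a single point of mass one, so almost everywhere means at that
  point. This starts the inductions on the number of variables.\<close>

lemma AE_PiM_empty: "(AE y in Pi\<^sub>M {} M. P y) \<longleftrightarrow> P (\<lambda>_. undefined)"
  by (subst PiM_empty) (simp add: AE_count_space)

lemma nonsing_PiM_map:
  fixes n :: nat
  assumes \<sigma>: "sigma_finite_measure M" "sigma_finite_measure M'" and T: "nonsing M M' T"
  shows "nonsing (\<Pi>\<^sub>M i\<in>{..<n}. M) (\<Pi>\<^sub>M i\<in>{..<n}. M') (\<lambda>y. \<lambda>i\<in>{..<n}. T (y i))"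
proof (induction n)
  case 0
  show ?case
  proof (rule nonsingI)
    fix P assume "AE b in \<Pi>\<^sub>M i\<in>{..<0::nat}. M'. P b"
    then show "AE y in \<Pi>\<^sub>M i\<in>{..<0::nat}. M. P (\<lambda>i\<in>{..<0}. T (y i))"
      unfolding lessThan_0 AE_PiM_empty restrict_def by simp
  qed (intro measurable_restrict, simp)
next
  case (Suc n)
  note [measurable] = nonsing_measurable[OF T]
  show ?case
  proof (rule nonsing_from_Suc[OF \<sigma>(1) zero_le])
    show "(\<lambda>y. \<lambda>i\<in>{..<Suc n}. T (y i)) \<in> (\<Pi>\<^sub>M i\<in>{..<Suc n}. M) \<rightarrow>\<^sub>M (\<Pi>\<^sub>M i\<in>{..<Suc n}. M')"
      by (intro measurable_restrict) measurable
    note \<sigma>' = \<sigma>[THEN sigma_finite_PiM, of "{..<n}", simplified]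
    have "nonsing (M \<Otimes>\<^sub>M (\<Pi>\<^sub>M i\<in>{..<n}. M)) (M' \<Otimes>\<^sub>M (\<Pi>\<^sub>M i\<in>{..<n}. M')) (\<lambda>(u, y). (T u, \<lambda>i\<in>{..<n}. T (y i)))"
    proof (rule nonsing_pair[OF \<sigma>(1) \<sigma>'(1) \<sigma>(2) \<sigma>'(2) T _ Suc])
      show "(\<lambda>(u, y). \<lambda>i\<in>{..<n}. T (y i)) \<in> M \<Otimes>\<^sub>M (\<Pi>\<^sub>M i\<in>{..<n}. M) \<rightarrow>\<^sub>M (\<Pi>\<^sub>M i\<in>{..<n}. M')"
        unfolding case_prod_beta' by (rule measurable_compose[OF measurable_snd nonsing_measurable[OF Suc]])
    qed
    from nonsing_compose[OF this nonsing_ins[OF \<sigma>(2) zero_le]]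
    show "nonsing (M \<Otimes>\<^sub>M (\<Pi>\<^sub>M i\<in>{..<n}. M)) (\<Pi>\<^sub>M i\<in>{..<Suc n}. M')
          (\<lambda>z. \<lambda>i\<in>{..<Suc n}. T (ins n 0 (fst z) (snd z) i))"
      by (rule nonsing_eq) (auto simp: ins_def fun_eq_iff)
  qed
qed

definition append_tup :: "nat \<Rightarrow> nat \<Rightarrow> (nat \<Rightarrow> 'a) \<Rightarrow> (nat \<Rightarrow> 'a) \<Rightarrow> nat \<Rightarrow> 'a" where
  "append_tup m q y x = (\<lambda>i\<in>{..<m + q}. if i < m then y i else x (i - m))"

lemma measurable_append_tup [measurable (raw)]:
  assumes [measurable]: "y \<in> A \<rightarrow>\<^sub>M (\<Pi>\<^sub>M i\<in>{..<m}. M)" "x \<in> A \<rightarrow>\<^sub>M (\<Pi>\<^sub>M i\<in>{..<q}. M)"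
  shows "(\<lambda>a. append_tup m q (y a) (x a)) \<in> A \<rightarrow>\<^sub>M (\<Pi>\<^sub>M i\<in>{..<m + q}. M)"
  unfolding append_tup_def
proof (rule measurable_restrict)
  fix i assume "i \<in> {..<m + q}"
  then show "(\<lambda>a. if i < m then y a i else x a (i - m)) \<in> A \<rightarrow>\<^sub>M M"
    by (cases "i < m") auto
qed

text \<open>For the maps \<open>orb\<close>, which put the orbit points of the group variables in
  front of the plane variables.\<close>

lemma nonsing_append_tup:
  assumes \<sigma>: "sigma_finite_measure M"
  shows "nonsing ((\<Pi>\<^sub>M i\<in>{..<m}. M) \<Otimes>\<^sub>M (\<Pi>\<^sub>M i\<in>{..<q}. M)) (\<Pi>\<^sub>M i\<in>{..<m + q}. M) (\<lambda>(y, x). append_tup m q y x)"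
proof -
  have s: "sigma_finite_measure (\<Pi>\<^sub>M i\<in>{..<n::nat}. M)" for n
    by (rule sigma_finite_PiM[OF \<sigma>]) simp
  show ?thesis
  proof (induction m)
    case 0
    show ?case unfolding add_0
    proof (rule nonsing_eq[OF nonsing_snd[OF s s]])
      fix z :: "(nat \<Rightarrow> 'a) \<times> (nat \<Rightarrow> 'a)" assume "z \<in> space ((\<Pi>\<^sub>M i\<in>{..<0}. M) \<Otimes>\<^sub>M (\<Pi>\<^sub>M i\<in>{..<q}. M))"
      then have "snd z \<in> extensional {..<q}" by (auto simp: space_pair_measure intro: PiM_extensional)
      then show "snd z = (\<lambda>(y, x). append_tup 0 q y x) z"
        by (auto simp: append_tup_def case_prod_beta' extensional_def fun_eq_iff)
    qed
  next
    case (Suc m)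
    let ?X = "\<Pi>\<^sub>M i\<in>{..<q}. M"
    have "nonsing (M \<Otimes>\<^sub>M ((\<Pi>\<^sub>M i\<in>{..<m}. M) \<Otimes>\<^sub>M ?X)) (\<Pi>\<^sub>M i\<in>{..<Suc (m + q)}. M)
       (\<lambda>(u, z). ins (m + q) 0 u (append_tup m q (fst z) (snd z)))"
      using nonsing_compose[OF nonsing_map_snd[OF sigma_finite_pair[OF s s] s \<sigma> Suc] nonsing_ins[OF \<sigma> zero_le]]
      by (simp add: case_prod_beta')
    note 1 = nonsing_compose[OF nonsing_assoc'[OF \<sigma> s s] this]
    have eq: "append_tup (Suc m) q (ins m 0 u y) x = ins (m + q) 0 u (append_tup m q y x)" for u y x
      by (auto simp: append_tup_def ins_def fun_eq_iff)
    show ?case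
    proof (rule nonsingI)
      show m: "(\<lambda>(y, x). append_tup (Suc m) q y x) \<in> (\<Pi>\<^sub>M i\<in>{..<Suc m}. M) \<Otimes>\<^sub>M ?X \<rightarrow>\<^sub>M (\<Pi>\<^sub>M i\<in>{..<Suc m + q}. M)"
        by (simp only: case_prod_beta') measurable
      fix P assume P: "Measurable.pred (\<Pi>\<^sub>M i\<in>{..<Suc m + q}. M) P" and AE: "AE b in \<Pi>\<^sub>M i\<in>{..<Suc m + q}. M. P b"
      note Pm = measurable_compose[OF m P, simplified case_prod_beta']
      have "AE a in (M \<Otimes>\<^sub>M (\<Pi>\<^sub>M i\<in>{..<m}. M)) \<Otimes>\<^sub>M ?X. P (append_tup (Suc m) q (ins m 0 (fst (fst a)) (snd (fst a))) (snd a))"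
        using nonsing_AE[OF 1 AE[unfolded add_Suc]] by (simp add: case_prod_beta' eq)
      from AE_Fubini[OF sigma_finite_pair[OF \<sigma> s] s this]
      have a: "AE z in M \<Otimes>\<^sub>M (\<Pi>\<^sub>M i\<in>{..<m}. M). AE x in ?X. P (append_tup (Suc m) q (ins m 0 (fst z) (snd z)) x)"
        by simp
      \<comment> \<open>\<open>AE_PiM_SucI\<close> merges the new entry with \<open>y\<close> only
        for a fixed \<open>x\<close>, so the quantifiers are exchanged here and exchanged back
        afterwards.\<close>
      have "AE x in ?X. AE z in M \<Otimes>\<^sub>M (\<Pi>\<^sub>M i\<in>{..<m}. M). P (append_tup (Suc m) q (ins m 0 (fst z) (snd z)) x)"
        by (rule AE_swap[OF sigma_finite_pair[OF \<sigma> s] s _ a])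
          (simp only: case_prod_beta', rule measurable_compose[OF _ P], measurable)
      then have "AE x in ?X. AE y in \<Pi>\<^sub>M i\<in>{..<Suc m}. M. P (append_tup (Suc m) q y x)"
        using AE_space
      proof eventually_elim
        case (elim x)
        then have [measurable]: "x \<in> space ?X" by simp
        show ?case
          by (rule AE_PiM_SucI[OF \<sigma> zero_le _ elim(1)]) (rule measurable_compose[OF _ P], measurable)
      qed
      then have "AE y in \<Pi>\<^sub>M i\<in>{..<Suc m}. M. AE x in ?X. P (append_tup (Suc m) q y x)"
        by (rule AE_swap[OF s s, rotated])
          (simp only: case_prod_beta', rule measurable_compose[OF _ P], measurable)
      then have "AE a in (\<Pi>\<^sub>M i\<in>{..<Suc m}. M) \<Otimes>\<^sub>M ?X. P (append_tup (Suc m) q (fst a) (snd a))"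
        by (intro AE_Tonelli[OF s s Pm]) simp
      then show "AE a in (\<Pi>\<^sub>M i\<in>{..<Suc m}. M) \<Otimes>\<^sub>M ?X. P ((\<lambda>(y, x). append_tup (Suc m) q y x) a)"
        by (simp add: case_prod_beta')
    qed
qed

qed

section \<open>Null sets of the group and of the plane\<close>

lemma borel_measurable_vec_nth [measurable (raw)]:
  fixes f :: "'a \<Rightarrow> 'b::euclidean_space^'n"
  assumes [measurable]: "f \<in> borel_measurable M"
  shows "(\<lambda>x. f x $ i) \<in> borel_measurable M"
  by (rule measurable_compose[OF assms borel_measurable_continuous_onI]) (intro continuous_intros)

text \<open>A vector is the sum of its entries placed along the axes, and placing an entry on an
  axis is continuous.\<close>

lemma borel_measurable_vec:
  fixes f :: "'a \<Rightarrow> 'b::euclidean_space^'n"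
  assumes f: "\<And>i. (\<lambda>x. f x $ i) \<in> borel_measurable M"
  shows "f \<in> borel_measurable M"
proof -
  have eq: "f = (\<lambda>x. \<Sum>i\<in>UNIV. axis i (f x $ i))"
    by (simp add: fun_eq_iff vec_eq_iff axis_def)
  have "continuous_on UNIV (axis i :: 'b \<Rightarrow> 'b^'n)" for i
    unfolding axis_def
  proof (rule continuous_on_vec_lambda)
    show "continuous_on UNIV (\<lambda>x. if j = i then x else (0::'b))" for j by (cases "j = i") auto
  qed
  then have "(\<lambda>x. axis i (f x $ i)) \<in> borel_measurable M" for i
    by (intro measurable_compose[OF f borel_measurable_continuous_onI])
  then show ?thesis by (subst eq) (intro borel_measurable_sum)
qed

lemma borel_measurable_matrix:
  fixes f :: "'a \<Rightarrow> 'b::euclidean_space^'n^'m"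
  assumes "\<And>i j. (\<lambda>x. f x $ i $ j) \<in> borel_measurable M"
  shows "f \<in> borel_measurable M"
  using assms by (intro borel_measurable_vec)

text \<open>The adjugate is the inverse on \<open>SL2\<close>. Being polynomial in the entries, it
  has its measurability and its algebra for free, unlike \<open>matrix_inv\<close>.\<close>

abbreviation adj :: "'k::{real_normed_field,euclidean_space}^2^2 \<Rightarrow> 'k^2^2" where
  "adj g \<equiv> vector [vector [g$2$2, - g$1$2], vector [- g$2$1, g$1$1]]"

section \<open>Algebra of \<open>SL2\<close> and \<open>Unip\<close>\<close>

lemma SL2_iff: "g \<in> SL2 \<longleftrightarrow> g$1$1 * g$2$2 - g$1$2 * g$2$1 = 1"
  by (simp add: SL2_def det_2)

lemmas mat2 = vec_eq_iff forall_2 matrix_matrix_mult_def matrix_vector_mult_def sum_2 mat_def axis_def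

lemma SL2_mult: "g \<in> SL2 \<Longrightarrow> h \<in> SL2 \<Longrightarrow> g ** h \<in> SL2"
  by (simp add: SL2_def det_mul)

lemma mat_1_SL2: "mat 1 \<in> SL2"
  by (simp add: SL2_def)

lemma unip_SL2: "unip t \<in> SL2"
  by (simp add: SL2_iff unip_def)

lemma unip_add: "unip s ** unip t = unip (s + t)"
  by (simp add: mat2 unip_def)

lemma unip_fix: "unip t *v e1 = e1"
  by (simp add: mat2 unip_def)

lemma adj_SL2: "g \<in> SL2 \<Longrightarrow> adj g \<in> SL2"
  by (simp add: SL2_iff algebra_simps)

lemma adj_left: "g \<in> SL2 \<Longrightarrow> adj g ** g = mat 1"
  by (simp add: SL2_iff mat2 algebra_simps)

lemma adj_right: "g \<in> SL2 \<Longrightarrow> g ** adj g = mat 1"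
  by (simp add: SL2_iff mat2 algebra_simps)

lemma adj_mult: "adj (g ** h) = adj h ** adj g"
  by (simp add: mat2 algebra_simps)

lemma adj_adj: "adj (adj g) = g"
  by (simp add: mat2)

lemma matrix_inv_SL2: "g \<in> SL2 \<Longrightarrow> matrix_inv g = adj g"
proof -
  assume g: "g \<in> SL2"
  have "g ** matrix_inv g = mat 1"
    unfolding matrix_inv_def by (rule someI2[of _ "adj g"]) (simp_all add: adj_left[OF g] adj_right[OF g])
  then have "adj g ** (g ** matrix_inv g) = adj g" by simp
  then show ?thesis unfolding matrix_mul_assoc adj_left[OF g] by simp
qed

lemma adj_cancel:
  assumes "g \<in> SL2"
  shows "adj g ** (g ** h) = h" "g ** (adj g ** h) = h" "adj g *v (g *v v) = v" "g *v (adj g *v v) = v"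
  using adj_left[OF assms] adj_right[OF assms] by (simp_all only: matrix_mul_assoc matrix_vector_mul_assoc matrix_mul_lid matrix_vector_mul_lid)

section \<open>Measurability on the group and on the plane\<close>

lemma space_haar: "space haar = SL2"
  by (simp add: haar_def space_restrict_space)

lemma sets_haar: "sets haar = sets (restrict_space borel SL2)"
  by (simp add: haar_def)

lemma space_plane: "space plane = - {0}"
  by (simp add: plane_def space_restrict_space)

lemma sets_plane: "sets plane = sets (restrict_space borel (- {0}))"
  unfolding plane_def by (rule sets_restrict_space_cong) simp

lemma measurable_haar_iff: "f \<in> A \<rightarrow>\<^sub>M haar \<longleftrightarrow> f \<in> borel_measurable A \<and> f \<in> space A \<rightarrow> SL2"
  unfolding measurable_cong_sets[OF refl sets_haar] by (auto simp: measurable_restrict_space2_iff)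

lemma measurable_plane_iff: "f \<in> A \<rightarrow>\<^sub>M plane \<longleftrightarrow> f \<in> borel_measurable A \<and> f \<in> space A \<rightarrow> - {0}"
  unfolding measurable_cong_sets[OF refl sets_plane] by (auto simp: measurable_restrict_space2_iff)

lemma measurable_haar_borel [measurable_dest]: "f \<in> A \<rightarrow>\<^sub>M haar \<Longrightarrow> f \<in> borel_measurable A"
  by (simp add: measurable_haar_iff)

lemma measurable_plane_borel [measurable_dest]: "f \<in> A \<rightarrow>\<^sub>M plane \<Longrightarrow> f \<in> borel_measurable A"
  by (simp add: measurable_plane_iff)

lemma mult_nonzero:
  assumes "g \<in> SL2" "v \<noteq> 0" shows "g *v v \<noteq> 0"
  using adj_cancel(3)[OF assms(1), of v] assms(2) by (metis matrix_vector_mult_0_right)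

lemma borel_measurable_mult_matrix [measurable (raw)]:
  fixes f g :: "'a \<Rightarrow> 'k::{real_normed_field,euclidean_space}^2^2"
  assumes [measurable]: "f \<in> borel_measurable A" "g \<in> borel_measurable A"
  shows "(\<lambda>a. f a ** g a) \<in> borel_measurable A"
  by (rule borel_measurable_matrix) (simp add: matrix_matrix_mult_def)

lemma borel_measurable_mult_vector [measurable (raw)]:
  fixes f :: "'a \<Rightarrow> 'k::{real_normed_field,euclidean_space}^2^2"
  assumes [measurable]: "f \<in> borel_measurable A" "v \<in> borel_measurable A"
  shows "(\<lambda>a. f a *v v a) \<in> borel_measurable A"
  by (rule borel_measurable_vec) (simp add: matrix_vector_mult_def)

lemma measurable_haar_mult [measurable (raw)]:
  "f \<in> A \<rightarrow>\<^sub>M haar \<Longrightarrow> g \<in> A \<rightarrow>\<^sub>M haar \<Longrightarrow> (\<lambda>a. f a ** g a) \<in> A \<rightarrow>\<^sub>M haar"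
  by (auto simp: measurable_haar_iff intro!: SL2_mult borel_measurable_mult_matrix)

lemma measurable_plane_mult [measurable (raw)]:
  "f \<in> A \<rightarrow>\<^sub>M haar \<Longrightarrow> v \<in> A \<rightarrow>\<^sub>M plane \<Longrightarrow> (\<lambda>a. f a *v v a) \<in> A \<rightarrow>\<^sub>M plane"
  by (force simp: measurable_haar_iff measurable_plane_iff intro!: borel_measurable_mult_vector dest: mult_nonzero)

lemma borel_measurable_vector_matrix:
  fixes a b c d :: "'a \<Rightarrow> 'k::{real_normed_field,euclidean_space}"
  assumes [measurable]: "a \<in> borel_measurable A" "b \<in> borel_measurable A" "c \<in> borel_measurable A" "d \<in> borel_measurable A"
  shows "(\<lambda>x. vector [vector [a x, b x], vector [c x, d x]] :: 'k^2^2) \<in> borel_measurable A"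
proof (rule borel_measurable_matrix)
  fix i j :: 2
  show "(\<lambda>x. (vector [vector [a x, b x], vector [c x, d x]] :: 'k^2^2) $ i $ j) \<in> borel_measurable A"
    using exhaust_2[of i] exhaust_2[of j] by auto
qed

lemma measurable_haar_adj [measurable (raw)]:
  assumes f: "f \<in> A \<rightarrow>\<^sub>M haar" shows "(\<lambda>a. adj (f a)) \<in> A \<rightarrow>\<^sub>M haar"
proof -
  have [measurable]: "f \<in> borel_measurable A" using f by measurable
  have "(\<lambda>a. adj (f a)) \<in> borel_measurable A"
    by (intro borel_measurable_vector_matrix) measurable
  then show ?thesis using f by (auto simp: measurable_haar_iff intro!: adj_SL2)
qed

lemma measurable_unip [measurable (raw)]:
  assumes [measurable]: "f \<in> borel_measurable A" shows "(\<lambda>a. unip (f a)) \<in> A \<rightarrow>\<^sub>M haar"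
  unfolding measurable_haar_iff unip_def[abs_def]
  by (intro conjI borel_measurable_vector_matrix Pi_I) (use unip_SL2 in \<open>auto simp: unip_def\<close>)

abbreviation det_ball :: "('k::{real_normed_field,euclidean_space}^2^2) set" where
  "det_ball \<equiv> {M. det M \<noteq> 0 \<and> norm (det M) \<le> 1}"

section \<open>Haar null sets\<close>

lemma borel_measurable_det2:
  fixes f :: "'a \<Rightarrow> 'k::{real_normed_field,euclidean_space}^2^2"
  assumes [measurable]: "f \<in> borel_measurable A"
  shows "(\<lambda>a. det (f a)) \<in> borel_measurable A"
  unfolding det_2 by measurable

lemma det_ball_sets: "det_ball \<in> sets lborel"
proof -
  have [measurable]: "(det :: 'k^2^2 \<Rightarrow> 'k::{real_normed_field,euclidean_space}) \<in> borel_measurable borel"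
    by (rule borel_measurable_det2[OF measurable_ident_sets[OF refl]])
  show ?thesis by measurable
qed

lemma unit_det_SL2:
  assumes "det M \<noteq> 0" shows "unit_det M \<in> SL2"
proof -
  have "M$1$1 / det M * M$2$2 - M$1$2 * (M$2$1 / det M) = (M$1$1 * M$2$2 - M$1$2 * M$2$1) / det M"
    by (simp add: diff_divide_distrib)
  also have "\<dots> = det M / det M" by (simp add: det_2)
  finally show ?thesis using assms by (simp add: SL2_iff unit_det_def)
qed

lemma measurable_unit_det:
  "(unit_det :: 'k::{real_normed_field,euclidean_space}^2^2 \<Rightarrow> _) \<in> restrict_space lborel det_ball \<rightarrow>\<^sub>M restrict_space borel SL2"
proof (rule measurable_restrict_space2)
  show "unit_det \<in> space (restrict_space lborel det_ball) \<rightarrow> SL2"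
    by (auto simp: space_restrict_space intro: unit_det_SL2)
  have "(unit_det :: 'k^2^2 \<Rightarrow> _) \<in> borel_measurable lborel"
  proof (rule borel_measurable_matrix)
    fix i j :: 2
    have [measurable]: "(det :: 'k^2^2 \<Rightarrow> 'k) \<in> borel_measurable borel"
      by (rule borel_measurable_det2[OF measurable_ident_sets[OF refl]])
    show "(\<lambda>x. (unit_det x :: 'k^2^2) $ i $ j) \<in> borel_measurable lborel"
    proof (cases "j = 1")
      case True
      have "(\<lambda>x :: 'k^2^2. x $ i $ j / det x) \<in> borel_measurable lborel" by measurable
      then show ?thesis using True by (simp add: unit_det_def)
    next
      case False
      have "(\<lambda>x :: 'k^2^2. x $ i $ j) \<in> borel_measurable lborel" by measurable
      then show ?thesis using False by (simp add: unit_det_def)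
    qed
  qed
  then show "(unit_det :: 'k^2^2 \<Rightarrow> _) \<in> restrict_space lborel det_ball \<rightarrow>\<^sub>M borel" by (rule measurable_restrict_space1)
qed

text \<open>Moves questions about Haar null sets to Lebesgue measure on matrices, where left
  multiplication is linear.\<close>

lemma AE_haar_iff:
  assumes P: "Measurable.pred haar P"
  shows "(AE g in haar. P g) \<longleftrightarrow> (AE M in lborel. M \<in> det_ball \<longrightarrow> P (unit_det M))"
proof -
  have "{x \<in> space (restrict_space borel SL2). P x} \<in> sets (restrict_space borel SL2)"
    using P by (simp add: pred_def sets_haar space_haar space_restrict_space)
  then have "(AE g in haar. P g) \<longleftrightarrow> (AE M in restrict_space lborel det_ball. P (unit_det M))"
    unfolding haar_def by (rule AE_distr_iff[OF measurable_unit_det])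
  also have "\<dots> \<longleftrightarrow> (AE M in lborel. M \<in> det_ball \<longrightarrow> P (unit_det M))"
    by (rule AE_restrict_space_iff) (use det_ball_sets in simp)
  finally show ?thesis .
qed

lemma AE_plane_iff: "(AE v in plane. P v) \<longleftrightarrow> (AE v in lborel. v \<noteq> 0 \<longrightarrow> P v)"
  unfolding plane_def by (subst AE_restrict_space_iff) auto

lemma unit_det_mult: "h \<in> SL2 \<Longrightarrow> unit_det (h ** M) = h ** unit_det M"
proof -
  assume "h \<in> SL2"
  then have "det (h ** M) = det M" by (simp add: det_mul SL2_def)
  then show ?thesis unfolding unit_det_def by (simp add: mat2 add_divide_distrib)
qed

lemma nonsing_haar_left:
  fixes h :: "'k::{real_normed_field,euclidean_space}^2^2"
  assumes h: "h \<in> SL2" shows "nonsing haar haar ((**) h)"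
proof (rule nonsingI)
  have [measurable]: "(\<lambda>_. h) \<in> haar \<rightarrow>\<^sub>M haar" using h by (simp add: space_haar)
  show m: "(**) h \<in> haar \<rightarrow>\<^sub>M haar" by measurable
  fix P :: "'k^2^2 \<Rightarrow> bool" assume P: "Measurable.pred haar P" and "AE g in haar. P g"
  then have "AE M in lborel. M \<in> det_ball \<longrightarrow> P (unit_det M)" by (simp add: AE_haar_iff)
  moreover have "nonsing lborel lborel ((**) h)"
  proof (rule nonsing_lborel_linear)
    show "linear ((**) h)" "linear ((**) (adj h))"
      by (rule linearI; simp add: mat2 algebra_simps scaleR_add_right)+
  qed (simp_all add: adj_cancel[OF h])
  ultimately have "AE M in lborel. h ** M \<in> det_ball \<longrightarrow> P (unit_det (h ** M))"
    by (rule nonsing_AE[rotated])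
  then have "AE M in lborel. M \<in> det_ball \<longrightarrow> P (h ** unit_det M)"
    using h by (simp add: unit_det_mult det_mul SL2_def)
  then show "AE g in haar. P (h ** g)"
    using measurable_compose[OF m P] by (subst AE_haar_iff) auto
qed

lemma nonsing_plane_mult:
  fixes g :: "'k::{real_normed_field,euclidean_space}^2^2"
  assumes g: "g \<in> SL2" shows "nonsing plane plane ((*v) g)"
proof (rule nonsingI)
  have [measurable]: "(\<lambda>_. g) \<in> plane \<rightarrow>\<^sub>M haar" using g by (simp add: space_haar)
  show m: "(*v) g \<in> plane \<rightarrow>\<^sub>M plane" by measurable
  fix P :: "'k^2 \<Rightarrow> bool" assume P: "Measurable.pred plane P" and "AE v in plane. P v"
  then have "AE v in lborel. v \<noteq> 0 \<longrightarrow> P v" by (simp add: AE_plane_iff)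
  moreover have "nonsing lborel lborel ((*v) g)"
  proof (rule nonsing_lborel_linear)
    show "linear ((*v) g)" "linear ((*v) (adj g))"
      by (rule linearI; simp add: mat2 algebra_simps scaleR_add_right)+
  qed (simp_all add: adj_cancel[OF g])
  ultimately have "AE v in lborel. g *v v \<noteq> 0 \<longrightarrow> P (g *v v)"
    by (rule nonsing_AE[rotated])
  then have "AE v in lborel. v \<noteq> 0 \<longrightarrow> P (g *v v)"
    using mult_nonzero[OF g] by (auto elim: AE_mp)
  then show "AE g' in plane. P (g *v g')" by (simp add: AE_plane_iff)
qed

text \<open>Bounded sets have finite measure: undoing \<open>unit_det\<close> multiplies the first
  column by the determinant, whose norm is at most one, so bounded matrices have bounded
  preimages.\<close>

lemma sigma_finite_haar: "sigma_finite_measure (haar :: ('k::{real_normed_field,euclidean_space}^2^2) measure)"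
proof
  define B where "B n = {g :: 'k^2^2. g \<in> SL2 \<and> (\<forall>i j. norm (g$i$j) \<le> real n)}" for n
  have B: "B n \<in> sets haar" for n
  proof -
    have "{g \<in> space haar. \<forall>i j. norm (g$i$j) \<le> real n} \<in> sets (haar :: ('k^2^2) measure)"
    proof -
      have [measurable]: "(\<lambda>g :: 'k^2^2. g) \<in> borel_measurable haar"
        by (rule measurable_haar_borel) simp
      show ?thesis by measurable
    qed
    then show ?thesis by (simp add: B_def space_haar)
  qed
  have fin: "emeasure haar (B n) \<noteq> \<infinity>" for n
  proof -
    have sub: "unit_det -` B n \<inter> space (restrict_space lborel det_ball) \<subseteq> {M. \<forall>i j. norm (M$i$j) \<le> real n}"
    proof
      fix M :: "'k^2^2" assume "M \<in> unit_det -` B n \<inter> space (restrict_space lborel det_ball)"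
      then have M: "det M \<noteq> 0" "norm (det M) \<le> 1" "\<And>i j. norm (unit_det M$i$j) \<le> real n"
        by (auto simp: B_def space_restrict_space)
      have "norm (M$i$j) \<le> real n" for i j
      proof (cases "j = 1")
        case True
        have "norm (M$i$j) = norm (unit_det M$i$j) * norm (det M)"
          using M(1) True by (simp add: unit_det_def norm_divide)
        also have "\<dots> \<le> real n * 1" using M(2,3) by (intro mult_mono) auto
        finally show ?thesis by simp
      qed (use M(3)[of i j] in \<open>simp add: unit_det_def\<close>)
      then show "M \<in> {M. \<forall>i j. norm (M$i$j) \<le> real n}" by simp
    qed
    have "bounded {M :: 'k^2^2. \<forall>i j. norm (M$i$j) \<le> real n}"
    proof (rule boundedI[of _ "4 * real n"])
      fix M :: "'k^2^2" assume M: "M \<in> {M. \<forall>i j. norm (M$i$j) \<le> real n}"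
      have "norm M \<le> (\<Sum>i\<in>UNIV. norm (M$i))" by (simp add: norm_vec_def L2_set_le_sum)
      also have "\<dots> \<le> (\<Sum>i\<in>(UNIV::2 set). 2 * real n)"
      proof (rule sum_mono)
        fix i :: 2
        have "norm (M$i) \<le> (\<Sum>j\<in>UNIV. norm (M$i$j))" by (simp add: norm_vec_def[of "M$i"] L2_set_le_sum)
        also have "\<dots> \<le> (\<Sum>j\<in>(UNIV::2 set). real n)" using M by (intro sum_mono) auto
        finally show "norm (M$i) \<le> 2 * real n" by simp
      qed
      finally show "norm M \<le> 4 * real n" by simp
    qed
    from bounded_subset[OF this sub] have b: "bounded (unit_det -` B n \<inter> space (restrict_space lborel det_ball))" .
    have "emeasure haar (B n) = emeasure (restrict_space lborel det_ball) (unit_det -` B n \<inter> space (restrict_space lborel det_ball))"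
      using B unfolding haar_def by (intro emeasure_distr measurable_unit_det) simp
    also have "\<dots> = emeasure lborel (unit_det -` B n \<inter> space (restrict_space lborel det_ball))"
      by (rule emeasure_restrict_space) (use det_ball_sets in \<open>auto simp: space_restrict_space\<close>)
    also have "\<dots> < \<infinity>" using emeasure_bounded_finite[OF b] by simp
    finally show ?thesis by simp
  qed
  have "\<Union>(range B) = space haar"
  proof (intro equalityI subsetI)
    fix g :: "'k^2^2" assume g: "g \<in> space haar"
    have "norm (g$i$j) \<le> real (nat \<lceil>norm g\<rceil>)" for i j
      using Finite_Cartesian_Product.norm_nth_le[of "g$i" j] Finite_Cartesian_Product.norm_nth_le[of g i]
        real_nat_ceiling_ge[of "norm g"] by linarith
    then have "g \<in> B (nat \<lceil>norm g\<rceil>)" using g unfolding B_def space_haar by blast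
    then show "g \<in> \<Union>(range B)" by blast
  qed (auto simp: B_def space_haar)
  then show "\<exists>A. countable A \<and> A \<subseteq> sets haar \<and> \<Union>A = space (haar :: ('k^2^2) measure) \<and> (\<forall>a\<in>A. emeasure haar a \<noteq> \<infinity>)"
    using B fin by (intro exI[of _ "range B"]) auto
qed

lemma sigma_finite_plane: "sigma_finite_measure (plane :: ('k::{real_normed_field,euclidean_space}^2) measure)"
  unfolding plane_def by (rule sigma_finite_measure_restrict_space) (auto intro: lborel.sigma_finite_measure_axioms)

text \<open>The matrices with determinant of norm strictly between 0 and 1 form a nonempty open set.
  That the measure is not zero is what permits the choice of a generic element in
  \<open>AE_haar_obtain\<close>.\<close>

lemma AE_haar_not_False: "\<not> (AE g in (haar :: ('k::{real_normed_field,euclidean_space}^2^2) measure). False)"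
proof
  assume "AE g in (haar :: ('k^2^2) measure). False"
  then have ae: "AE M :: 'k^2^2 in lborel. M \<notin> det_ball" by (simp add: AE_haar_iff)
  define D where "D = {M :: 'k^2^2. det M \<noteq> 0} \<inter> {M. norm (det M) < 1}"
  have c: "continuous_on UNIV (det :: 'k^2^2 \<Rightarrow> 'k)"
    unfolding det_2[abs_def] by (intro continuous_intros)
  have "open D" unfolding D_def
    by (intro open_Int open_Collect_neq open_Collect_less continuous_intros c)
  moreover have "vector [vector [1, 0], vector [0, of_real (1/2)]] \<in> D"
    by (simp add: D_def det_2)
  then have "D \<noteq> {}" by auto
  ultimately have "\<not> negligible D" by (rule open_not_negligible)
  moreover have "D \<in> sets lborel" using \<open>open D\<close> by simp
  then have "D \<in> null_sets lborel" using ae by (subst AE_iff_null_sets) (auto simp: D_def elim!: AE_mp)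
  then have "negligible D" by (simp add: negligible_iff_null_sets null_sets_completionI)
  ultimately show False by simp
qed

lemma AE_haar_obtain:
  assumes "AE g in haar. P g" obtains g where "g \<in> SL2" "P g"
proof -
  have "\<exists>g. g \<in> SL2 \<and> P g"
  proof (rule ccontr)
    assume "\<nexists>g. g \<in> SL2 \<and> P g"
    then have eq: "(g \<in> SL2 \<and> P g) = False" for g by blast
    have "AE g in haar. g \<in> SL2 \<and> P g" using assms AE_space[of haar]
      by eventually_elim (simp add: space_haar)
    then show False unfolding eq using AE_haar_not_False by blast
  qed
  then show ?thesis using that by blast
qed

text \<open>Left invariance gives \<open>P (adj h ** g)\<close> for almost all \<open>g\<close>,
  whatever \<open>h\<close> is. After exchanging the two, one \<open>g\<close> serves almost all
  \<open>h\<close>, and replacing \<open>h\<close> by \<open>g ** h\<close> leaves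
  \<open>P (adj h)\<close>.\<close>

lemma nonsing_haar_adj: "nonsing haar haar (adj :: 'k::{real_normed_field,euclidean_space}^2^2 \<Rightarrow> _)"
proof (rule nonsingI)
  show m[measurable]: "adj \<in> haar \<rightarrow>\<^sub>M haar" by measurable
  fix P :: "'k^2^2 \<Rightarrow> bool" assume P[measurable]: "Measurable.pred haar P" and ae: "AE g in haar. P g"
  have "AE g in haar. P (adj h ** g)" if "h \<in> SL2" for h
    by (rule nonsing_AE[OF nonsing_haar_left[OF adj_SL2[OF that]] ae])
  then have "AE h in haar. AE g in haar. P (adj h ** g)" by - (rule AE_I2, simp add: space_haar)
  then have "AE g in haar. AE h in haar. P (adj h ** g)"
    by (rule AE_swap[OF sigma_finite_haar sigma_finite_haar, rotated]) measurable
  then obtain g where g: "g \<in> SL2" "AE h in haar. P (adj h ** g)" by (rule AE_haar_obtain)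
  have "AE h in haar. P (adj (g ** h) ** g)"
    by (rule nonsing_AE[OF nonsing_haar_left[OF g(1)] g(2)])
  then show "AE h in haar. P (adj h)"
    unfolding adj_mult matrix_mul_assoc[symmetric] adj_left[OF g(1)] matrix_mul_rid .
qed

text \<open>Inversion conjugates right multiplication to left multiplication, which settles null
  sets without a modular function.\<close>

lemma nonsing_haar_right:
  assumes h: "h \<in> SL2" shows "nonsing haar haar (\<lambda>g. g ** h)"
proof -
  have "nonsing haar haar (\<lambda>g. adj (adj h ** adj g))"
    by (rule nonsing_compose[OF nonsing_compose[OF nonsing_haar_adj nonsing_haar_left[OF adj_SL2[OF h]]] nonsing_haar_adj])
  then show ?thesis unfolding adj_mult adj_adj .
qed

section \<open>The orbit map from the group to the plane\<close>

lemma AE_plane_obtain: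
  assumes "AE v in plane. P v" obtains v where "v \<noteq> 0" "P v"
proof -
  have "\<exists>v. v \<noteq> 0 \<and> P v"
  proof (rule ccontr)
    assume "\<nexists>v. v \<noteq> 0 \<and> P v"
    then have eq: "(v \<noteq> 0 \<and> P v) = False" for v by blast
    have "AE v in lborel. v \<noteq> 0 \<and> P v"
      using AE_lborel_singleton[of "0 :: 'a^2"] assms[unfolded AE_plane_iff] by eventually_elim simp
    then have "AE v in (lborel :: ('a^2) measure). False" unfolding eq .
    then have "emeasure lborel (UNIV :: ('a^2) set) = 0" by (simp add: AE_iff_measurable[of UNIV])
    then show False by (simp add: emeasure_lborel_UNIV)
  qed
  then show ?thesis using that by blast
qed

text \<open>A Borel section of the orbit map of \<open>e1\<close>, given by one formula for each
  choice of a nonzero entry.\<close>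

definition section_mat :: "'k::{real_normed_field,euclidean_space}^2 \<Rightarrow> 'k^2^2" where
  "section_mat v = (if v$1 \<noteq> 0 then vector [vector [v$1, 0], vector [v$2, inverse (v$1)]]
     else vector [vector [0, - inverse (v$2)], vector [v$2, 0]])"

lemma section_mat:
  assumes "v \<noteq> 0" shows "section_mat v \<in> SL2" "section_mat v *v e1 = v"
proof -
  have "v$1 \<noteq> 0 \<or> v$2 \<noteq> 0" using assms by (auto simp: vec_eq_iff forall_2)
  then show "section_mat v \<in> SL2" "section_mat v *v e1 = v"
    by (auto simp: section_mat_def SL2_iff mat2)
qed

lemma measurable_section_mat [measurable (raw)]:
  assumes f: "f \<in> A \<rightarrow>\<^sub>M plane" shows "(\<lambda>a. section_mat (f a)) \<in> A \<rightarrow>\<^sub>M haar"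
proof -
  have [measurable]: "f \<in> borel_measurable A" using f by measurable
  have "(\<lambda>a. section_mat (f a)) \<in> borel_measurable A"
    unfolding section_mat_def
    by (intro measurable_If borel_measurable_vector_matrix) measurable
  then show ?thesis using f by (auto simp: measurable_haar_iff measurable_plane_iff section_mat(1) Pi_iff)
qed

text \<open>Applying every \<open>g\<close> to almost every \<open>v\<close> and exchanging yields
  some \<open>v\<close> with \<open>P (g *v v)\<close> for almost all \<open>g\<close>. The matrix
  \<open>k\<close> carries \<open>w\<close> to this \<open>v\<close>, so a right translation of
  \<open>g\<close> turns it into \<open>w\<close>.\<close>

lemma nonsing_orbit:
  fixes w :: "'k::{real_normed_field,euclidean_space}^2"
  assumes w: "w \<noteq> 0" shows "nonsing haar plane (\<lambda>g. g *v w)"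
proof (rule nonsingI)
  have [measurable]: "(\<lambda>_. w) \<in> haar \<rightarrow>\<^sub>M plane" using w by (simp add: space_plane)
  show m: "(\<lambda>g. g *v w) \<in> haar \<rightarrow>\<^sub>M plane" by measurable
  fix P :: "'k^2 \<Rightarrow> bool" assume P[measurable]: "Measurable.pred plane P" and ae: "AE v in plane. P v"
  have "AE g in haar. AE v in plane. P (g *v v)"
    using nonsing_AE[OF nonsing_plane_mult ae] by - (rule AE_I2, simp add: space_haar)
  then have "AE v in plane. AE g in haar. P (g *v v)"
    by (rule AE_swap[OF sigma_finite_haar sigma_finite_plane, rotated]) measurable
  then obtain v where v: "v \<noteq> 0" "AE g in haar. P (g *v v)" by (rule AE_plane_obtain)
  define k where "k = section_mat v ** adj (section_mat w)"
  have k: "k \<in> SL2" "k *v w = v"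
    using section_mat[OF v(1)] section_mat[OF w] adj_cancel(3)[OF section_mat(1)[OF w], of e1]
    by (auto simp: k_def SL2_mult adj_SL2 matrix_vector_mul_assoc[symmetric])
  have a: "adj k *v v = w" using adj_cancel(3)[OF k(1), of w] k(2) by simp
  have "AE g in haar. P ((g ** adj k) *v v)"
    by (rule nonsing_AE[OF nonsing_haar_right[OF adj_SL2[OF k(1)]] v(2)])
  then show "AE g in haar. P (g *v w)"
    unfolding matrix_vector_mul_assoc[symmetric] a .
qed

text \<open>The converse of \<open>nonsing_orbit\<close>, with the exchange run backwards: right
  translation by a section element replaces \<open>e1\<close> by any \<open>v\<close>, then one
  \<open>h\<close> serves almost all \<open>v\<close>, and \<open>adj h\<close> removes it.\<close>

lemma AE_plane_orbitI:
  assumes P[measurable]: "Measurable.pred plane P" and ae: "AE h in haar. P (h *v e1)"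
  shows "AE v in plane. P v"
proof -
  have "AE h in haar. P (h *v v)" if "v \<in> space plane" for v
  proof -
    have v: "v \<noteq> 0" using that by (simp add: space_plane)
    have "AE h in haar. P ((h ** section_mat v) *v e1)"
      by (rule nonsing_AE[OF nonsing_haar_right[OF section_mat(1)[OF v]] ae])
    then show ?thesis unfolding matrix_vector_mul_assoc[symmetric] section_mat(2)[OF v] .
  qed
  then have "AE v in plane. AE h in haar. P (h *v v)" by - (rule AE_I2)
  then have "AE h in haar. AE v in plane. P (h *v v)"
    by (rule AE_swap[OF sigma_finite_plane sigma_finite_haar, rotated]) measurable
  then obtain h where h: "h \<in> SL2" "AE v in plane. P (h *v v)" by (rule AE_haar_obtain)
  from nonsing_AE[OF nonsing_plane_mult[OF adj_SL2[OF h(1)]] h(2)]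
  show ?thesis by (simp add: adj_cancel[OF h(1)])
qed

section \<open>The double complex\<close>

definition insG :: "nat \<Rightarrow> 'k^2^2 \<Rightarrow> 'k point \<Rightarrow> 'k point" where
  "insG m u z = (ins m 0 u (fst z), snd z)"

definition insV :: "nat \<Rightarrow> 'k^2 \<Rightarrow> 'k point \<Rightarrow> 'k point" where
  "insV q v z = (fst z, ins q 0 v (snd z))"

definition faceG :: "nat \<Rightarrow> nat \<Rightarrow> 'k point \<Rightarrow> 'k point" where
  "faceG m j z = (face m j (fst z), snd z)"

definition faceV :: "nat \<Rightarrow> nat \<Rightarrow> 'k point \<Rightarrow> 'k point" where
  "faceV q j z = (fst z, face q j (snd z))"

lemma sigma_finite_PiM_haar: "sigma_finite_measure (\<Pi>\<^sub>M i\<in>{..<n::nat}. haar)"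
  by (rule sigma_finite_PiM[OF sigma_finite_haar]) simp

lemma sigma_finite_PiM_plane: "sigma_finite_measure (\<Pi>\<^sub>M i\<in>{..<n::nat}. plane)"
  by (rule sigma_finite_PiM[OF sigma_finite_plane]) simp

lemma sigma_finite_pts: "sigma_finite_measure (pts m q)"
  unfolding pts_def by (rule sigma_finite_pair[OF sigma_finite_PiM_haar sigma_finite_PiM_plane])

lemma measurable_fst_pts [measurable]: "fst \<in> pts m q \<rightarrow>\<^sub>M (\<Pi>\<^sub>M i\<in>{..<m}. haar)"
  unfolding pts_def by (rule measurable_fst)

lemma measurable_snd_pts [measurable]: "snd \<in> pts m q \<rightarrow>\<^sub>M (\<Pi>\<^sub>M i\<in>{..<q}. plane)"
  unfolding pts_def by (rule measurable_snd)

lemma measurable_Pair_pts: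
  "f \<in> A \<rightarrow>\<^sub>M (\<Pi>\<^sub>M i\<in>{..<m}. haar) \<Longrightarrow> g \<in> A \<rightarrow>\<^sub>M (\<Pi>\<^sub>M i\<in>{..<q}. plane) \<Longrightarrow> (\<lambda>a. (f a, g a)) \<in> A \<rightarrow>\<^sub>M pts m q"
  unfolding pts_def by (rule measurable_Pair)

lemma space_pts:
  "z \<in> space (pts m q) \<longleftrightarrow> fst z \<in> {..<m} \<rightarrow>\<^sub>E SL2 \<and> snd z \<in> {..<q} \<rightarrow>\<^sub>E - {0}"
  by (cases z) (simp add: pts_def space_pair_measure space_PiM space_haar space_plane)

lemma measurable_insG [measurable (raw)]:
  assumes [measurable]: "u \<in> A \<rightarrow>\<^sub>M haar" "z \<in> A \<rightarrow>\<^sub>M pts m q"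
  shows "(\<lambda>a. insG m (u a) (z a)) \<in> A \<rightarrow>\<^sub>M pts (Suc m) q"
  unfolding insG_def by (intro measurable_Pair_pts) simp_all

lemma measurable_insV [measurable (raw)]:
  assumes [measurable]: "u \<in> A \<rightarrow>\<^sub>M plane" "z \<in> A \<rightarrow>\<^sub>M pts m q"
  shows "(\<lambda>a. insV q (u a) (z a)) \<in> A \<rightarrow>\<^sub>M pts m (Suc q)"
  unfolding insV_def by (intro measurable_Pair_pts) simp_all

lemma measurable_faceG [measurable (raw)]:
  assumes [measurable]: "z \<in> A \<rightarrow>\<^sub>M pts (Suc m) q"
  shows "(\<lambda>a. faceG m j (z a)) \<in> A \<rightarrow>\<^sub>M pts m q"
  unfolding faceG_def by (intro measurable_Pair_pts) simp_all

lemma measurable_faceV [measurable (raw)]: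
  assumes [measurable]: "z \<in> A \<rightarrow>\<^sub>M pts m (Suc q)"
  shows "(\<lambda>a. faceV q j (z a)) \<in> A \<rightarrow>\<^sub>M pts m q"
  unfolding faceV_def by (intro measurable_Pair_pts) simp_all

lemma measurable_act [measurable (raw)]:
  assumes [measurable]: "g \<in> A \<rightarrow>\<^sub>M haar" "z \<in> A \<rightarrow>\<^sub>M pts m q"
  shows "(\<lambda>a. act m q (g a) (z a)) \<in> A \<rightarrow>\<^sub>M pts m q"
  unfolding act_def case_prod_beta' by (intro measurable_Pair_pts measurable_restrict) simp_all

lemma act_faceG: "j \<le> m \<Longrightarrow> faceG m j (act (Suc m) q g z) = act m q g (faceG m j z)"
  by (auto simp: faceG_def act_def face_def case_prod_beta' fun_eq_iff)

lemma act_faceV: "j \<le> q \<Longrightarrow> faceV q j (act m (Suc q) g z) = act m q g (faceV q j z)"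
  by (auto simp: faceV_def act_def face_def case_prod_beta' fun_eq_iff)

lemma act_insG: "act (Suc m) q g (insG m u z) = insG m (g ** u) (act m q g z)"
  by (auto simp: insG_def act_def ins_def case_prod_beta' fun_eq_iff)

lemma act_insV: "act m (Suc q) g (insV q v z) = insV q (g *v v) (act m q g z)"
  by (auto simp: insV_def act_def ins_def case_prod_beta' fun_eq_iff)

lemma act_act: "act m q g (act m q h z) = act m q (g ** h) z"
  by (auto simp: act_def case_prod_beta' fun_eq_iff matrix_mul_assoc matrix_vector_mul_assoc)

lemma act_1: "z \<in> space (pts m q) \<Longrightarrow> act m q (mat 1) z = z"
  by (auto simp: space_pts act_def case_prod_beta' fun_eq_iff prod_eq_iff PiE_iff extensional_def)

lemma act_space:
  assumes g: "g \<in> SL2" and z: "z \<in> space (pts m q)" shows "act m q g z \<in> space (pts m q)"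
proof -
  have "(\<lambda>z. act m q g z) \<in> pts m q \<rightarrow>\<^sub>M pts m q" using g by (intro measurable_act) (simp_all add: space_haar)
  then show ?thesis using z by (rule measurable_space)
qed

lemma nonsing_act:
  assumes g: "g \<in> SL2" shows "nonsing (pts m q) (pts m q) (act m q g)"
proof -
  note G = nonsing_PiM_map[OF sigma_finite_haar sigma_finite_haar nonsing_haar_left[OF g], of m]
  note V = nonsing_PiM_map[OF sigma_finite_plane sigma_finite_plane nonsing_plane_mult[OF g], of q]
  have "nonsing (pts m q) (pts m q) (\<lambda>(y, x). (\<lambda>i\<in>{..<m}. g ** y i, \<lambda>i\<in>{..<q}. g *v x i))"
    unfolding pts_def
  proof (rule nonsing_pair[OF sigma_finite_PiM_haar sigma_finite_PiM_plane sigma_finite_PiM_haar sigma_finite_PiM_plane G _ V])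
    show "(\<lambda>(a, x). \<lambda>i\<in>{..<q}. g *v x i) \<in> (\<Pi>\<^sub>M i\<in>{..<m}. haar) \<Otimes>\<^sub>M (\<Pi>\<^sub>M i\<in>{..<q}. plane) \<rightarrow>\<^sub>M (\<Pi>\<^sub>M i\<in>{..<q}. plane)"
      unfolding case_prod_beta' by (rule measurable_compose[OF measurable_snd nonsing_measurable[OF V]])
  qed
  then show ?thesis by (simp add: act_def[abs_def])
qed

lemma nonsing_insG: "nonsing (haar \<Otimes>\<^sub>M pts m q) (pts (Suc m) q) (\<lambda>(u, z). insG m u z)"
proof -
  have 1: "nonsing (haar \<Otimes>\<^sub>M pts m q) ((haar \<Otimes>\<^sub>M (\<Pi>\<^sub>M i\<in>{..<m}. haar)) \<Otimes>\<^sub>M (\<Pi>\<^sub>M i\<in>{..<q}. plane)) (\<lambda>(a, b, c). ((a, b), c))"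
    unfolding pts_def by (rule nonsing_assoc[OF sigma_finite_haar sigma_finite_PiM_haar sigma_finite_PiM_plane])
  have 2: "nonsing ((haar \<Otimes>\<^sub>M (\<Pi>\<^sub>M i\<in>{..<m}. haar)) \<Otimes>\<^sub>M (\<Pi>\<^sub>M i\<in>{..<q}. plane)) (pts (Suc m) q)
     (\<lambda>(a, c). ((\<lambda>(u, y). ins m 0 u y) a, c))"
    unfolding pts_def
    by (rule nonsing_map_fst[OF sigma_finite_pair[OF sigma_finite_haar sigma_finite_PiM_haar] sigma_finite_PiM_haar
       sigma_finite_PiM_plane nonsing_ins[OF sigma_finite_haar zero_le]])
  show ?thesis using nonsing_compose[OF 1 2] by (simp add: case_prod_beta' insG_def)
qed

lemma nonsing_insV: "nonsing (plane \<Otimes>\<^sub>M pts m q) (pts m (Suc q)) (\<lambda>(v, z). insV q v z)"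
proof -
  note s = sigma_finite_PiM_haar[of m] sigma_finite_PiM_plane[of q] sigma_finite_plane
  have 1: "nonsing (plane \<Otimes>\<^sub>M pts m q) (((\<Pi>\<^sub>M i\<in>{..<m}. haar) \<Otimes>\<^sub>M (\<Pi>\<^sub>M i\<in>{..<q}. plane)) \<Otimes>\<^sub>M plane) (\<lambda>(a, b). (b, a))"
    unfolding pts_def by (rule nonsing_swap[OF s(3) sigma_finite_pair[OF s(1,2)]])
  note 2 = nonsing_compose[OF 1 nonsing_assoc'[OF s]]
  note 3 = nonsing_compose[OF 2 nonsing_map_snd[OF sigma_finite_pair[OF s(2,3)] sigma_finite_pair[OF s(3,2)] s(1) nonsing_swap[OF s(2,3)]]]
  note 4 = nonsing_compose[OF 3 nonsing_map_snd[OF sigma_finite_pair[OF s(3,2)] sigma_finite_PiM_plane[of "Suc q"] s(1) nonsing_ins[OF s(3) zero_le]]]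
  show ?thesis using 4 unfolding pts_def[symmetric] by (simp add: case_prod_beta' insV_def)
qed

lemma nonsing_faceG: "j \<le> m \<Longrightarrow> nonsing (pts (Suc m) q) (pts m q) (faceG m j)"
  using nonsing_map_fst[OF sigma_finite_PiM_haar sigma_finite_PiM_haar sigma_finite_PiM_plane nonsing_face[OF sigma_finite_haar], of j m q]
  by (simp add: pts_def case_prod_beta' faceG_def[abs_def])

lemma nonsing_faceV: "j \<le> q \<Longrightarrow> nonsing (pts m (Suc q)) (pts m q) (faceV q j)"
  using nonsing_map_snd[OF sigma_finite_PiM_plane sigma_finite_PiM_plane sigma_finite_PiM_haar nonsing_face[OF sigma_finite_plane], of j q m]
  by (simp add: pts_def case_prod_beta' faceV_def[abs_def])

section \<open>The two differentials\<close>

lemma d_up_eq: "d_up m f z = (\<Sum>j\<le>m. (-1) ^ j * f (faceG m j z))"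
  by (simp add: d_up_def faceG_def case_prod_beta')

lemma d_right_eq: "d_right m q f z = (-1) ^ m * (\<Sum>j\<le>q. (-1) ^ j * f (faceV q j z))"
  by (simp add: d_right_def faceV_def case_prod_beta')

lemma faceG_insG_0: "fst z \<in> extensional {..<m} \<Longrightarrow> faceG m 0 (insG m u z) = z"
  by (simp add: faceG_def insG_def face_ins)

lemma faceG_insG_Suc: "j \<le> m \<Longrightarrow> faceG (Suc m) (Suc j) (insG (Suc m) u z) = insG m u (faceG m j z)"
  by (simp add: faceG_def insG_def face_Suc_ins_0)

lemma faceV_insV_0: "snd z \<in> extensional {..<q} \<Longrightarrow> faceV q 0 (insV q u z) = z"
  by (simp add: faceV_def insV_def face_ins)

lemma faceV_insV_Suc: "j \<le> q \<Longrightarrow> faceV (Suc q) (Suc j) (insV (Suc q) u z) = insV q u (faceV q j z)"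
  by (simp add: faceV_def insV_def face_Suc_ins_0)

text \<open>Face 0 deletes the inserted variable again. Every other face passes through the
  insertion with its index lowered by one, whence the minus sign, provided \<open>U\<close> does not
  see the variable that is deleted. This is the homotopy formula behind all contractions.\<close>

lemma d_up_insG:
  assumes "z \<in> space (pts (Suc m) q)" and U: "\<And>j. U (faceG m j z) = U z"
  shows "d_up (Suc m) f (insG (Suc m) (U z) z) = f z - d_up m (\<lambda>z. f (insG m (U z) z)) z"
proof -
  have "fst z \<in> extensional {..<Suc m}" using assms(1) by (simp add: space_pts PiE_iff)
  then show ?thesis
    unfolding d_up_eq sum.atMost_Suc_shift
    by (simp add: faceG_insG_0 faceG_insG_Suc U sum_negf)
qed

lemma d_right_insV:
  assumes "z \<in> space (pts m (Suc q))" and V: "\<And>j. V (faceV q j z) = V z"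
  shows "d_right m (Suc q) f (insV (Suc q) (V z) z) = (-1) ^ m * f z - d_right m q (\<lambda>z. f (insV q (V z) z)) z"
proof -
  have "snd z \<in> extensional {..<Suc q}" using assms(1) by (simp add: space_pts PiE_iff)
  then show ?thesis
    unfolding d_right_eq sum.atMost_Suc_shift
    by (simp add: faceV_insV_0 faceV_insV_Suc V sum_negf algebra_simps)
qed

text \<open>By \<open>face_face\<close> the term at \<open>(i, j)\<close> with
  \<open>i \<le> j\<close> cancels the one at \<open>(Suc j, i)\<close>.\<close>

lemma alternating_face_sum_zero:
  fixes F :: "(nat \<Rightarrow> 'a) \<Rightarrow> real"
  shows "(\<Sum>i\<le>Suc n. (-1) ^ i * (\<Sum>j\<le>n. (-1) ^ j * F (face n j (face (Suc n) i y)))) = 0"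
proof -
  define S where "S i j = (-1) ^ (i + j) * F (face n j (face (Suc n) i y))" for i j
  have "(\<Sum>i\<le>Suc n. (-1) ^ i * (\<Sum>j\<le>n. (-1) ^ j * F (face n j (face (Suc n) i y)))) = (\<Sum>(i, j)\<in>{..Suc n} \<times> {..n}. S i j)"
  proof -
    have "(-1) ^ i * (\<Sum>j\<le>n. (-1) ^ j * F (face n j (face (Suc n) i y))) = (\<Sum>j\<le>n. S i j)" for i
      unfolding sum_distrib_left by (rule sum.cong) (simp_all add: S_def power_add)
    then have "(\<Sum>i\<le>Suc n. (-1) ^ i * (\<Sum>j\<le>n. (-1) ^ j * F (face n j (face (Suc n) i y)))) = (\<Sum>i\<le>Suc n. \<Sum>j\<le>n. S i j)"
      by (rule sum.cong[OF refl])
    then show ?thesis unfolding sum.cartesian_product .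
  qed
  also have "\<dots> = (\<Sum>(i, j)\<in>{(i, j). i \<le> j \<and> j \<le> n}. S i j) + (\<Sum>(i, j)\<in>{(i, j). j < i \<and> i \<le> Suc n}. S i j)"
  proof -
    have fin: "finite {(i, j). i \<le> j \<and> j \<le> n}" "finite {(i, j). j < i \<and> i \<le> Suc n}"
      by (rule finite_subset[of _ "{..Suc n} \<times> {..Suc n}"]; auto)+
    have "{..Suc n} \<times> {..n} = {(i, j). i \<le> j \<and> j \<le> n} \<union> {(i, j). j < i \<and> i \<le> Suc n}"
      by auto
    then show ?thesis by (simp only:) (rule sum.union_disjoint[OF fin], auto)
  qed
  also have "(\<Sum>(i, j)\<in>{(i, j). j < i \<and> i \<le> Suc n}. S i j) = (\<Sum>(i, j)\<in>{(i, j). i \<le> j \<and> j \<le> n}. S (Suc j) i)"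
    by (rule sum.reindex_bij_witness[of _ "\<lambda>(i, j). (Suc j, i)" "\<lambda>(i, j). (j, i - 1)"]) auto
  also have "(\<Sum>(i, j)\<in>{(i, j). i \<le> j \<and> j \<le> n}. S i j) + \<dots> = (\<Sum>(i, j)\<in>{(i, j). i \<le> j \<and> j \<le> n}. S i j + S (Suc j) i)"
    by (simp add: sum.distrib case_prod_beta')
  also have "\<dots> = 0"
    by (rule sum.neutral) (auto simp: S_def face_face add.commute)
  finally show ?thesis .
qed

lemma d_up_d_up: "d_up (Suc m) (d_up m f) z = 0"
  using alternating_face_sum_zero[where n=m and F="\<lambda>y. f (y, snd z)" and y="fst z"]
  unfolding d_up_eq faceG_def by simp

lemma sum_scalar_out:
  fixes X :: "'a \<Rightarrow> real"
  shows "(\<Sum>i\<in>A. a i * (c * X i)) = c * (\<Sum>i\<in>A. a i * X i)"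
  by (simp add: sum_distrib_left mult.left_commute)

lemma sum_scalar_swap:
  fixes F :: "'a \<Rightarrow> 'b \<Rightarrow> real"
  shows "(\<Sum>i\<in>A. a i * (\<Sum>j\<in>B. b j * F i j)) = (\<Sum>j\<in>B. b j * (\<Sum>i\<in>A. a i * F i j))"
  unfolding sum_distrib_left by (subst sum.swap) (simp only: mult.left_commute)

lemma d_right_d_right: "d_right m (Suc q) (d_right m q f) z = 0"
  unfolding d_right_eq faceV_def fst_conv snd_conv sum_scalar_out
    alternating_face_sum_zero[where F="\<lambda>x. f (fst z, x)"] by simp

text \<open>The underlying sums commute; the sign in \<open>d_right\<close> alternates with the
  number of group variables and turns this into anticommuting.\<close>

lemma d_up_d_right: "d_up m (d_right m q f) z = - d_right (Suc m) q (d_up m f) z"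
  unfolding d_up_eq d_right_eq sum_scalar_out
  by (subst sum_scalar_swap) (simp add: faceV_def faceG_def)

lemma d_up_diff: "d_up m (\<lambda>z. f z - g z) z = d_up m f z - d_up m g z"
  by (simp add: d_up_eq right_diff_distrib sum_subtractf)

lemma d_up_add: "d_up m (\<lambda>z. f z + g z) z = d_up m f z + d_up m g z"
  by (simp add: d_up_eq distrib_left sum.distrib)

lemma d_up_mult: "d_up m (\<lambda>z. c * f z) z = c * d_up m f z"
  by (simp add: d_up_eq sum_distrib_left mult.left_commute)

lemma d_up_uminus: "d_up m (\<lambda>z. - f z) z = - d_up m f z"
  using d_up_mult[of m "-1" f z] by simp

lemma d_right_diff: "d_right m q (\<lambda>z. f z - g z) z = d_right m q f z - d_right m q g z"
  by (simp add: d_right_eq right_diff_distrib sum_subtractf)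

lemma d_right_add: "d_right m q (\<lambda>z. f z + g z) z = d_right m q f z + d_right m q g z"
  by (simp add: d_right_eq distrib_left sum.distrib)

lemma d_right_mult: "d_right m q (\<lambda>z. c * f z) z = c * d_right m q f z"
  by (simp add: d_right_eq sum_distrib_left mult.left_commute)

lemma d_right_uminus: "d_right m q (\<lambda>z. - f z) z = - d_right m q f z"
  using d_right_mult[of m q "-1" f z] by simp

lemma d_up_AE_cong:
  assumes "AE z in pts m q. f z = g z" shows "AE z in pts (Suc m) q. d_up m f z = d_up m g z"
proof -
  have "AE z in pts (Suc m) q. \<forall>j\<in>{..m}. f (faceG m j z) = g (faceG m j z)"
    by (rule AE_ball_countable') (auto intro: nonsing_AE[OF nonsing_faceG assms])
  then show ?thesis by eventually_elim (simp add: d_up_eq)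
qed

lemma d_right_AE_cong:
  assumes "AE z in pts m q. f z = g z" shows "AE z in pts m (Suc q). d_right m q f z = d_right m q g z"
proof -
  have "AE z in pts m (Suc q). \<forall>j\<in>{..q}. f (faceV q j z) = g (faceV q j z)"
    by (rule AE_ball_countable') (auto intro: nonsing_AE[OF nonsing_faceV assms])
  then show ?thesis by eventually_elim (simp add: d_right_eq)
qed

lemma d_up_zero: "d_up m (\<lambda>_. 0) z = 0" and d_right_zero: "d_right m q (\<lambda>_. 0) z = 0"
  by (simp_all add: d_up_eq d_right_eq)

section \<open>Invariant cochains\<close>

lemma L0inv_measurable: "f \<in> L0inv L m q \<Longrightarrow> f \<in> borel_measurable (pts m q)"
  by (simp add: L0inv_def)

lemma L0inv_AE: "f \<in> L0inv L m q \<Longrightarrow> g \<in> L \<Longrightarrow> AE z in pts m q. f (act m q g z) = f z"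
  by (simp add: L0inv_def)

lemma L0inv_add:
  assumes "f \<in> L0inv L m q" "g \<in> L0inv L m q" shows "(\<lambda>z. f z + g z) \<in> L0inv L m q"
proof -
  have "AE z in pts m q. f (act m q h z) + g (act m q h z) = f z + g z" if "h \<in> L" for h
    using L0inv_AE[OF assms(1) that] L0inv_AE[OF assms(2) that] by eventually_elim simp
  then show ?thesis using assms[THEN L0inv_measurable] unfolding L0inv_def by simp
qed

lemma L0inv_mult:
  assumes "f \<in> L0inv L m q" shows "(\<lambda>z. c * f z) \<in> L0inv L m q"
proof -
  have "AE z in pts m q. c * f (act m q h z) = c * f z" if "h \<in> L" for h
    using L0inv_AE[OF assms(1) that] by eventually_elim simp
  then show ?thesis using assms[THEN L0inv_measurable] unfolding L0inv_def by simp
qed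

lemma L0inv_uminus: "f \<in> L0inv L m q \<Longrightarrow> (\<lambda>z. - f z) \<in> L0inv L m q"
  using L0inv_mult[of f L m q "-1"] by simp

lemma L0inv_diff: "f \<in> L0inv L m q \<Longrightarrow> g \<in> L0inv L m q \<Longrightarrow> (\<lambda>z. f z - g z) \<in> L0inv L m q"
  using L0inv_add[of f L m q "\<lambda>z. - g z"] L0inv_uminus[of g] by simp

lemma L0inv_zero: "(\<lambda>_. 0) \<in> L0inv L m q"
  by (simp add: L0inv_def)

lemma L0inv_sum:
  assumes "\<And>j. j \<in> J \<Longrightarrow> f j \<in> L0inv L m q"
  shows "(\<lambda>z. \<Sum>j\<in>J. f j z) \<in> L0inv L m q"
  using assms by (induction J rule: infinite_finite_induct) (auto intro: L0inv_zero L0inv_add)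

lemma L0inv_AE_eq:
  assumes L: "L \<subseteq> SL2" and f: "f \<in> L0inv L m q" and g: "g \<in> borel_measurable (pts m q)" and eq: "AE z in pts m q. f z = g z"
  shows "g \<in> L0inv L m q"
proof -
  have "AE z in pts m q. g (act m q h z) = g z" if h: "h \<in> L" for h
    using L0inv_AE[OF f h] eq nonsing_AE[OF nonsing_act[OF subsetD[OF L h]] eq]
    by eventually_elim simp
  then show ?thesis using g by (simp add: L0inv_def)
qed

lemma L0inv_pullback:
  assumes f: "f \<in> L0inv L m q" and T: "nonsing (pts m' q') (pts m q) T"
    and eq: "\<And>g z. g \<in> L \<Longrightarrow> z \<in> space (pts m' q') \<Longrightarrow> T (act m' q' g z) = act m q g (T z)"
  shows "(\<lambda>z. f (T z)) \<in> L0inv L m' q'"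
proof -
  have "AE z in pts m' q'. f (T (act m' q' g z)) = f (T z)" if g: "g \<in> L" for g
    using nonsing_AE[OF T L0inv_AE[OF f g]] AE_space by eventually_elim (simp add: eq g)
  then show ?thesis
    using measurable_compose[OF nonsing_measurable[OF T] L0inv_measurable[OF f]] by (simp add: L0inv_def)
qed

lemma L0inv_d_up: "f \<in> L0inv L m q \<Longrightarrow> d_up m f \<in> L0inv L (Suc m) q"
  unfolding d_up_eq[abs_def]
  by (intro L0inv_sum L0inv_mult L0inv_pullback[OF _ nonsing_faceG]) (auto simp: act_faceG)

lemma L0inv_d_right: "f \<in> L0inv L m q \<Longrightarrow> d_right m q f \<in> L0inv L m (Suc q)"
  unfolding d_right_eq[abs_def]
  by (intro L0inv_sum L0inv_mult L0inv_pullback[OF _ nonsing_faceV]) (auto simp: act_faceV)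

section \<open>Exactness of the double complex\<close>

lemma measurable_pts_G [measurable (raw)]:
  assumes "z \<in> A \<rightarrow>\<^sub>M pts m q" "i < m" shows "(\<lambda>a. fst (z a) i) \<in> A \<rightarrow>\<^sub>M haar"
  by (rule measurable_compose[OF measurable_compose[OF assms(1) measurable_fst_pts] measurable_component_singleton])
    (use assms(2) in simp)

lemma measurable_pts_V [measurable (raw)]:
  assumes "z \<in> A \<rightarrow>\<^sub>M pts m q" "i < q" shows "(\<lambda>a. snd (z a) i) \<in> A \<rightarrow>\<^sub>M plane"
  by (rule measurable_compose[OF measurable_compose[OF assms(1) measurable_snd_pts] measurable_component_singleton])
    (use assms(2) in simp)

lemma space_pts_G: "z \<in> space (pts m q) \<Longrightarrow> i < m \<Longrightarrow> fst z i \<in> SL2"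
  by (auto simp: space_pts)

lemma space_pts_V: "z \<in> space (pts m q) \<Longrightarrow> i < q \<Longrightarrow> snd z i \<noteq> 0"
  by (auto simp: space_pts)

lemma fst_act: "i < m \<Longrightarrow> fst (act m q g z) i = g ** fst z i"
  by (simp add: act_def case_prod_beta')

lemma snd_act: "i < q \<Longrightarrow> snd (act m q g z) i = g *v snd z i"
  by (simp add: act_def case_prod_beta')

section \<open>Representatives that are invariant at every point\<close>

lemma AE_lborel_obtain:
  fixes P :: "'a::euclidean_space \<Rightarrow> bool"
  assumes "AE t in lborel. P t" obtains t where "P t"
proof -
  have "\<exists>t. P t"
  proof (rule ccontr)
    assume "\<nexists>t. P t"
    then have "AE t in (lborel :: 'a measure). False" using assms by simp
    then have "emeasure lborel (UNIV :: 'a set) = 0" by (simp add: AE_iff_measurable[of UNIV])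
    then show False by (simp add: emeasure_lborel_UNIV)
  qed
  then show ?thesis using that by blast
qed

text \<open>A function that is invariant without exceptional set can be evaluated on a null set and
  stays invariant there, for instance after a chosen variable has been inserted.\<close>

definition strict :: "('k::{real_normed_field,euclidean_space}^2^2) set \<Rightarrow> nat \<Rightarrow> nat \<Rightarrow> 'k cochain \<Rightarrow> bool" where
  "strict L m q f \<longleftrightarrow> f \<in> borel_measurable (pts m q) \<and> (\<forall>g\<in>L. \<forall>z\<in>space (pts m q). f (act m q g z) = f z)"

lemma strict_L0inv: "strict L m q f \<Longrightarrow> f \<in> L0inv L m q"
  unfolding strict_def L0inv_def by (auto intro: AE_I2)

text \<open>Invariance holds for almost all pairs \<open>(g, z)\<close>. Substituting
  \<open>u ** adj (fst z 0)\<close> for \<open>g\<close> is nonsingular, so some \<open>u\<close>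
  works for almost all \<open>z\<close>. The point reached after this substitution depends only on
  the orbit of \<open>z\<close>, so the new function is invariant everywhere.\<close>

lemma strict_representative_SL2:
  assumes f: "f \<in> L0inv SL2 (Suc m) q"
  obtains f' where "strict SL2 (Suc m) q f'" "AE z in pts (Suc m) q. f z = f' z"
proof -
  let ?M = "pts (Suc m) q"
  note [measurable] = L0inv_measurable[OF f]
  have "AE g in haar. AE z in ?M. f (act (Suc m) q g z) = f z"
    using L0inv_AE[OF f] by - (rule AE_I2, simp add: space_haar)
  then have 1: "AE w in haar \<Otimes>\<^sub>M ?M. f (act (Suc m) q (fst w) (snd w)) = f (snd w)"
    by (intro AE_Tonelli[OF sigma_finite_haar sigma_finite_pts]) simp_all
  have "nonsing (haar \<Otimes>\<^sub>M ?M) (haar \<Otimes>\<^sub>M ?M) (\<lambda>(u, z). (u ** adj (fst z 0), z))"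
  proof (rule nonsing_pair_left[OF sigma_finite_pts sigma_finite_haar sigma_finite_haar])
    show "(\<lambda>(u, z). u ** adj (fst z 0)) \<in> haar \<Otimes>\<^sub>M ?M \<rightarrow>\<^sub>M haar"
      unfolding case_prod_beta' by measurable
    show "nonsing haar haar (\<lambda>u. u ** adj (fst z 0))" if "z \<in> space ?M" for z
      by (rule nonsing_haar_right[OF adj_SL2[OF space_pts_G[OF that]]]) simp
  qed
  from AE_Fubini[OF sigma_finite_haar sigma_finite_pts nonsing_AE[OF this 1]]
  obtain u where u: "u \<in> SL2" "AE z in ?M. f (act (Suc m) q (u ** adj (fst z 0)) z) = f z"
    by (rule AE_haar_obtain) simp
  define f' where "f' z = f (act (Suc m) q (u ** adj (fst z 0)) z)" for z
  have [measurable]: "u \<in> space haar" using u by (simp add: space_haar)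
  show ?thesis
  proof
    show "AE z in ?M. f z = f' z" using u(2) by eventually_elim (simp add: f'_def)
    have "f' \<in> borel_measurable ?M" unfolding f'_def[abs_def] by measurable
    moreover have "f' (act (Suc m) q g z) = f' z" if g: "g \<in> SL2" for g z
      unfolding f'_def act_act fst_act[OF zero_less_Suc] adj_mult matrix_mul_assoc[symmetric] adj_left[OF g] matrix_mul_rid ..
    ultimately show "strict SL2 (Suc m) q f'" by (simp add: strict_def)
  qed
qed

text \<open>A Borel coordinate along the orbits of \<open>Unip\<close>: multiplication by
  \<open>unip t\<close> adds \<open>t\<close> times the second row to the first, which shifts the
  quotient of the two rows by \<open>t\<close> in any column where it is defined.\<close>

definition nu :: "'k::{real_normed_field,euclidean_space}^2^2 \<Rightarrow> 'k" where
  "nu g = (if g$2$1 \<noteq> 0 then g$1$1 / g$2$1 else g$1$2 / g$2$2)"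

lemma nu_unip: "g \<in> SL2 \<Longrightarrow> nu (unip t ** g) = t + nu g"
  by (auto simp: nu_def unip_def mat2 SL2_iff add_divide_distrib)

lemma measurable_nu [measurable (raw)]:
  assumes f: "f \<in> A \<rightarrow>\<^sub>M haar" shows "(\<lambda>a. nu (f a)) \<in> borel_measurable A"
proof -
  have [measurable]: "f \<in> borel_measurable A" using f by measurable
  show ?thesis unfolding nu_def by measurable
qed

lemma Unip_subset_SL2: "Unip \<subseteq> SL2"
  by (auto simp: Unip_def unip_SL2)

text \<open>As for \<open>SL2\<close>, but the first group variable can only be normalised along its
  \<open>Unip\<close> orbit, by the coordinate \<open>nu\<close>. The generic parameter is taken for
  Lebesgue measure on the field.\<close>

lemma strict_representative_Unip:
  fixes f :: "'k::{real_normed_field,euclidean_space} cochain"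
  assumes f: "f \<in> L0inv Unip (Suc m) q"
  obtains f' where "strict Unip (Suc m) q f'" "AE z in pts (Suc m) q. f z = f' z"
proof -
  let ?M = "pts (Suc m) q :: 'k point measure"
  note [measurable] = L0inv_measurable[OF f]
  have "AE t in lborel. AE z in ?M. f (act (Suc m) q (unip t) z) = f z"
    using L0inv_AE[OF f] by - (rule AE_I2, simp add: Unip_def)
  then have 1: "AE w in lborel \<Otimes>\<^sub>M ?M. f (act (Suc m) q (unip (fst w)) (snd w)) = f (snd w)"
    by (intro AE_Tonelli[OF lborel.sigma_finite_measure_axioms sigma_finite_pts]) simp_all
  have "nonsing (lborel \<Otimes>\<^sub>M ?M) (lborel \<Otimes>\<^sub>M ?M) (\<lambda>(s, z). (- nu (fst z 0) + s, z))"
  proof (rule nonsing_pair_left[OF sigma_finite_pts lborel.sigma_finite_measure_axioms lborel.sigma_finite_measure_axioms])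
    show "(\<lambda>(s, z). - nu (fst z 0) + s) \<in> lborel \<Otimes>\<^sub>M ?M \<rightarrow>\<^sub>M lborel"
      unfolding case_prod_beta' by simp
    show "nonsing lborel lborel (\<lambda>s. - nu (fst z 0) + s)" for z :: "'k point"
      by (rule nonsing_lborel_affine[where f="\<lambda>x. x" and g="\<lambda>x. x"]) (simp_all add: linear_ident)
  qed
  from AE_Fubini[OF lborel.sigma_finite_measure_axioms sigma_finite_pts nonsing_AE[OF this 1]]
  obtain s where s: "AE z in ?M. f (act (Suc m) q (unip (- nu (fst z 0) + s)) z) = f z"
    by (rule AE_lborel_obtain) simp
  define f' where "f' z = f (act (Suc m) q (unip (- nu (fst z 0) + s)) z)" for z
  show ?thesis
  proof
    show "AE z in ?M. f z = f' z" using s by eventually_elim (simp add: f'_def)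
    have "f' \<in> borel_measurable ?M" unfolding f'_def[abs_def] by measurable
    moreover have "f' (act (Suc m) q (unip t) z) = f' z" if z: "z \<in> space ?M" for t z
      using nu_unip[OF space_pts_G[OF z zero_less_Suc], of t]
      by (simp add: f'_def act_act fst_act unip_add algebra_simps)
    ultimately show "strict Unip (Suc m) q f'" by (auto simp: strict_def Unip_def)
  qed
qed

text \<open>Two sets of full measure meet: any \<open>t\<close> is the sum of two good parameters
  \<open>s\<close> and \<open>t - s\<close>, and the corresponding translations compose.\<close>

lemma L0inv_UnipI:
  fixes f :: "'k::{real_normed_field,euclidean_space} cochain"
  assumes f: "f \<in> borel_measurable (pts m q)"
    and inv: "AE t in lborel. AE z in pts m q. f (act m q (unip t) z) = f z"
  shows "f \<in> L0inv Unip m q"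
proof -
  have "AE z in pts m q. f (act m q (unip t) z) = f z" for t :: 'k
  proof -
    have "nonsing lborel lborel (\<lambda>s. t + - s)"
      by (rule nonsing_lborel_affine[where f="\<lambda>x. - x" and g="\<lambda>x. - x"]) (simp_all add: linear_uminus)
    from nonsing_AE[OF this inv] inv
    have "AE s in lborel. (AE z in pts m q. f (act m q (unip s) z) = f z) \<and> (AE z in pts m q. f (act m q (unip (t + - s)) z) = f z)"
      by eventually_elim blast
    then obtain s where s: "AE z in pts m q. f (act m q (unip s) z) = f z" "AE z in pts m q. f (act m q (unip (t + - s)) z) = f z"
      by (rule AE_lborel_obtain) blast
    from nonsing_AE[OF nonsing_act[OF unip_SL2[of "t + - s"]] s(1)] s(2)
    show ?thesis by eventually_elim (simp add: act_act unip_add)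
  qed
  then show ?thesis using f by (auto simp: L0inv_def Unip_def)
qed

section \<open>Contractions of the columns and rows\<close>

lemma measurable_insG_const: "u \<in> SL2 \<Longrightarrow> insG m u \<in> pts m q \<rightarrow>\<^sub>M pts (Suc m) q"
  using measurable_insG[of "\<lambda>_. u" "pts m q" "\<lambda>z. z" m q] by (simp add: space_haar)

text \<open>Inserting a constant \<open>u\<close> contracts the complex of all cochains. The
  primitive is in general no longer invariant, and its failure to be so carries the group
  cohomology.\<close>

lemma up_exact_plain:
  assumes f: "f \<in> borel_measurable (pts (Suc m) q)" and d: "AE z in pts (Suc (Suc m)) q. d_up (Suc m) f z = 0"
  shows "AE u in haar. AE z in pts (Suc m) q. f z = d_up m (\<lambda>z. f (insG m u z)) z"
proof -
  have "AE u in haar. AE z in pts (Suc m) q. d_up (Suc m) f (insG (Suc m) u z) = 0"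
    using AE_Fubini[OF sigma_finite_haar sigma_finite_pts nonsing_AE[OF nonsing_insG d]] by simp
  then show ?thesis
  proof eventually_elim
    case (elim u)
    then show ?case using AE_space
      by eventually_elim (simp add: d_up_insG[where U="\<lambda>_. u"])
  qed
qed

section \<open>Generic pairs of vectors\<close>

lemma det2_eq: "det2 v w = v$1 * w$2 - w$1 * v$2"
  by (simp add: det2_def det_2)

lemma det2_mult: "g \<in> SL2 \<Longrightarrow> det2 (g *v v) (g *v w) = det2 v w"
proof -
  assume "g \<in> SL2"
  have "det2 (g *v v) (g *v w) = (g$1$1 * g$2$2 - g$1$2 * g$2$1) * det2 v w"
    by (simp add: det2_eq mat2 algebra_simps)
  then show ?thesis using \<open>g \<in> SL2\<close> by (simp add: SL2_iff)
qed

text \<open>The vectors with second entry 0 lie in the real hyperplane orthogonal to one basis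
  vector of the field placed in that entry.\<close>

lemma AE_plane_nth: "AE w in (plane :: ('k::{real_normed_field,euclidean_space}^2) measure). w$2 \<noteq> 0"
proof -
  obtain b :: 'k where b: "b \<in> Basis" using nonempty_Basis by blast
  have "axis 2 b \<in> (Basis :: ('k^2) set)" using b by (auto simp: Basis_vec_def)
  then have "negligible {w :: 'k^2. w \<bullet> axis 2 b = 0}" by (rule negligible_standard_hyperplane)
  moreover have "closed {w :: 'k^2. w \<bullet> axis 2 b = 0}" by (intro closed_Collect_eq continuous_intros)
  ultimately have "{w :: 'k^2. w \<bullet> axis 2 b = 0} \<in> null_sets lborel"
    by (subst null_sets_completion_iff[symmetric]) (simp_all add: negligible_iff_null_sets)
  from AE_not_in[OF this] have "AE w in lborel. (w :: 'k^2)$2 \<noteq> 0"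
    by eventually_elim (auto simp: inner_axis)
  then show ?thesis unfolding AE_plane_iff by eventually_elim simp
qed

text \<open>In coordinates that move \<open>v\<close> to \<open>e1\<close>, the determinant
  \<open>det2 v w\<close> is the second entry of \<open>w\<close>.\<close>

lemma AE_plane_det2:
  assumes v: "v \<noteq> 0" shows "AE w in plane. det2 v w \<noteq> 0"
proof -
  let ?s = "section_mat v"
  note s = section_mat[OF v]
  have "AE w in plane. (adj ?s *v w) $ 2 \<noteq> 0"
    by (rule nonsing_AE[OF nonsing_plane_mult[OF adj_SL2[OF s(1)]] AE_plane_nth])
  moreover have "(adj ?s *v w) $ 2 = det2 v w" for w
    using arg_cong[OF s(2), of "\<lambda>v. v $ 1"] arg_cong[OF s(2), of "\<lambda>v. v $ 2"]
    by (simp add: mat2 det2_eq)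
  ultimately show ?thesis by simp
qed

lemma borel_measurable_det2_vec [measurable (raw)]:
  fixes v w :: "'a \<Rightarrow> 'k::{real_normed_field,euclidean_space}^2"
  assumes [measurable]: "v \<in> borel_measurable A" "w \<in> borel_measurable A"
  shows "(\<lambda>a. det2 (v a) (w a)) \<in> borel_measurable A"
  unfolding det2_eq by measurable

lemma AE_PiM_plane_det2: "AE x in (\<Pi>\<^sub>M i\<in>{..<Suc (Suc q)}. plane). det2 (x 0) (x 1) \<noteq> 0"
proof (rule AE_PiM_SucI[OF sigma_finite_plane zero_le])
  have [measurable]: "(\<lambda>x. x i) \<in> borel_measurable (\<Pi>\<^sub>M i\<in>{..<n::nat}. plane)" if "i < n" for i n
    by (rule measurable_plane_borel) (use that in simp)
  show "Measurable.pred (\<Pi>\<^sub>M i\<in>{..<Suc (Suc q)}. plane) (\<lambda>x. det2 (x 0) (x 1) \<noteq> 0)"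
    by measurable
  have "AE x in (\<Pi>\<^sub>M i\<in>{..<Suc q}. plane). det2 v (x 0) \<noteq> 0" if "v \<noteq> 0" for v
  proof (rule AE_PiM_SucI[OF sigma_finite_plane zero_le])
    show "Measurable.pred (\<Pi>\<^sub>M i\<in>{..<Suc q}. plane) (\<lambda>x. det2 v (x 0) \<noteq> 0)"
      by measurable
    show "AE z in plane \<Otimes>\<^sub>M (\<Pi>\<^sub>M i\<in>{..<q}. plane). det2 v (ins q 0 (fst z) (snd z) 0) \<noteq> 0"
      using nonsing_AE[OF nonsing_fst[OF sigma_finite_plane sigma_finite_PiM_plane] AE_plane_det2[OF that]]
      by eventually_elim (simp add: ins_def)
  qed
  then have "AE v in plane. AE x in (\<Pi>\<^sub>M i\<in>{..<Suc q}. plane). det2 v (x 0) \<noteq> 0"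
    by - (rule AE_I2, simp add: space_plane)
  moreover have [measurable]: "(\<lambda>z. snd z 0) \<in> borel_measurable (plane \<Otimes>\<^sub>M (\<Pi>\<^sub>M i\<in>{..<Suc q}. plane))"
    by (rule measurable_plane_borel) simp
  have [measurable]: "fst \<in> borel_measurable (plane \<Otimes>\<^sub>M (\<Pi>\<^sub>M i\<in>{..<Suc q}. plane))"
    by (rule measurable_plane_borel[OF measurable_fst])
  ultimately show "AE z in plane \<Otimes>\<^sub>M (\<Pi>\<^sub>M i\<in>{..<Suc q}. plane). det2 (ins (Suc q) 0 (fst z) (snd z) 0) (ins (Suc q) 0 (fst z) (snd z) 1) \<noteq> 0"
    by (intro AE_Tonelli[OF sigma_finite_plane sigma_finite_PiM_plane]) (simp_all add: ins_def)
qed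

lemma AE_pts_det2:
  assumes "2 \<le> q" shows "AE z in pts m q. det2 (snd z 0) (snd z 1) \<noteq> 0"
proof -
  obtain q' where q: "q = Suc (Suc q')" using assms by (metis One_nat_def Suc_1 Suc_le_D Suc_le_mono)
  show ?thesis unfolding q pts_def
    by (rule nonsing_AE[OF nonsing_snd[OF sigma_finite_PiM_haar sigma_finite_PiM_plane] AE_PiM_plane_det2])
qed

text \<open>The default \<open>mat 1\<close> keeps all values in \<open>SL2\<close>, so that
  \<open>frame\<close> is a total map; its equivariance then holds only off the null set of
  dependent pairs.\<close>

definition frame :: "'k::{real_normed_field,euclidean_space}^2 \<Rightarrow> 'k^2 \<Rightarrow> 'k^2^2" where
  "frame v w = (if det2 v w = 0 then mat 1 else
     vector [vector [v$1, w$1 / det2 v w], vector [v$2, w$2 / det2 v w]])"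

lemma frame_SL2: "frame v w \<in> SL2"
proof (cases "det2 v w = 0")
  case False
  have "v$1 * (w$2 / det2 v w) - w$1 / det2 v w * v$2 = (v$1 * w$2 - w$1 * v$2) / det2 v w"
    by (simp add: diff_divide_distrib)
  also have "\<dots> = 1" using False by (simp add: det2_eq)
  finally show ?thesis using False by (simp add: frame_def SL2_iff)
qed (simp add: frame_def mat_1_SL2)

lemma frame_mult: "g \<in> SL2 \<Longrightarrow> det2 v w \<noteq> 0 \<Longrightarrow> frame (g *v v) (g *v w) = g ** frame v w"
  by (simp add: frame_def det2_mult) (simp add: mat2 add_divide_distrib)

lemma measurable_frame [measurable (raw)]:
  assumes v: "v \<in> A \<rightarrow>\<^sub>M plane" and w: "w \<in> A \<rightarrow>\<^sub>M plane"
  shows "(\<lambda>a. frame (v a) (w a)) \<in> A \<rightarrow>\<^sub>M haar"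
proof -
  have [measurable]: "v \<in> borel_measurable A" "w \<in> borel_measurable A" using v w by measurable
  have "(\<lambda>a. frame (v a) (w a)) \<in> borel_measurable A"
    unfolding frame_def
    by (intro measurable_If borel_measurable_vector_matrix) measurable
  then show ?thesis by (auto simp: measurable_haar_iff frame_SL2)
qed

text \<open>The stabiliser of a pair of linearly independent vectors is trivial: inserting the
  variable \<open>frame (x 0) (x 1) ** u\<close> contracts the columns with at least two plane variables.\<close>

lemma up_exact:
  assumes f0: "f0 \<in> L0inv SL2 (Suc m) q" and q: "2 \<le> q"
    and d0: "AE z in pts (Suc (Suc m)) q. d_up (Suc m) f0 z = 0"
  shows "\<exists>b\<in>L0inv SL2 m q. AE z in pts (Suc m) q. f0 z = d_up m b z"
proof -
  obtain f where f: "strict SL2 (Suc m) q f" and ff: "AE z in pts (Suc m) q. f0 z = f z"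
    using strict_representative_SL2[OF f0] .
  have [measurable]: "f \<in> borel_measurable (pts (Suc m) q)" using f by (simp add: strict_def)
  have d: "AE z in pts (Suc (Suc m)) q. d_up (Suc m) f z = 0"
    using d0 d_up_AE_cong[OF ff] by eventually_elim simp
  define U where "U u z = frame (snd z 0) (snd z 1) ** u" for u :: "'a^2^2" and z :: "'a point"
  have Um[measurable]: "(\<lambda>a. U (u a) (z a)) \<in> A \<rightarrow>\<^sub>M haar" if "u \<in> A \<rightarrow>\<^sub>M haar" "z \<in> A \<rightarrow>\<^sub>M pts n q" for A u z n
    unfolding U_def using that q by (intro measurable_haar_mult measurable_frame measurable_pts_V) auto
  have "nonsing (haar \<Otimes>\<^sub>M pts (Suc m) q) (haar \<Otimes>\<^sub>M pts (Suc m) q) (\<lambda>(u, z). (U u z, z))"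
  proof (rule nonsing_pair_left[OF sigma_finite_pts sigma_finite_haar sigma_finite_haar])
    show "(\<lambda>(u, z). U u z) \<in> haar \<Otimes>\<^sub>M pts (Suc m) q \<rightarrow>\<^sub>M haar"
      unfolding case_prod_beta' by measurable
    show "nonsing haar haar (\<lambda>u. U u z)" for z
      unfolding U_def by (rule nonsing_haar_left[OF frame_SL2])
  qed
  from nonsing_AE[OF nonsing_compose[OF this nonsing_insG] d]
  have "AE w in haar \<Otimes>\<^sub>M pts (Suc m) q. d_up (Suc m) f (insG (Suc m) (U (fst w) (snd w)) (snd w)) = 0"
    by (simp add: case_prod_beta')
  from AE_Fubini[OF sigma_finite_haar sigma_finite_pts this]
  obtain u where u: "u \<in> SL2" "AE z in pts (Suc m) q. d_up (Suc m) f (insG (Suc m) (U u z) z) = 0"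
    by (rule AE_haar_obtain) simp
  have [measurable]: "u \<in> space haar" using u by (simp add: space_haar)
  define b where "b z = f (insG m (U u z) z)" for z
  have "b \<in> L0inv SL2 m q"
    unfolding L0inv_def
  proof (intro CollectI conjI ballI)
    show "b \<in> borel_measurable (pts m q)" unfolding b_def[abs_def] by measurable
    fix g :: "'a^2^2" assume g: "g \<in> SL2"
    show "AE z in pts m q. b (act m q g z) = b z"
      using AE_pts_det2[OF q] AE_space
    proof eventually_elim
      case (elim z)
      have "U u (act m q g z) = g ** U u z"
        using q elim(1) by (simp add: U_def snd_act frame_mult[OF g] matrix_mul_assoc)
      then have "b (act m q g z) = f (act (Suc m) q g (insG m (U u z) z))"
        by (simp add: b_def act_insG)
      moreover have "insG m (U u z) z \<in> space (pts (Suc m) q)"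
        unfolding U_def by (rule measurable_space[OF measurable_insG_const[OF SL2_mult[OF frame_SL2 u(1)]] elim(2)])
      \<comment> \<open>For a fixed \<open>u\<close> the inserted points may form a null set, so
        invariance of \<open>f\<close> almost everywhere would say nothing here; it is strict
        invariance that applies.\<close>
      ultimately show ?case using f g by (simp add: strict_def b_def)
    qed
  qed
  moreover have "AE z in pts (Suc m) q. f0 z = d_up m b z"
    using u(2) ff AE_space
  proof eventually_elim
    case (elim z)
    have "U u (faceG m j z) = U u z" for j by (simp add: U_def faceG_def)
    from d_up_insG[where f=f and U="U u", OF elim(3) this] elim(1,2)
    show ?case by (simp add: b_def[abs_def])
  qed
  ultimately show ?thesis by blast
qed

text \<open>The point \<open>(fst z 0 ** k) *v e1\<close> depends equivariantly on the first group
  variable without any exceptional set, and inserting it contracts the rows. The generic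
  \<open>k\<close> keeps the insertion away from the null set where \<open>d0\<close> fails.\<close>

lemma right_exact:
  assumes f0: "f0 \<in> L0inv SL2 (Suc m) (Suc q)"
    and d0: "AE z in pts (Suc m) (Suc (Suc q)). d_right (Suc m) (Suc q) f0 z = 0"
  shows "\<exists>b\<in>L0inv SL2 (Suc m) q. AE z in pts (Suc m) (Suc q). f0 z = d_right (Suc m) q b z"
proof -
  obtain f where f: "strict SL2 (Suc m) (Suc q) f" and ff: "AE z in pts (Suc m) (Suc q). f0 z = f z"
    using strict_representative_SL2[OF f0] .
  have [measurable]: "f \<in> borel_measurable (pts (Suc m) (Suc q))" using f by (simp add: strict_def)
  have d: "AE z in pts (Suc m) (Suc (Suc q)). d_right (Suc m) (Suc q) f z = 0"
    using d0 d_right_AE_cong[OF ff] by eventually_elim simp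
  define V where "V k z = (fst z 0 ** k) *v e1" for k :: "'a^2^2" and z :: "'a point"
  have [measurable]: "(\<lambda>_. e1) \<in> A \<rightarrow>\<^sub>M (plane :: ('a^2) measure)" for A
    by (simp add: space_plane axis_eq_0_iff)
  have e1: "(e1 :: 'a^2) \<noteq> 0" by (simp add: axis_eq_0_iff)
  have [measurable]: "(\<lambda>a. V (k a) (z a)) \<in> A \<rightarrow>\<^sub>M plane" if "k \<in> A \<rightarrow>\<^sub>M haar" "z \<in> A \<rightarrow>\<^sub>M pts (Suc m) n" for A k z n
    unfolding V_def using that by measurable
  have "nonsing (haar \<Otimes>\<^sub>M pts (Suc m) (Suc q)) (plane \<Otimes>\<^sub>M pts (Suc m) (Suc q)) (\<lambda>(k, z). (V k z, z))"
  proof (rule nonsing_pair_left[OF sigma_finite_pts sigma_finite_haar sigma_finite_plane])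
    show "(\<lambda>(k, z). V k z) \<in> haar \<Otimes>\<^sub>M pts (Suc m) (Suc q) \<rightarrow>\<^sub>M plane"
      unfolding case_prod_beta' by measurable
    show "nonsing haar plane (\<lambda>k. V k z)" if "z \<in> space (pts (Suc m) (Suc q))" for z
      unfolding V_def
      by (rule nonsing_compose[OF nonsing_haar_left[OF space_pts_G[OF that zero_less_Suc]] nonsing_orbit[OF e1]])
  qed
  from nonsing_AE[OF nonsing_compose[OF this nonsing_insV] d]
  have "AE w in haar \<Otimes>\<^sub>M pts (Suc m) (Suc q). d_right (Suc m) (Suc q) f (insV (Suc q) (V (fst w) (snd w)) (snd w)) = 0"
    by (simp add: case_prod_beta')
  from AE_Fubini[OF sigma_finite_haar sigma_finite_pts this]
  obtain k where k: "k \<in> SL2" "AE z in pts (Suc m) (Suc q). d_right (Suc m) (Suc q) f (insV (Suc q) (V k z) z) = 0"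
    by (rule AE_haar_obtain) simp
  have [measurable]: "k \<in> space haar" using k by (simp add: space_haar)
  define b0 where "b0 z = f (insV q (V k z) z)" for z
  have m: "(\<lambda>z. insV q (V k z) z) \<in> pts (Suc m) q \<rightarrow>\<^sub>M pts (Suc m) (Suc q)" by measurable
  have "strict SL2 (Suc m) q b0"
    unfolding strict_def
  proof (intro conjI ballI)
    show "b0 \<in> borel_measurable (pts (Suc m) q)" unfolding b0_def[abs_def] by measurable
    fix g :: "'a^2^2" and z :: "'a point" assume g: "g \<in> SL2" and z: "z \<in> space (pts (Suc m) q)"
    have "V k (act (Suc m) q g z) = g *v V k z"
      by (simp add: V_def fst_act matrix_mul_assoc matrix_vector_mul_assoc)
    then have "b0 (act (Suc m) q g z) = f (act (Suc m) (Suc q) g (insV q (V k z) z))"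
      by (simp add: b0_def act_insV)
    then show "b0 (act (Suc m) q g z) = b0 z"
      using f g measurable_space[OF m z] by (simp add: strict_def b0_def)
  qed
  \<comment> \<open>The factor undoes the sign that \<open>d_right\<close> carries.\<close>
  then have "(\<lambda>z. (-1) ^ Suc m * b0 z) \<in> L0inv SL2 (Suc m) q" by (intro L0inv_mult strict_L0inv)
  moreover have "AE z in pts (Suc m) (Suc q). f0 z = d_right (Suc m) q (\<lambda>z. (-1) ^ Suc m * b0 z) z"
    using k(2) ff AE_space
  proof eventually_elim
    case (elim z)
    have "V k (faceV q j z) = V k z" for j by (simp add: V_def faceV_def)
    from d_right_insV[where f=f and V="V k", OF elim(3) this] elim(1,2)
    have "(-1) ^ Suc m * f0 z = d_right (Suc m) q b0 z" by (simp add: b0_def[abs_def])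
    then have "(-1) ^ Suc m * d_right (Suc m) q b0 z = (-1) ^ Suc m * ((-1) ^ Suc m * f0 z)" by simp
    then show ?case unfolding d_right_mult by (simp flip: mult.assoc power_mult_distrib)
  qed
  ultimately show ?thesis using bexI[of "\<lambda>b. AE z in pts (Suc m) (Suc q). f0 z = d_right (Suc m) q b z"] by blast
qed

section \<open>Eckmann--Shapiro induction\<close>

lemma e1_nonzero: "(e1 :: 'k::{real_normed_field,euclidean_space}^2) \<noteq> 0"
  by (simp add: axis_eq_0_iff)

lemma measurable_e1 [measurable]: "(\<lambda>_. e1) \<in> A \<rightarrow>\<^sub>M plane"
  by (simp add: space_plane e1_nonzero)

lemma measurable_insV_const: "v \<noteq> 0 \<Longrightarrow> insV q v \<in> pts m q \<rightarrow>\<^sub>M pts m (Suc q)"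
  using measurable_insV[of "\<lambda>_. v" "pts m q" "\<lambda>z. z" m q] by (simp add: space_plane)

lemma measurable_act_const: "g \<in> SL2 \<Longrightarrow> act m q g \<in> pts m q \<rightarrow>\<^sub>M pts m q"
  using measurable_act[of "\<lambda>_. g" "pts m q" "\<lambda>z. z" m q] by (simp add: space_haar)

lemma nonsing_exchange:
  assumes \<sigma>: "sigma_finite_measure A" "sigma_finite_measure B" "sigma_finite_measure C"
  shows "nonsing (A \<Otimes>\<^sub>M (B \<Otimes>\<^sub>M C)) (B \<Otimes>\<^sub>M (A \<Otimes>\<^sub>M C)) (\<lambda>(a, b, c). (b, a, c))"
proof -
  note 1 = nonsing_compose[OF nonsing_assoc[OF \<sigma>]
    nonsing_map_fst[OF sigma_finite_pair[OF \<sigma>(1,2)] sigma_finite_pair[OF \<sigma>(2,1)] \<sigma>(3) nonsing_swap[OF \<sigma>(1,2)]]]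
  show ?thesis using nonsing_compose[OF 1 nonsing_assoc'[OF \<sigma>(2,1,3)]] by (simp add: case_prod_beta')
qed

lemma AE_pts_insVI:
  assumes P: "Measurable.pred (pts m (Suc q)) P"
    and ae: "AE w in plane \<Otimes>\<^sub>M pts m q. P (insV q (fst w) (snd w))"
  shows "AE z in pts m (Suc q). P z"
proof -
  let ?Y = "\<Pi>\<^sub>M i\<in>{..<m}. haar :: ('a^2^2) measure" and ?X = "\<lambda>q. \<Pi>\<^sub>M i\<in>{..<q}. plane :: ('a^2) measure"
  note Y = sigma_finite_PiM_haar[of m] note X = sigma_finite_PiM_plane note V = sigma_finite_plane
  have "AE w in ?Y \<Otimes>\<^sub>M (plane \<Otimes>\<^sub>M ?X q). P (insV q (fst (snd w)) (fst w, snd (snd w)))"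
    using nonsing_AE[OF nonsing_exchange[OF Y V X] ae[unfolded pts_def]] by (simp add: case_prod_beta')
  from AE_Fubini[OF Y sigma_finite_pair[OF V X] this]
  have "AE y in ?Y. AE w in plane \<Otimes>\<^sub>M ?X q. P (y, ins q 0 (fst w) (snd w))" by (simp add: insV_def)
  then have "AE y in ?Y. AE x in ?X (Suc q). P (y, x)"
    using AE_space
  proof eventually_elim
    case (elim y)
    have "(\<lambda>x. (y, x)) \<in> ?X (Suc q) \<rightarrow>\<^sub>M pts m (Suc q)"
      unfolding pts_def using elim(2) by simp
    from AE_PiM_SucI[OF sigma_finite_plane zero_le measurable_compose[OF this P]] elim(1)
    show ?case by simp
  qed
  then show ?thesis using P unfolding pts_def by (intro AE_Tonelli[OF Y X])
qed

lemma nonsing_orbit_insV: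
  "nonsing (haar \<Otimes>\<^sub>M pts m q) (pts m (Suc q)) (\<lambda>(h, z). insV q (h *v e1) z)"
proof -
  have "nonsing (haar \<Otimes>\<^sub>M pts m q) (plane \<Otimes>\<^sub>M pts m q) (\<lambda>(h, z). (h *v e1, z))"
    by (rule nonsing_map_fst[OF sigma_finite_haar sigma_finite_plane sigma_finite_pts nonsing_orbit[OF e1_nonzero]])
  from nonsing_compose[OF this nonsing_insV] show ?thesis by (simp add: case_prod_beta')
qed

text \<open>Both predicates are compared on pairs of a group element \<open>h\<close> and a point.
  From left to right one generic \<open>h\<close> suffices, since acting by \<open>h\<close>
  preserves null sets. From right to left the statement holds for every \<open>h\<close>, and
  \<open>AE_plane_orbitI\<close> passes from group elements to cosets.\<close>

lemma shapiro_AE: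
  fixes P Q :: "'k::{real_normed_field,euclidean_space} point \<Rightarrow> bool"
  assumes P: "Measurable.pred (pts m 1) P" and Q: "Measurable.pred (pts m 0) Q"
    and PQ: "AE w in haar \<Otimes>\<^sub>M pts m 0. P (insV 0 (fst w *v e1) (snd w)) \<longleftrightarrow> Q (act m 0 (adj (fst w)) (snd w))"
  shows "(AE z in pts m 1. P z) \<longleftrightarrow> (AE z in pts m 0. Q z)"
proof
  assume "AE z in pts m 1. P z"
  from nonsing_AE[OF nonsing_orbit_insV[of m 0] this[unfolded One_nat_def]] PQ
  have "AE w in haar \<Otimes>\<^sub>M pts m 0. Q (act m 0 (adj (fst w)) (snd w))"
    by eventually_elim (simp add: case_prod_beta')
  from AE_Fubini[OF sigma_finite_haar sigma_finite_pts this]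
  obtain h where h: "h \<in> SL2" "AE z in pts m 0. Q (act m 0 (adj h) z)" by (rule AE_haar_obtain) simp
  from nonsing_AE[OF nonsing_act[OF h(1)] h(2)] AE_space
  show "AE z in pts m 0. Q z" by eventually_elim (simp add: act_act adj_left[OF h(1)] act_1)
next
  assume Q': "AE z in pts m 0. Q z"
  have "AE h in haar. AE z in pts m 0. Q (act m 0 (adj h) z)"
    using nonsing_AE[OF nonsing_act[OF adj_SL2] Q'] by - (rule AE_I2, simp add: space_haar)
  moreover note AE_Fubini[OF sigma_finite_haar sigma_finite_pts PQ]
  ultimately have "AE h in haar. AE z in pts m 0. P (insV 0 (h *v e1) z)"
  proof eventually_elim
    case (elim h)
    then show ?case by eventually_elim simp
  qed
  moreover have m: "(\<lambda>w. insV 0 (fst w *v e1) (snd w)) \<in> haar \<Otimes>\<^sub>M pts m 0 \<rightarrow>\<^sub>M pts m (Suc 0)"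
    by measurable
  ultimately have "AE z in pts m 0. AE h in haar. P (insV 0 (h *v e1) z)"
    by (intro AE_swap[OF sigma_finite_haar sigma_finite_pts])
      (use measurable_compose[OF m P[simplified]] in \<open>simp_all add: case_prod_beta'\<close>)
  then have "AE z in pts m 0. AE v in plane. P (insV 0 v z)"
    using AE_space
  proof eventually_elim
    case (elim z)
    then have [measurable]: "z \<in> space (pts m 0)" by simp
    have "(\<lambda>v. insV 0 v z) \<in> plane \<rightarrow>\<^sub>M pts m (Suc 0)" by measurable
    then show ?case using measurable_compose[OF _ P[simplified]] elim(1) by (intro AE_plane_orbitI)
  qed
  moreover have m': "(\<lambda>w. insV 0 (fst w) (snd w)) \<in> plane \<Otimes>\<^sub>M pts m 0 \<rightarrow>\<^sub>M pts m (Suc 0)"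
    by measurable
  have m'': "(\<lambda>w. insV 0 (snd w) (fst w)) \<in> pts m 0 \<Otimes>\<^sub>M plane \<rightarrow>\<^sub>M pts m (Suc 0)"
    by measurable
  ultimately have "AE v in plane. AE z in pts m 0. P (insV 0 v z)"
    by (intro AE_swap[OF sigma_finite_pts sigma_finite_plane])
      (use measurable_compose[OF m'' P[simplified]] in \<open>simp_all add: case_prod_beta'\<close>)
  then have "AE w in plane \<Otimes>\<^sub>M pts m 0. P (insV 0 (fst w) (snd w))"
    by (intro AE_Tonelli[OF sigma_finite_plane sigma_finite_pts measurable_compose[OF m' P[simplified]]]) simp
  from AE_pts_insVI[OF P[simplified] this] show "AE z in pts m 1. P z" unfolding One_nat_def .
qed

lemma shapiro_iff:
  "shapiro m f a \<longleftrightarrow> f \<in> L0inv Unip m 0 \<and> a \<in> L0inv SL2 m 1 \<and>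
    (AE w in haar \<Otimes>\<^sub>M pts m 0. a (insV 0 (fst w *v e1) (snd w)) = f (act m 0 (adj (fst w)) (snd w)))"
proof -
  have eq: "(case w of (h, y, x) \<Rightarrow> a (y, \<lambda>j\<in>{..<1}. h *v e1) = f (\<lambda>i\<in>{..<m}. matrix_inv h ** y i, x))
    \<longleftrightarrow> a (insV 0 (fst w *v e1) (snd w)) = f (act m 0 (adj (fst w)) (snd w))"
    if "w \<in> space (haar \<Otimes>\<^sub>M pts m 0)" for w
  proof -
    have w: "fst w \<in> SL2" "snd w \<in> space (pts m 0)" using that by (auto simp: space_pair_measure space_haar)
    have "snd (snd w) = (\<lambda>_. undefined)" using w(2) by (auto simp: space_pts)
    moreover have "ins 0 0 (fst w *v e1) (\<lambda>_. undefined) = (\<lambda>j\<in>{..<1}. fst w *v e1)" by (auto simp: ins_def fun_eq_iff)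
    moreover have "(\<lambda>j\<in>{..<0::nat}. adj (fst w) *v snd (snd w) j) = (\<lambda>_. undefined)" by (simp add: restrict_def)
    ultimately show ?thesis
      unfolding case_prod_beta' insV_def act_def matrix_inv_SL2[OF w(1)] by simp
  qed
  have "(AE w in haar \<Otimes>\<^sub>M pts m 0. case w of (h, y, x) \<Rightarrow> a (y, \<lambda>j\<in>{..<1}. h *v e1) = f (\<lambda>i\<in>{..<m}. matrix_inv h ** y i, x))
    \<longleftrightarrow> (AE w in haar \<Otimes>\<^sub>M pts m 0. a (insV 0 (fst w *v e1) (snd w)) = f (act m 0 (adj (fst w)) (snd w)))"
    by (rule AE_cong) (rule eq)
  then show ?thesis unfolding shapiro_def by blast
qed

lemma shapiro_L0inv: "shapiro m f a \<Longrightarrow> f \<in> L0inv Unip m 0" "shapiro m f a \<Longrightarrow> a \<in> L0inv SL2 m 1"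
  by (simp_all add: shapiro_def)

lemma shapiro_measurable:
  "shapiro m f a \<Longrightarrow> f \<in> borel_measurable (pts m 0)" "shapiro m f a \<Longrightarrow> a \<in> borel_measurable (pts m 1)"
  by (simp_all add: shapiro_def L0inv_def)

lemma shapiroD:
  "shapiro m f a \<Longrightarrow> AE w in haar \<Otimes>\<^sub>M pts m 0. a (insV 0 (fst w *v e1) (snd w)) = f (act m 0 (adj (fst w)) (snd w))"
  by (simp add: shapiro_iff)

lemma shapiro_d_up:
  assumes "shapiro m f a" shows "shapiro (Suc m) (d_up m f) (d_up m a)"
  unfolding shapiro_iff
proof (intro conjI)
  show "d_up m f \<in> L0inv Unip (Suc m) 0" "d_up m a \<in> L0inv SL2 (Suc m) 1"
    using assms by (auto intro!: L0inv_d_up simp: shapiro_iff)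
  have "AE w in haar \<Otimes>\<^sub>M pts (Suc m) 0. \<forall>j\<in>{..m}. a (insV 0 (fst w *v e1) (faceG m j (snd w))) = f (act m 0 (adj (fst w)) (faceG m j (snd w)))"
  proof (rule AE_ball_countable')
    fix j assume "j \<in> {..m}"
    then have "nonsing (haar \<Otimes>\<^sub>M pts (Suc m) 0) (haar \<Otimes>\<^sub>M pts m 0) (\<lambda>(h, z). (h, faceG m j z))"
      by (intro nonsing_map_snd sigma_finite_pts sigma_finite_haar nonsing_faceG) simp
    from nonsing_AE[OF this shapiroD[OF assms]]
    show "AE w in haar \<Otimes>\<^sub>M pts (Suc m) 0. a (insV 0 (fst w *v e1) (faceG m j (snd w))) = f (act m 0 (adj (fst w)) (faceG m j (snd w)))"
      by (simp add: case_prod_beta')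
  qed simp
  then show "AE w in haar \<Otimes>\<^sub>M pts (Suc m) 0. d_up m a (insV 0 (fst w *v e1) (snd w)) = d_up m f (act (Suc m) 0 (adj (fst w)) (snd w))"
  proof eventually_elim
    case (elim w)
    have "faceG m j (insV 0 v z) = insV 0 v (faceG m j z)" for j v and z :: "'a point" by (simp add: faceG_def insV_def)
    then show ?case using elim by (simp add: d_up_eq act_faceG)
  qed
qed

lemma shapiro_AE_eq:
  assumes 1: "shapiro m f a" and 2: "shapiro m f' a'"
  shows "(AE z in pts m 1. a z = a' z) \<longleftrightarrow> (AE z in pts m 0. f z = f' z)"
proof (rule shapiro_AE)
  note [measurable] = shapiro_measurable[OF 1] shapiro_measurable[OF 2]
  show "Measurable.pred (pts m 1) (\<lambda>z. a z = a' z)" "Measurable.pred (pts m 0) (\<lambda>z. f z = f' z)" by measurable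
  show "AE w in haar \<Otimes>\<^sub>M pts m 0. (a (insV 0 (fst w *v e1) (snd w)) = a' (insV 0 (fst w *v e1) (snd w))) =
    (f (act m 0 (adj (fst w)) (snd w)) = f' (act m 0 (adj (fst w)) (snd w)))"
    using shapiroD[OF 1] shapiroD[OF 2] by eventually_elim simp
qed

lemma shapiro_zero: "shapiro m (\<lambda>_. 0) (\<lambda>_. 0)"
  by (simp add: shapiro_iff L0inv_zero)

lemma shapiro_diff:
  assumes 1: "shapiro m f a" and 2: "shapiro m f' a'"
  shows "shapiro m (\<lambda>z. f z - f' z) (\<lambda>z. a z - a' z)"
  unfolding shapiro_iff
proof (intro conjI L0inv_diff)
  show "AE w in haar \<Otimes>\<^sub>M pts m 0. a (insV 0 (fst w *v e1) (snd w)) - a' (insV 0 (fst w *v e1) (snd w)) =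
    f (act m 0 (adj (fst w)) (snd w)) - f' (act m 0 (adj (fst w)) (snd w))"
    using shapiroD[OF 1] shapiroD[OF 2] by eventually_elim simp
qed (rule shapiro_L0inv[OF 1] shapiro_L0inv[OF 2])+

lemma shapiro_AE_cong:
  assumes 1: "shapiro m f a" and f: "f' \<in> borel_measurable (pts m 0)" "AE z in pts m 0. f z = f' z"
    and a: "a' \<in> borel_measurable (pts m 1)" "AE z in pts m 1. a z = a' z"
  shows "shapiro m f' a'"
  unfolding shapiro_iff
proof (intro conjI)
  show "f' \<in> L0inv Unip m 0" by (rule L0inv_AE_eq[OF Unip_subset_SL2 shapiro_L0inv(1)[OF 1] f])
  show "a' \<in> L0inv SL2 m 1" by (rule L0inv_AE_eq[OF order_refl shapiro_L0inv(2)[OF 1] a])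
  note [measurable] = f(1)
  have "AE w in haar \<Otimes>\<^sub>M pts m 0. a (insV 0 (fst w *v e1) (snd w)) = a' (insV 0 (fst w *v e1) (snd w))"
    using nonsing_AE[OF nonsing_orbit_insV[of m 0] a(2)[unfolded One_nat_def]] by (simp add: case_prod_beta')
  moreover have "nonsing (haar \<Otimes>\<^sub>M pts m 0) (haar \<Otimes>\<^sub>M pts m 0) (\<lambda>(h, z). (h, act m 0 (adj h) z))"
  proof (rule nonsing_pair[OF sigma_finite_haar sigma_finite_pts sigma_finite_haar sigma_finite_pts nonsing_ident])
    show "(\<lambda>(h, z). act m 0 (adj h) z) \<in> haar \<Otimes>\<^sub>M pts m 0 \<rightarrow>\<^sub>M pts m 0"
      unfolding case_prod_beta' by measurable
    show "nonsing (pts m 0) (pts m 0) (act m 0 (adj h))" if "h \<in> space haar" for h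
      using that by (intro nonsing_act adj_SL2) (simp add: space_haar)
  qed
  from nonsing_AE[OF nonsing_compose[OF this nonsing_snd[OF sigma_finite_haar sigma_finite_pts]] f(2)]
  have "AE w in haar \<Otimes>\<^sub>M pts m 0. f (act m 0 (adj (fst w)) (snd w)) = f' (act m 0 (adj (fst w)) (snd w))"
    by (simp add: case_prod_beta')
  moreover note shapiroD[OF 1]
  ultimately show "AE w in haar \<Otimes>\<^sub>M pts m 0. a' (insV 0 (fst w *v e1) (snd w)) = f' (act m 0 (adj (fst w)) (snd w))"
    by eventually_elim simp
qed

lemma SL2_stabilizer:
  assumes "g \<in> SL2" "g *v e1 = e1" shows "g \<in> Unip"
proof -
  have "g$1$1 = 1" "g$2$1 = 0" using assms(2) by (auto simp: mat2)
  then have "g = unip (g$1$2)" using assms(1) by (simp add: SL2_iff mat2 unip_def)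
  then show ?thesis by (simp add: Unip_def)
qed

text \<open>The coset of \<open>h\<close> is represented by \<open>section_mat (h *v e1)\<close>,
  which differs from \<open>h\<close> by an element of \<open>Unip\<close>. Strict invariance makes
  the value independent of that element at every point.\<close>

lemma shapiro_exists:
  fixes f :: "'k::{real_normed_field,euclidean_space} cochain"
  assumes f: "f \<in> L0inv Unip (Suc m) 0" shows "\<exists>a. shapiro (Suc m) f a"
proof -
  obtain f' where f': "strict Unip (Suc m) 0 f'" and eq: "AE z in pts (Suc m) 0. f z = f' z"
    using strict_representative_Unip[OF f] .
  have [measurable]: "f' \<in> borel_measurable (pts (Suc m) 0)" using f' by (simp add: strict_def)
  define a where "a z = f' (act (Suc m) 0 (adj (section_mat (snd z 0))) (fst z, \<lambda>_. undefined))" for z :: "'k point"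
  have a_eq: "a (insV 0 (h *v e1) z) = f' (act (Suc m) 0 (adj h) z)"
    if h: "h \<in> SL2" and z: "z \<in> space (pts (Suc m) 0)" for h z
  proof -
    let ?v = "h *v e1" let ?s = "section_mat ?v"
    have v: "?v \<noteq> 0" by (rule mult_nonzero[OF h e1_nonzero])
    note s = section_mat[OF v]
    have "adj ?s ** h \<in> Unip"
    proof (rule SL2_stabilizer)
      show "(adj ?s ** h) *v e1 = e1"
        using adj_cancel(3)[OF s(1), of e1] by (simp add: matrix_vector_mul_assoc[symmetric] s(2))
    qed (intro SL2_mult adj_SL2 s(1) h)
    moreover have "act (Suc m) 0 (adj h) z \<in> space (pts (Suc m) 0)" by (rule act_space[OF adj_SL2[OF h] z])
    ultimately have "f' (act (Suc m) 0 (adj ?s ** h) (act (Suc m) 0 (adj h) z)) = f' (act (Suc m) 0 (adj h) z)"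
      using f' by (simp add: strict_def)
    moreover have "(adj ?s ** h) ** adj h = adj ?s" by (simp add: matrix_mul_assoc[symmetric] adj_right[OF h])
    moreover have "(fst z, \<lambda>_. undefined) = z" using z by (auto simp: space_pts prod_eq_iff)
    moreover have "insV 0 ?v z = (fst z, ins 0 0 ?v (snd z))" by (simp add: insV_def)
    ultimately show ?thesis by (simp add: a_def act_act) (simp add: ins_def)
  qed
  have m: "a \<in> borel_measurable (pts (Suc m) 1)"
  proof -
    have "(\<lambda>z. (fst z, \<lambda>_. undefined)) \<in> pts (Suc m) 1 \<rightarrow>\<^sub>M pts (Suc m) 0"
      by (rule measurable_Pair_pts) (simp_all add: space_PiM)
    then show ?thesis unfolding a_def[abs_def] by measurable
  qed
  have "strict SL2 (Suc m) 1 a"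
    unfolding strict_def
  proof (intro conjI m ballI)
    fix g :: "'k^2^2" and z :: "'k point" assume g: "g \<in> SL2" and z: "z \<in> space (pts (Suc m) 1)"
    define h where "h = section_mat (snd z 0)"
    have h: "h \<in> SL2" "h *v e1 = snd z 0"
      unfolding h_def by (intro section_mat space_pts_V[OF z]; simp)+
    define z0 where "z0 = (fst z, \<lambda>_::nat. undefined::'k^2)"
    have z0: "z0 \<in> space (pts (Suc m) 0)" using z by (auto simp: space_pts z0_def)
    have z1: "z = insV 0 (h *v e1) z0"
      using z unfolding h(2) by (auto simp: insV_def z0_def space_pts ins_def prod_eq_iff fun_eq_iff PiE_iff extensional_def)
    have "a (act (Suc m) 1 g z) = a (insV 0 ((g ** h) *v e1) (act (Suc m) 0 g z0))"
      unfolding z1 One_nat_def act_insV matrix_vector_mul_assoc ..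
    also have "\<dots> = f' (act (Suc m) 0 (adj (g ** h)) (act (Suc m) 0 g z0))"
      by (rule a_eq[OF SL2_mult[OF g h(1)] act_space[OF g z0]])
    also have "\<dots> = f' (act (Suc m) 0 (adj h) z0)"
      unfolding act_act adj_mult by (simp add: matrix_mul_assoc[symmetric] adj_left[OF g])
    also have "\<dots> = a z" unfolding z1 by (rule a_eq[OF h(1) z0, symmetric])
    finally show "a (act (Suc m) 1 g z) = a z" .
  qed
  then have "shapiro (Suc m) f' a"
    unfolding shapiro_iff using strict_L0inv[OF f']
    by (auto intro!: strict_L0inv AE_I2 a_eq simp: space_pair_measure space_haar)
  then have "shapiro (Suc m) f a"
    by (rule shapiro_AE_cong) (use eq m L0inv_measurable[OF f] in auto)
  then show ?thesis by blast
qed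

text \<open>The inverse of induction restricts to the coset of \<open>e1\<close>. This is a null
  set, so the restriction makes sense only for a strict representative.\<close>

lemma unshapiro_exists:
  fixes a :: "'k::{real_normed_field,euclidean_space} cochain"
  assumes a: "a \<in> L0inv SL2 (Suc m) 1" shows "\<exists>f. shapiro (Suc m) f a"
proof -
  obtain a' where a': "strict SL2 (Suc m) 1 a'" and eq: "AE z in pts (Suc m) 1. a z = a' z"
    using strict_representative_SL2[OF a] .
  have [measurable]: "a' \<in> borel_measurable (pts (Suc m) (Suc 0))" using a' by (simp add: strict_def)
  define f where "f z = a' (insV 0 e1 z)" for z
  have ms: "insV 0 v z \<in> space (pts (Suc m) 1)" if "v \<noteq> 0" "z \<in> space (pts (Suc m) 0)" for v :: "'k^2" and z :: "'k point"
    using measurable_space[OF measurable_insV_const[OF that(1)] that(2)] by simp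
  have f_eq: "f (act (Suc m) 0 (adj h) z) = a' (insV 0 (h *v e1) z)"
    if h: "h \<in> SL2" and z: "z \<in> space (pts (Suc m) 0)" for h z
  proof -
    have "act (Suc m) (Suc 0) (adj h) (insV 0 (h *v e1) z) = insV 0 e1 (act (Suc m) 0 (adj h) z)"
      unfolding act_insV adj_cancel(3)[OF h] ..
    moreover have "a' (act (Suc m) 1 (adj h) (insV 0 (h *v e1) z)) = a' (insV 0 (h *v e1) z)"
      using a' adj_SL2[OF h] ms[OF mult_nonzero[OF h e1_nonzero] z] unfolding strict_def by blast
    ultimately show ?thesis by (simp add: f_def)
  qed
  have m: "f \<in> borel_measurable (pts (Suc m) 0)" unfolding f_def[abs_def] by measurable
  have "strict Unip (Suc m) 0 f"
    unfolding strict_def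
  proof (intro conjI m ballI)
    fix g :: "'k^2^2" and z :: "'k point" assume "g \<in> Unip" and z: "z \<in> space (pts (Suc m) 0)"
    then obtain t where g: "g = unip t" by (auto simp: Unip_def)
    have g': "adj (unip (- t)) = unip t" by (simp add: mat2 unip_def)
    show "f (act (Suc m) 0 g z) = f z"
      using f_eq[OF unip_SL2[of "- t"] z] unfolding g' g unip_fix by (simp add: f_def)
  qed
  then have "shapiro (Suc m) f a'"
    unfolding shapiro_iff using strict_L0inv[OF a']
    by (auto intro!: strict_L0inv AE_I2 f_eq[symmetric] simp: space_pair_measure space_haar)
  then have "shapiro (Suc m) f a"
    by (rule shapiro_AE_cong) (use eq m L0inv_measurable[OF a] in auto)
  then show ?thesis by blast
qed

text \<open>Up to sign the induced cochain is \<open>d_right m 0 c\<close>: restriction from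
  \<open>SL2\<close> to \<open>Unip\<close> becomes the augmentation of the rows.\<close>

lemma shapiro_restriction:
  assumes c: "c \<in> L0inv SL2 m 0" shows "shapiro m c (\<lambda>z. c (faceV 0 0 z))"
  unfolding shapiro_iff
proof (intro conjI)
  show "c \<in> L0inv Unip m 0" using c Unip_subset_SL2 by (auto simp: L0inv_def)
  show "(\<lambda>z. c (faceV 0 0 z)) \<in> L0inv SL2 m 1" unfolding One_nat_def
    by (rule L0inv_pullback[OF c nonsing_faceV]) (simp_all add: act_faceV)
  have "AE h in haar. AE z in pts m 0. c (act m 0 (adj h) z) = c z"
    using L0inv_AE[OF c adj_SL2] by - (rule AE_I2, simp add: space_haar)
  then have "AE w in haar \<Otimes>\<^sub>M pts m 0. c (act m 0 (adj (fst w)) (snd w)) = c (snd w)"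
    by (intro AE_Tonelli[OF sigma_finite_haar sigma_finite_pts])
      (use L0inv_measurable[OF c, measurable] in simp_all)
  then show "AE w in haar \<Otimes>\<^sub>M pts m 0. c (faceV 0 0 (insV 0 (fst w *v e1) (snd w))) = c (act m 0 (adj (fst w)) (snd w))"
    using AE_space
  proof eventually_elim
    case (elim w)
    then have "snd (snd w) \<in> extensional {..<0}" by (auto simp: space_pair_measure space_pts)
    then show ?case using elim by (simp add: faceV_insV_0)
  qed
qed

section \<open>Measurable additive functions\<close>

lemma borel_outer_open:
  fixes K :: "'a::euclidean_space set"
  assumes K: "K \<in> sets borel" "emeasure lborel K \<noteq> \<infinity>" "e > 0"
  obtains U where "open U" "K \<subseteq> U" "emeasure lborel U < emeasure lborel K + ennreal e"
proof -
  have "K \<in> sets lebesgue" using K(1) by (auto intro: sets_completionI_sets)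
  then obtain U where U: "open U" "K \<subseteq> U" "U - K \<in> lmeasurable" "emeasure lebesgue (U - K) < ennreal e"
    using sets_lebesgue_outer_open[OF _ \<open>e > 0\<close>] by metis
  have "emeasure lborel U = emeasure lborel K + emeasure lborel (U - K)"
    using U(1,2) K(1) by (subst plus_emeasure) (auto intro!: arg_cong[where f="emeasure lborel"])
  moreover have "emeasure lborel (U - K) < ennreal e" using U K(1) by (simp add: emeasure_completion)
  ultimately have "emeasure lborel U < emeasure lborel K + ennreal e"
    using K(2) by (simp add: ennreal_add_left_cancel_less)
  then show ?thesis using that U by blast
qed

text \<open>A compact part \<open>K\<close> of positive measure lies in an open \<open>U\<close> of
  less than twice its measure. A small translate of \<open>K\<close> stays inside \<open>U\<close>;
  were it disjoint from \<open>K\<close>, the measure of \<open>U\<close> would be at least twice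
  that of \<open>K\<close>.\<close>

lemma steinhaus:
  fixes E :: "'a::euclidean_space set"
  assumes E: "E \<in> sets borel" "emeasure lborel E \<noteq> 0"
  obtains d where "d > 0" "\<And>x. norm x < d \<Longrightarrow> \<exists>y\<in>E. x + y \<in> E"
proof -
  have pos: "0 < emeasure lborel E" using E(2) by (simp add: zero_less_iff_neq_zero)
  obtain K where K: "compact K" "K \<subseteq> E" "0 < emeasure lborel K"
  proof -
    have "(\<Union>n. E \<inter> cball 0 (real n)) = E"
      using real_arch_simple by (auto simp: dist_norm)
    then obtain n where n: "emeasure lborel (E \<inter> cball 0 (real n)) \<noteq> 0"
      using E emeasure_UN_eq_0[of lborel "\<lambda>n. E \<inter> cball 0 (real n)"] by (auto simp: image_subset_iff)
    let ?F = "E \<inter> cball 0 (real n)"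
    have F: "?F \<in> sets borel" "emeasure lborel ?F \<noteq> \<infinity>"
      using E emeasure_bounded_finite[OF bounded_subset[OF bounded_cball Int_lower2], of E 0 "real n"] by auto
    define \<epsilon> where "\<epsilon> = measure lborel ?F / 2"
    have mF: "emeasure lborel ?F = ennreal (measure lborel ?F)" using F by (simp add: emeasure_eq_ennreal_measure)
    have "measure lborel ?F \<noteq> 0" using n mF by (metis ennreal_0)
    then have e: "\<epsilon> > 0" using measure_nonneg[of lborel ?F] unfolding \<epsilon>_def by linarith
    obtain T where T: "closed T" "T \<subseteq> ?F" "?F - T \<in> lmeasurable" "emeasure lebesgue (?F - T) < ennreal \<epsilon>"
      using sets_lebesgue_inner_closed[of ?F \<epsilon>] F(1) e by (auto intro: sets_completionI_sets)
    have "emeasure lborel ?F = emeasure lborel T + emeasure lborel (?F - T)"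
      using T F by (subst plus_emeasure) (auto intro!: arg_cong[where f="emeasure lborel"])
    moreover have "emeasure lborel (?F - T) < ennreal \<epsilon>" using T F by (simp add: emeasure_completion)
    moreover have "ennreal \<epsilon> \<le> emeasure lborel ?F" unfolding mF \<epsilon>_def by (intro ennreal_leI) simp
    ultimately have "emeasure lborel T \<noteq> 0" by (metis add_0 leD)
    moreover have "compact T" using T(1,2) by (meson bounded_cball bounded_subset compact_eq_bounded_closed inf.boundedE)
    ultimately show ?thesis using that[of T] T(2) by (auto simp: zero_less_iff_neq_zero)
  qed
  have Kb: "K \<in> sets borel" using K(1) by (simp add: borel_compact)
  have Kfin: "emeasure lborel K \<noteq> \<infinity>" using emeasure_bounded_finite[OF compact_imp_bounded[OF K(1)]] by simp
  define \<epsilon> where "\<epsilon> = measure lborel K"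
  have mK: "emeasure lborel K = ennreal \<epsilon>" using Kfin by (simp add: \<epsilon>_def emeasure_eq_ennreal_measure)
  have e: "\<epsilon> > 0" using K(3) mK by simp
  obtain U where U: "open U" "K \<subseteq> U" "emeasure lborel U < emeasure lborel K + ennreal \<epsilon>"
    using borel_outer_open[OF Kb Kfin e] by blast
  have "\<exists>d>0. \<forall>x\<in>K. \<forall>y. dist x y < d \<longrightarrow> y \<in> U"
  proof (cases "U = UNIV")
    case False
    have "\<exists>d>0. \<forall>x\<in>K. \<forall>y\<in>- U. d \<le> dist x y"
      by (rule separate_compact_closed) (use K U False in auto)
    then show ?thesis by (meson ComplI leD)
  qed (auto intro: exI[of _ 1])
  then obtain d where d: "d > 0" "\<And>x y. x \<in> K \<Longrightarrow> dist x y < d \<Longrightarrow> y \<in> U" by blast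
  show ?thesis
  proof (rule that[OF d(1)])
    fix x :: 'a assume x: "norm x < d"
    show "\<exists>y\<in>E. x + y \<in> E"
    proof (rule ccontr)
      assume no: "\<not> (\<exists>y\<in>E. x + y \<in> E)"
      let ?K = "(+) x ` K"
      have "K \<inter> ?K = {}" using no K(2) by auto
      moreover have Kx: "compact ?K" using K(1) by (rule compact_translation)
      ultimately have "emeasure lborel (K \<union> ?K) = emeasure lborel K + emeasure lborel ?K"
        using Kb by (intro plus_emeasure[symmetric]) (auto simp: borel_compact)
      also have "emeasure lborel ?K = emeasure lborel K"
      proof -
        have "emeasure lborel K = emeasure (distr lborel borel ((+) (- x))) K" by (simp add: lborel_distr_plus)
        also have "\<dots> = emeasure lborel ((+) (- x) -` K \<inter> space lborel)" using Kb by (intro emeasure_distr) auto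
        also have "(+) (- x) -` K \<inter> space lborel = ?K" by (force simp: image_iff)
        finally show ?thesis by simp
      qed
      finally have "emeasure lborel (K \<union> ?K) = emeasure lborel K + ennreal \<epsilon>" by (simp add: mK)
      moreover have "?K \<subseteq> U" using d(2) x by (auto simp: dist_norm)
      then have "emeasure lborel (K \<union> ?K) \<le> emeasure lborel U" using U by (intro emeasure_mono) auto
      ultimately show False using U(3) by simp
    qed
  qed
qed

text \<open>Cauchy's equation for a function that is only almost everywhere equal to a measurable
  one. The Steinhaus property of a set where \<open>g\<close> is bounded and agrees with \<alpha>
  bounds \<alpha> near 0, and bounded additive functions are linear.\<close>

lemma measurable_additive_imp_linear:
  fixes \<alpha> :: "'a::euclidean_space \<Rightarrow> real"
  assumes add: "\<And>s t. \<alpha> (s + t) = \<alpha> s + \<alpha> t"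
    and g: "g \<in> borel_measurable lborel" and ag: "AE t in lborel. \<alpha> t = g t"
  shows "linear \<alpha>"
proof -
  have z: "\<alpha> 0 = 0" using add[of 0 0] by simp
  have neg: "\<alpha> (- t) = - \<alpha> t" for t using add[of t "- t"] z by simp
  have nat: "\<alpha> (real n *\<^sub>R t) = real n * \<alpha> t" for n t
    by (induction n) (simp_all add: z scaleR_left_distrib add algebra_simps)
  obtain N where N: "N \<in> null_sets lborel" "{t. \<alpha> t \<noteq> g t} \<subseteq> N"
    using ag by (auto simp: eventually_ae_filter)
  define E where "E n = {t. \<bar>g t\<bar> \<le> real n} - N" for n
  have Eb: "E n \<in> sets borel" for n
  proof -
    have "{t \<in> space lborel. \<bar>g t\<bar> \<le> real n} \<in> sets lborel" using g by measurable
    then show ?thesis using N(1) by (auto simp: E_def null_sets_def)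
  qed
  obtain n where n: "emeasure lborel (E n) \<noteq> 0"
  proof (rule ccontr)
    assume "\<not> thesis"
    then have "E n \<in> null_sets lborel" for n using Eb that by (auto simp: null_sets_def)
    then have "(\<Union>n. E n) \<union> N \<in> null_sets lborel" using N(1) by (intro null_sets.Un null_sets_UN) auto
    moreover have "(\<Union>n. E n) \<union> N = UNIV" using real_arch_simple by (auto simp: E_def)
    ultimately have "emeasure lborel (UNIV :: 'a set) = 0" by (simp add: null_sets_def)
    then show False by (simp add: emeasure_lborel_UNIV)
  qed
  obtain d where d: "d > 0" "\<And>x. norm x < d \<Longrightarrow> \<exists>y\<in>E n. x + y \<in> E n"
    using steinhaus[OF Eb n] by blast
  define B where "B = 2 * real n"
  have B: "\<bar>\<alpha> x\<bar> \<le> B" if nx: "norm x < d" for x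
  proof -
    obtain y where y: "y \<in> E n" "x + y \<in> E n" using d(2)[OF nx] by blast
    have "\<bar>\<alpha> t\<bar> \<le> real n" if "t \<in> E n" for t
    proof -
      have "\<alpha> t = g t" "\<bar>g t\<bar> \<le> real n" using that N(2) unfolding E_def by blast+
      then show ?thesis by simp
    qed
    from this[OF y(1)] this[OF y(2)] add[of x y] show ?thesis by (simp add: B_def)
  qed
  have scale: "\<alpha> (c *\<^sub>R x) = c * \<alpha> x" for c x
  proof -
    \<comment> \<open>The defect of homogeneity is additive and vanishes at 1, so it has period 1
      and is bounded by its values on the unit interval. A bounded additive function is
      zero.\<close>
    define h where "h c = \<alpha> (c *\<^sub>R x) - c * \<alpha> x" for c
    have h_add: "h (s + t) = h s + h t" for s t by (simp add: h_def scaleR_left_distrib add algebra_simps)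
    have h0: "h 0 = 0" by (simp add: h_def z)
    have h_neg: "h (- t) = - h t" for t using h_add[of t "- t"] h0 by simp
    have h_nat: "h (real k * t) = real k * h t" for k t
      by (induction k) (simp_all add: h0 distrib_right h_add)
    have h_1: "h 1 = 0" by (simp add: h_def)
    have h_real_nat: "h (real k) = 0" for k using h_nat[of k 1] h_1 by simp
    have h_int: "h (of_int k) = 0" for k :: int
    proof (cases "k \<ge> 0")
      case True
      then have "(of_int k :: real) = real (nat k)" by simp
      then show ?thesis by (simp only: h_real_nat)
    next
      case False
      then have "(of_int k :: real) = - real (nat (- k))" by simp
      then show ?thesis by (simp only: h_neg h_real_nat)
    qed
    \<comment> \<open>All multiples of \<open>x\<close> by numbers in the unit interval, divided by
      \<open>k\<close>, lie in the ball on which \<open>B\<close> bounds \<alpha>.\<close>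
    obtain k :: nat where k: "norm x < real k * d" using reals_Archimedean3[OF d(1)] by blast
    have k0: "k > 0" using k norm_ge_zero[of x] by (cases k) auto
    have bd: "\<bar>h t\<bar> \<le> real k * B + \<bar>\<alpha> x\<bar>" for t
    proof -
      define s where "s = frac t"
      have s: "0 \<le> s" "s < 1" by (simp_all add: s_def frac_lt_1)
      have "t = of_int \<lfloor>t\<rfloor> + s" by (simp add: s_def frac_def)
      then have "h t = h s" by (metis h_add h_int add_0)
      have "norm ((s / real k) *\<^sub>R x) \<le> norm x / real k" using s k0 by (simp add: divide_simps mult_left_le_one_le)
      also have "\<dots> < d" using k k0 by (simp add: divide_simps mult.commute)
      finally have "\<bar>\<alpha> ((s / real k) *\<^sub>R x)\<bar> \<le> B" by (rule B)
      moreover have "\<alpha> (s *\<^sub>R x) = real k * \<alpha> ((s / real k) *\<^sub>R x)"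
        using nat[of k "(s / real k) *\<^sub>R x"] k0 by simp
      ultimately have "\<bar>\<alpha> (s *\<^sub>R x)\<bar> \<le> real k * B" by (simp add: abs_mult mult_left_mono)
      moreover have "\<bar>s * \<alpha> x\<bar> \<le> \<bar>\<alpha> x\<bar>" using s by (simp add: abs_mult mult_left_le_one_le)
      ultimately have "\<bar>h s\<bar> \<le> real k * B + \<bar>\<alpha> x\<bar>" unfolding h_def by linarith
      then show ?thesis using \<open>h t = h s\<close> by simp
    qed
    have "h c = 0"
    proof (rule ccontr)
      assume "h c \<noteq> 0"
      then obtain j :: nat where j: "real k * B + \<bar>\<alpha> x\<bar> < real j * \<bar>h c\<bar>"
        using reals_Archimedean3[of "\<bar>h c\<bar>"] by auto
      have "\<bar>h (real j * c)\<bar> = real j * \<bar>h c\<bar>" by (simp add: h_nat abs_mult)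
      then show False using bd[of "real j * c"] j by simp
    qed
    then show ?thesis by (simp add: h_def)
  qed
  show ?thesis by (rule linearI) (simp_all add: add scale)
qed

section \<open>Cohomology in low degrees\<close>

lemma pts_obtain: "AE z in pts m 0. P z \<Longrightarrow> \<exists>z\<in>space (pts m 0). P z"
proof (induction m arbitrary: P)
  case 0
  have "AE y in \<Pi>\<^sub>M i\<in>{..<0::nat}. haar. AE x in \<Pi>\<^sub>M i\<in>{..<0::nat}. plane. P (y, x)"
    using AE_Fubini[OF sigma_finite_PiM_haar sigma_finite_PiM_plane 0[unfolded pts_def]] .
  then have "P (\<lambda>_. undefined, \<lambda>_. undefined)" unfolding lessThan_0 AE_PiM_empty .
  moreover have "(\<lambda>_. undefined, \<lambda>_. undefined) \<in> space (pts 0 0)" by (simp add: space_pts)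
  ultimately show ?case by blast
next
  case (Suc m)
  have "AE w in haar \<Otimes>\<^sub>M pts m 0. P (insG m (fst w) (snd w))"
    using nonsing_AE[OF nonsing_insG Suc.prems] by (simp add: case_prod_beta')
  from AE_Fubini[OF sigma_finite_haar sigma_finite_pts this]
  obtain u where u: "u \<in> SL2" "AE z in pts m 0. P (insG m u z)" by (rule AE_haar_obtain) simp
  from Suc.IH[OF u(2)] obtain z where "z \<in> space (pts m 0)" "P (insG m u z)" by blast
  then show ?case using measurable_space[OF measurable_insG_const[OF u(1)]] by blast
qed

text \<open>Nothing is known about the measurability of \<open>\<rho>\<close> beforehand, so Fubini cannot be applied to
  \<open>\<rho> t = R t z\<close>; it is applied to \<open>R t z = R t z'\<close> instead.\<close>

lemma AE_parameter_selection:
  assumes \<sigma>: "sigma_finite_measure T" "sigma_finite_measure M" and ob: "\<And>P. AE z in M. P z \<Longrightarrow> \<exists>z\<in>space M. P z"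
    and R: "(\<lambda>w. R (fst w) (snd w)) \<in> borel_measurable (T \<Otimes>\<^sub>M M)"
    and ae: "AE t in T. AE z in M. \<rho> t = (R t z :: real)"
  obtains z' where "z' \<in> space M" "AE t in T. \<rho> t = R t z'"
proof -
  have "AE t in T. AE w in M \<Otimes>\<^sub>M M. R t (fst w) = R t (snd w)"
    using ae AE_space
  proof eventually_elim
    case (elim t)
    have [measurable]: "R t \<in> borel_measurable M"
      using measurable_compose[OF measurable_Pair1'[OF elim(2)] R] by simp
    have "AE z in M. AE z' in M. R t z = R t z'"
      using elim(1)
    proof eventually_elim
      case (elim z)
      show ?case using \<open>AE z in M. \<rho> t = R t z\<close> by eventually_elim (use elim in simp)
    qed
    then show ?case by (intro AE_Tonelli[OF \<sigma>(2,2)]) simp_all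
  qed
  moreover have "(\<lambda>x. (fst x, fst (snd x))) \<in> T \<Otimes>\<^sub>M (M \<Otimes>\<^sub>M M) \<rightarrow>\<^sub>M T \<Otimes>\<^sub>M M"
    "(\<lambda>x. (fst x, snd (snd x))) \<in> T \<Otimes>\<^sub>M (M \<Otimes>\<^sub>M M) \<rightarrow>\<^sub>M T \<Otimes>\<^sub>M M" by measurable
  note [measurable] = measurable_compose[OF this(1) R, simplified] measurable_compose[OF this(2) R, simplified]
  ultimately have "AE x in T \<Otimes>\<^sub>M (M \<Otimes>\<^sub>M M). R (fst x) (fst (snd x)) = R (fst x) (snd (snd x))"
    by (intro AE_Tonelli[OF \<sigma>(1) sigma_finite_pair[OF \<sigma>(2,2)]]) simp_all
  from nonsing_AE[OF nonsing_exchange[OF \<sigma>(2,1,2)] this]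
  have "AE x in M \<Otimes>\<^sub>M (T \<Otimes>\<^sub>M M). R (fst (snd x)) (fst x) = R (fst (snd x)) (snd (snd x))"
    by (simp add: case_prod_beta')
  from ob[OF AE_Fubini[OF \<sigma>(2) sigma_finite_pair[OF \<sigma>] this]]
  obtain z' where z': "z' \<in> space M" "AE w in T \<Otimes>\<^sub>M M. R (fst w) z' = R (fst w) (snd w)" by auto
  from AE_Fubini[OF \<sigma> z'(2)] ae
  have "AE t in T. \<rho> t = R t z'"
  proof eventually_elim
    case (elim t)
    then have "AE z in M. R t z' = R t z \<and> \<rho> t = R t z" by simp
    from ob[OF this] show ?case by auto
  qed
  then show ?thesis using that z' by blast
qed

lemma AE_pts_const: "AE z in pts (Suc m) 0. (c::real) = d \<Longrightarrow> c = d"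
  using pts_obtain[of "\<lambda>_. c = d" "Suc m"] by blast

lemma d_up_act: "d_up m (\<lambda>z. f (act m q h z)) z = d_up m f (act (Suc m) q h z)"
  by (simp add: d_up_eq act_faceG)

lemma d_up_1: "d_up (Suc 0) f z = f (faceG (Suc 0) 0 z) - f (faceG (Suc 0) (Suc 0) z)"
  by (simp add: d_up_eq)

lemma d_up_const: "d_up (Suc 0) (\<lambda>_. c) z = 0"
  by (simp add: d_up_1)

text \<open>The primitive supplied by \<open>up_exact_plain\<close> has no variables left.\<close>

lemma d_up_1_zero_imp_const:
  assumes f: "f \<in> borel_measurable (pts (Suc 0) 0)" and d: "AE z in pts (Suc (Suc 0)) 0. d_up (Suc 0) f z = 0"
  shows "\<exists>c. AE z in pts (Suc 0) 0. f z = c"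
proof -
  obtain u where u: "AE z in pts (Suc 0) 0. f z = d_up 0 (\<lambda>z. f (insG 0 u z)) z"
    using up_exact_plain[OF f d] by (rule AE_haar_obtain)
  have "faceG 0 0 z = (\<lambda>_. undefined, snd z)" for z :: "'a point" by (simp add: faceG_def face_def restrict_def)
  then have "d_up 0 (\<lambda>z. f (insG 0 u z)) z = f (insG 0 u (\<lambda>_. undefined, \<lambda>_. undefined))"
    if "z \<in> space (pts (Suc 0) 0)" for z using that by (simp add: d_up_eq space_pts)
  then have "AE z in pts (Suc 0) 0. f z = f (insG 0 u (\<lambda>_. undefined, \<lambda>_. undefined))"
    using u AE_space by (auto elim!: eventually_elim2)
  then show ?thesis by blast
qed

text \<open>The primitive is not invariant, but its change under \<open>g\<close> has zero
  differential, hence is a constant \<xi>. As \<open>g\<close> varies, \<xi> is the homomorphism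
  that belongs to the class (\<open>primitive_additive\<close>).\<close>

lemma one_cocycle_primitive:
  assumes L: "L \<subseteq> SL2" and f: "f \<in> L0inv L (Suc (Suc 0)) 0" and d: "AE z in pts (Suc (Suc (Suc 0))) 0. d_up (Suc (Suc 0)) f z = 0"
  obtains F \<xi> where "F \<in> borel_measurable (pts (Suc 0) 0)" "AE z in pts (Suc (Suc 0)) 0. f z = d_up (Suc 0) F z"
    "\<And>g. g \<in> L \<Longrightarrow> AE z in pts (Suc 0) 0. F (act (Suc 0) 0 g z) = F z + \<xi> g"
proof -
  note fm[measurable] = L0inv_measurable[OF f]
  obtain u where u: "u \<in> SL2" "AE z in pts (Suc (Suc 0)) 0. f z = d_up (Suc 0) (\<lambda>z. f (insG (Suc 0) u z)) z"
    using up_exact_plain[OF fm d] by (rule AE_haar_obtain)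
  define F where "F z = f (insG (Suc 0) u z)" for z
  have Fm: "F \<in> borel_measurable (pts (Suc 0) 0)"
    unfolding F_def[abs_def] by (rule measurable_compose[OF measurable_insG_const[OF u(1)] fm])
  have fF: "AE z in pts (Suc (Suc 0)) 0. f z = d_up (Suc 0) F z" using u(2) by (simp add: F_def[abs_def])
  have "\<exists>c. AE z in pts (Suc 0) 0. F (act (Suc 0) 0 g z) - F z = c" if g: "g \<in> L" for g
  proof (rule d_up_1_zero_imp_const)
    have g': "g \<in> SL2" using g L by blast
    show "(\<lambda>z. F (act (Suc 0) 0 g z) - F z) \<in> borel_measurable (pts (Suc 0) 0)"
      using Fm measurable_compose[OF measurable_act_const[OF g'] Fm] by simp
    show "AE z in pts (Suc (Suc 0)) 0. d_up (Suc 0) (\<lambda>z. F (act (Suc 0) 0 g z) - F z) z = 0"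
      using fF nonsing_AE[OF nonsing_act[OF g'] fF] L0inv_AE[OF f g]
      by eventually_elim (simp add: d_up_diff d_up_act)
  qed
  then have "\<forall>g\<in>L. \<exists>c. AE z in pts (Suc 0) 0. F (act (Suc 0) 0 g z) - F z = c" by blast
  from bchoice[OF this] obtain \<xi> where \<xi>: "\<And>g. g \<in> L \<Longrightarrow> AE z in pts (Suc 0) 0. F (act (Suc 0) 0 g z) - F z = \<xi> g"
    by blast
  have "AE z in pts (Suc 0) 0. F (act (Suc 0) 0 g z) = F z + \<xi> g" if "g \<in> L" for g
    using \<xi>[OF that] by eventually_elim simp
  then show ?thesis using that Fm fF by blast
qed

lemma primitive_additive:
  fixes F :: "'k::{real_normed_field,euclidean_space} cochain"
  assumes \<xi>: "\<And>g. g \<in> L \<Longrightarrow> AE z in pts (Suc 0) 0. F (act (Suc 0) 0 g z) = F z + \<xi> g"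
    and g: "g \<in> L" and h: "h \<in> L" and gh: "g ** h \<in> L" and L: "L \<subseteq> SL2"
  shows "\<xi> (g ** h) = \<xi> g + \<xi> h"
proof -
  have "AE z in pts (Suc 0) 0. F (act (Suc 0) 0 g (act (Suc 0) 0 h z)) = F (act (Suc 0) 0 h z) + \<xi> g"
    by (rule nonsing_AE[OF nonsing_act \<xi>[OF g]]) (use h L in blast)
  with \<xi>[OF gh] \<xi>[OF h] have "AE z in (pts (Suc 0) 0 :: 'k point measure). \<xi> (g ** h) = \<xi> g + \<xi> h"
  proof eventually_elim
    case (elim z)
    then show ?case using elim(3)[unfolded act_act] by linarith
  qed
  then show ?thesis by (rule AE_pts_const)
qed

section \<open>First cohomology of \<open>Unip\<close> and of \<open>SL2\<close>\<close>

lemma linear_borel: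
  fixes \<alpha> :: "'a::euclidean_space \<Rightarrow> real"
  shows "linear \<alpha> \<Longrightarrow> \<alpha> \<in> borel_measurable borel"
  by (intro borel_measurable_continuous_onI linear_continuous_on) (simp add: linear_conv_bounded_linear)

lemma measurable_nu_pts [measurable]: "(\<lambda>z. nu (fst z 0)) \<in> borel_measurable (pts (Suc m) q)"
  by measurable

text \<open>The homomorphism of a primitive is additive in the parameter of \<open>Unip\<close>, and
  linear once it is measurable; \<open>AE_parameter_selection\<close> reads it off at one point.
  Since \<open>\<alpha> \<circ> nu\<close> changes under \<open>Unip\<close> in the same way as the
  primitive, their difference is invariant.\<close>

lemma H1_Unip_representative:
  fixes f :: "'k::{real_normed_field,euclidean_space} cochain"
  assumes f: "f \<in> L0inv Unip (Suc (Suc 0)) 0" and d: "AE z in pts (Suc (Suc (Suc 0))) 0. d_up (Suc (Suc 0)) f z = 0"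
  shows "\<exists>\<alpha>. linear \<alpha> \<and> (\<exists>b\<in>L0inv Unip (Suc 0) 0. AE z in pts (Suc (Suc 0)) 0.
    f z = d_up (Suc 0) (\<lambda>z. \<alpha> (nu (fst z 0))) z + d_up (Suc 0) b z)"
proof -
  obtain F \<xi> where Fm[measurable]: "F \<in> borel_measurable (pts (Suc 0) 0)" and fF: "AE z in pts (Suc (Suc 0)) 0. f z = d_up (Suc 0) F z"
    and \<xi>: "\<And>g. g \<in> Unip \<Longrightarrow> AE z in pts (Suc 0) 0. F (act (Suc 0) 0 g z) = F z + \<xi> g"
    using one_cocycle_primitive[OF Unip_subset_SL2 f d] by blast
  define \<alpha> where "\<alpha> t = \<xi> (unip t)" for t
  have add: "\<alpha> (s + t) = \<alpha> s + \<alpha> t" for s t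
    using primitive_additive[where L=Unip and F=F and \<xi>=\<xi>, OF \<xi>, of "unip s" "unip t"] Unip_subset_SL2
    by (simp add: \<alpha>_def unip_add Unip_def)
  have "AE t in lborel. AE z in pts (Suc 0) 0. \<alpha> t = F (act (Suc 0) 0 (unip t) z) - F z"
  proof (rule AE_I2)
    show "AE z in pts (Suc 0) 0. \<alpha> t = F (act (Suc 0) 0 (unip t) z) - F z" for t
      using \<xi>[of "unip t"] by (auto simp: Unip_def \<alpha>_def elim: eventually_mono)
  qed
  moreover have "(\<lambda>w. F (act (Suc 0) 0 (unip (fst w)) (snd w)) - F (snd w)) \<in> borel_measurable (lborel \<Otimes>\<^sub>M pts (Suc 0) 0)"
    by measurable
  ultimately obtain z where z: "z \<in> space (pts (Suc 0) 0)" "AE t in lborel. \<alpha> t = F (act (Suc 0) 0 (unip t) z) - F z"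
    using AE_parameter_selection[OF lborel.sigma_finite_measure_axioms sigma_finite_pts pts_obtain,
      where R="\<lambda>t z. F (act (Suc 0) 0 (unip t) z) - F z" and \<rho>=\<alpha>] by blast
  have lin: "linear \<alpha>"
  proof (rule measurable_additive_imp_linear[OF add _ z(2)])
    note [measurable] = z(1)
    show "(\<lambda>t. F (act (Suc 0) 0 (unip t) z) - F z) \<in> borel_measurable lborel" by measurable
  qed
  note [measurable] = linear_borel[OF lin]
  define b where "b z = F z - \<alpha> (nu (fst z 0))" for z
  have "b \<in> L0inv Unip (Suc 0) 0"
    unfolding L0inv_def
  proof (intro CollectI conjI ballI)
    show "b \<in> borel_measurable (pts (Suc 0) 0)" unfolding b_def[abs_def] by measurable
    fix g :: "'k^2^2" assume "g \<in> Unip"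
    then obtain t where g: "g = unip t" by (auto simp: Unip_def)
    show "AE z in pts (Suc 0) 0. b (act (Suc 0) 0 g z) = b z"
      using \<xi>[OF \<open>g \<in> Unip\<close>] AE_space
    proof eventually_elim
      case (elim z)
      have "fst z 0 \<in> SL2" using elim(2) by (rule space_pts_G) simp
      then show ?case using elim(1) add[of t "nu (fst z 0)"] by (simp add: b_def g fst_act nu_unip \<alpha>_def)
    qed
  qed
  moreover have "AE z in pts (Suc (Suc 0)) 0. f z = d_up (Suc 0) (\<lambda>z. \<alpha> (nu (fst z 0))) z + d_up (Suc 0) b z"
    using fF by eventually_elim (simp add: b_def[abs_def] d_up_diff)
  ultimately show ?thesis using lin by blast
qed

text \<open>The two primitives differ by a constant; translation by \<open>unip t\<close> leaves
  \<open>b\<close> alone and adds \<open>\<alpha> t\<close> to the other one.\<close>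

lemma linear_class_injective:
  fixes \<alpha> :: "'k::{real_normed_field,euclidean_space} \<Rightarrow> real"
  assumes \<alpha>: "linear \<alpha>" and b: "b \<in> L0inv Unip (Suc 0) 0"
    and eq: "AE z in pts (Suc (Suc 0)) 0. d_up (Suc 0) (\<lambda>z. \<alpha> (nu (fst z 0))) z = d_up (Suc 0) b z"
  shows "\<alpha> t = 0"
proof -
  note [measurable] = linear_borel[OF \<alpha>] L0inv_measurable[OF b]
  have "\<exists>c. AE z in pts (Suc 0) 0. \<alpha> (nu (fst z 0)) - b z = c"
  proof (rule d_up_1_zero_imp_const)
    show "AE z in pts (Suc (Suc 0)) 0. d_up (Suc 0) (\<lambda>z. \<alpha> (nu (fst z 0)) - b z) z = 0"
      using eq by eventually_elim (simp add: d_up_diff)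
  qed measurable
  then obtain c where c: "AE z in pts (Suc 0) 0. \<alpha> (nu (fst z 0)) - b z = c" by blast
  have "AE z in pts (Suc 0) 0. b (act (Suc 0) 0 (unip t) z) = b z" by (rule L0inv_AE[OF b]) (simp add: Unip_def)
  with c nonsing_AE[OF nonsing_act[OF unip_SL2[of t]] c] AE_space
  have "AE z in (pts (Suc 0) 0 :: 'k point measure). \<alpha> t = 0"
  proof eventually_elim
    case (elim z)
    have "fst z 0 \<in> SL2" using elim(3) by (rule space_pts_G) simp
    then show ?case using elim by (simp add: fst_act nu_unip linear_add[OF \<alpha>])
  qed
  then show ?thesis by (rule AE_pts_const)
qed

text \<open>On \<open>unip (4 * t)\<close> additivity multiplies the value by four while conjugation
  by \<open>a\<close> leaves it unchanged. The lower unipotents follow by conjugation with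
  \<open>w\<close>, and the two groups generate \<open>SL2\<close>: a matrix with nonzero lower left
  entry is a product of three unipotents, and \<open>low 1\<close> makes that entry nonzero
  otherwise.\<close>

lemma SL2_hom_trivial:
  fixes \<xi> :: "'k::{real_normed_field,euclidean_space}^2^2 \<Rightarrow> real"
  assumes hom: "\<And>g h. g \<in> SL2 \<Longrightarrow> h \<in> SL2 \<Longrightarrow> \<xi> (g ** h) = \<xi> g + \<xi> h" and g: "g \<in> SL2"
  shows "\<xi> g = 0"
proof -
  define low :: "'k \<Rightarrow> 'k^2^2" where "low t = vector [vector [1, 0], vector [t, 1]]" for t
  define a :: "'k^2^2" where "a = vector [vector [2, 0], vector [0, inverse 2]]"
  define w :: "'k^2^2" where "w = vector [vector [0, -1], vector [1, 0]]"
  have mem: "low t \<in> SL2" "a \<in> SL2" "w \<in> SL2" for t by (simp_all add: SL2_iff low_def a_def w_def)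
  note hom' = hom[OF unip_SL2 unip_SL2]
  have u: "\<xi> (unip t) = 0" for t
  proof -
    have "a ** unip t = unip (4 * t) ** a" by (simp add: mat2 a_def unip_def field_simps)
    then have "\<xi> a + \<xi> (unip t) = \<xi> (unip (4 * t)) + \<xi> a"
      using hom[OF mem(2) unip_SL2, of t] hom[OF unip_SL2 mem(2), of "4 * t"] by simp
    moreover have "\<xi> (unip (4 * t)) = 4 * \<xi> (unip t)"
      using hom'[of t t] hom'[of "t + t" "t + t"] unip_add[of t t] unip_add[of "t + t" "t + t"] by simp
    ultimately show ?thesis by simp
  qed
  have l: "\<xi> (low t) = 0" for t
  proof -
    have "w ** unip (- t) = low t ** w" by (simp add: mat2 w_def unip_def low_def)
    then show ?thesis using hom[OF mem(3) unip_SL2, of "- t"] hom[OF mem(1,3), of t] u by simp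
  qed
  have gen: "\<xi> g = 0" if g: "g \<in> SL2" and nz: "g$2$1 \<noteq> 0" for g
  proof -
    have "g = unip ((g$1$1 - 1) / g$2$1) ** (low (g$2$1) ** unip ((g$2$2 - 1) / g$2$1))"
      using g nz by (simp add: SL2_iff mat2 unip_def low_def field_simps)
    then have "\<xi> g = \<xi> (unip ((g$1$1 - 1) / g$2$1)) + (\<xi> (low (g$2$1)) + \<xi> (unip ((g$2$2 - 1) / g$2$1)))"
      using hom mem(1) unip_SL2 SL2_mult by metis
    then show ?thesis by (simp add: u l)
  qed
  show ?thesis
  proof (cases "g$2$1 = 0")
    case True
    then have "g$1$1 \<noteq> 0" using g by (auto simp: SL2_iff)
    then have "(low 1 ** g)$2$1 \<noteq> 0" using True by (simp add: mat2 low_def)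
    then have "\<xi> (low 1 ** g) = 0" by (rule gen[OF SL2_mult[OF mem(1) g]])
    then show ?thesis using hom[OF mem(1)[of 1] g] l by simp
  qed (rule gen[OF g])
qed

lemma H1_SL2_trivial:
  fixes c :: "'k::{real_normed_field,euclidean_space} cochain"
  assumes c: "c \<in> L0inv SL2 (Suc (Suc 0)) 0" and d: "AE z in pts (Suc (Suc (Suc 0))) 0. d_up (Suc (Suc 0)) c z = 0"
  shows "\<exists>e\<in>L0inv SL2 (Suc 0) 0. AE z in pts (Suc (Suc 0)) 0. c z = d_up (Suc 0) e z"
proof -
  obtain F \<xi> where F: "F \<in> borel_measurable (pts (Suc 0) 0)" and cF: "AE z in pts (Suc (Suc 0)) 0. c z = d_up (Suc 0) F z"
    and \<xi>: "\<And>g. g \<in> SL2 \<Longrightarrow> AE z in pts (Suc 0) 0. F (act (Suc 0) 0 g z) = F z + \<xi> g"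
    using one_cocycle_primitive[OF order_refl c d] by blast
  have "\<xi> g = 0" if "g \<in> SL2" for g
    using primitive_additive[where L=SL2 and F=F and \<xi>=\<xi>, OF \<xi>] SL2_mult that
    by (intro SL2_hom_trivial[of \<xi>]) auto
  then have "F \<in> L0inv SL2 (Suc 0) 0" using F \<xi> by (simp add: L0inv_def)
  then show ?thesis using cF by blast
qed

text \<open>A central extension of the additive group on which doubling lifts to an automorphism fixing
  the centre is split: the commutator pairing is invariant under doubling and bilinear, hence
  zero, and comparing doubling with its lift gives the splitting.\<close>

lemma doubling_invariant_cocycle_trivial:
  fixes \<kappa> :: "'k::{real_normed_field,euclidean_space}^2^2 \<Rightarrow> 'k^2^2 \<Rightarrow> real"
  assumes coc: "\<And>g h k. g \<in> SL2 \<Longrightarrow> h \<in> SL2 \<Longrightarrow> k \<in> SL2 \<Longrightarrow> \<kappa> g h + \<kappa> (g ** h) k = \<kappa> h k + \<kappa> g (h ** k)"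
    and a: "a \<in> SL2" "\<And>t. a ** unip t = unip (t + t) ** a"
    and \<rho>: "\<And>t. \<rho> t = \<kappa> (unip t) (unip t) - (\<kappa> a (unip t) - \<kappa> (unip (t + t)) a)"
  shows "\<kappa> (unip s) (unip t) = \<rho> s + \<rho> t - \<rho> (s + t)"
proof -
  define c where "c s t = \<kappa> (unip s) (unip t)" for s t
  \<comment> \<open>Write the extension as pairs with multiplication twisted by \<kappa>.
    Conjugation by a lift of \<open>a\<close> sends \<open>(unip t, x)\<close> to
    \<open>(unip (t + t), x + T t)\<close>.\<close>
  define T where "T t = \<kappa> a (unip t) - \<kappa> (unip (t + t)) a" for t
  note u = unip_SL2
  have c: "c x y + c (x + y) z = c y z + c x (y + z)" for x y z
    using coc[OF u u u, of x y z] by (simp add: c_def unip_add)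
  have dbl: "c (s + s) (t + t) = c s t + T (s + t) - T s - T t" for s t
    using coc[OF a(1) u u, of s t] coc[OF u a(1) u, of "s + s" t] coc[OF u u a(1), of "s + s" "t + t"]
    by (simp add: c_def T_def a(2) unip_add algebra_simps)
  define K where "K s t = c s t - c t s" for s t
  have K_dbl: "K (s + s) (t + t) = K s t" for s t
    using dbl[of s t] dbl[of t s] by (simp add: K_def add.commute)
  have K_add: "K (s + s') t = K s t + K s' t" for s s' t
    using c[of s s' t] c[of s t s'] c[of t s s'] by (simp add: K_def add.commute)
  have K_anti: "K s t = - K t s" for s t by (simp add: K_def)
  \<comment> \<open>Bilinearity gives a factor four under doubling, invariance a factor one.\<close>
  have "K s t = 0" for s t
  proof -
    have "K (s + s) (t + t) = 2 * K s (t + t)" using K_add[of s s "t + t"] by linarith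
    moreover have "K s (t + t) = 2 * K s t" using K_anti[of s "t + t"] K_anti[of s t] K_add[of t t s] by linarith
    ultimately show ?thesis using K_dbl[of s t] by simp
  qed
  then have sym: "c s t = c t s" for s t by (simp add: K_def)
  \<comment> \<open>With \<open>c\<close> symmetric the extension is abelian, so squaring is a
    homomorphism: the pull-back of \<open>c\<close> under doubling is twice \<open>c\<close> up to
    the coboundary of \<open>c t t\<close>.\<close>
  have sq: "c (s + s) (t + t) + c s s + c t t = c (s + t) (s + t) + 2 * c s t" for s t
    using c[of s s "t + t"] c[of s t t] c[of "s + t" s t] c[of s "s + t" t] sym[of s "s + t"]
    by (simp add: ac_simps)
  \<comment> \<open>By \<open>dbl\<close> the same pull-back is \<open>c\<close> itself up to the
    coboundary of \<open>T\<close>. Subtracting the two descriptions leaves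
    \<open>c\<close>.\<close>
  have "c s t = \<rho> s + \<rho> t - \<rho> (s + t)"
    using sq[of s t] dbl[of s t] unfolding \<rho> c_def[symmetric] T_def[symmetric] by linarith
  then show ?thesis by (simp add: c_def)
qed

section \<open>Restriction to \<open>Unip\<close> in degree two\<close>

lemma AE_translate:
  fixes P :: "'a::euclidean_space \<Rightarrow> bool"
  assumes "AE s in lborel. P s" shows "AE s in lborel. P (s + t)"
proof -
  have "nonsing lborel lborel (\<lambda>s. t + s)"
    by (rule nonsing_lborel_affine[where f="\<lambda>x. x" and g="\<lambda>x. x"]) (simp_all add: linear_ident)
  from nonsing_AE[OF this assms] show ?thesis by (simp add: add.commute)
qed

lemma AE_double:
  fixes P :: "'a::euclidean_space \<Rightarrow> bool"
  assumes "AE s in lborel. P s" shows "AE s in lborel. P (s + s)"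
proof -
  have "nonsing lborel lborel (\<lambda>s. 2 *\<^sub>R s)"
    by (rule nonsing_lborel_linear[where g="\<lambda>s. (1/2) *\<^sub>R s"]) (simp_all add: linear_scaleR)
  from nonsing_AE[OF this assms] show ?thesis by (simp add: scaleR_2)
qed

text \<open>A cocycle \<open>c\<close> has a primitive \<open>b\<close> that is not invariant, and \<open>b (g \<cdot>) - b = d_up 1 (\<phi> g)\<close>. The
  pairs \<open>(g, \<phi> g + const)\<close> form the central extension of \<open>SL2\<close> by the reals with cocycle \<open>\<kappa>\<close> that
  belongs to \<open>c\<close>. Over \<open>Unip\<close>, doubling lifts to conjugation by \<open>a = diag (sqrt 2, 1 / sqrt 2)\<close>,
  so the extension splits there, and the splitting is used to correct \<open>b\<close> to an invariant primitive.\<close>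

lemma H2_restriction_trivial:
  fixes c :: "'k::{real_normed_field,euclidean_space} cochain"
  assumes c: "c \<in> L0inv SL2 (Suc (Suc (Suc 0))) 0"
    and dc: "AE z in pts (Suc (Suc (Suc (Suc 0)))) 0. d_up (Suc (Suc (Suc 0))) c z = 0"
  shows "\<exists>f\<in>L0inv Unip (Suc (Suc 0)) 0. AE z in pts (Suc (Suc (Suc 0))) 0. c z = d_up (Suc (Suc 0)) f z"
proof -
  let ?M1 = "pts (Suc 0) 0 :: 'k point measure" and ?M2 = "pts (Suc (Suc 0)) 0 :: 'k point measure"
    and ?M3 = "pts (Suc (Suc (Suc 0))) 0 :: 'k point measure" and ?T = "lborel :: 'k measure"
  let ?a1 = "act (Suc 0) 0 :: 'k^2^2 \<Rightarrow> 'k point \<Rightarrow> 'k point"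
  note \<sigma>T = lborel.sigma_finite_measure_axioms note \<sigma>P = sigma_finite_pts note \<sigma>G = sigma_finite_haar
  obtain u where u: "u \<in> SL2" "AE z in ?M3. c z = d_up (Suc (Suc 0)) (\<lambda>z. c (insG (Suc (Suc 0)) u z)) z"
    using up_exact_plain[OF L0inv_measurable[OF c] dc] by (rule AE_haar_obtain)
  define b where "b z = c (insG (Suc (Suc 0)) u z)" for z
  have bm[measurable]: "b \<in> borel_measurable ?M2"
    unfolding b_def[abs_def] by (rule measurable_compose[OF measurable_insG_const[OF u(1)] L0inv_measurable[OF c]])
  have cb: "AE z in ?M3. c z = d_up (Suc (Suc 0)) b z" using u(2) by (simp add: b_def[abs_def])
  define D where "D g z = b (act (Suc (Suc 0)) 0 g z) - b z" for g z
  have Dm[measurable (raw)]: "(\<lambda>x. D (g x) (z x)) \<in> borel_measurable A" if "g \<in> A \<rightarrow>\<^sub>M haar" "z \<in> A \<rightarrow>\<^sub>M ?M2"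
    for g z and A :: "'x measure"
    unfolding D_def using that by measurable
  have D_const_m: "D g \<in> borel_measurable ?M2" if "g \<in> SL2" for g
    using measurable_compose[OF measurable_act_const[OF that] bm] bm unfolding D_def[abs_def] by simp
  have dD: "AE z in ?M3. d_up (Suc (Suc 0)) (D g) z = 0" if g: "g \<in> SL2" for g
    using cb nonsing_AE[OF nonsing_act[OF g] cb] L0inv_AE[OF c g]
    by eventually_elim (simp add: D_def[abs_def] d_up_diff d_up_act)
  define good where "good g \<phi> \<longleftrightarrow> \<phi> \<in> borel_measurable ?M1 \<and> (AE z in ?M2. D g z = d_up (Suc 0) \<phi> z)" for g \<phi>
  have plain: "AE u in haar. AE z in ?M2. D g z = d_up (Suc 0) (\<lambda>z. D g (insG (Suc 0) u z)) z" if "g \<in> SL2" for g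
    by (rule up_exact_plain[OF D_const_m[OF that] dD[OF that]])
  have ex: "\<exists>\<phi>. good g \<phi>" if g: "g \<in> SL2" for g
  proof -
    obtain v where v: "v \<in> SL2" "AE z in ?M2. D g z = d_up (Suc 0) (\<lambda>z. D g (insG (Suc 0) v z)) z"
      using plain[OF g] by (rule AE_haar_obtain)
    then have "good g (\<lambda>z. D g (insG (Suc 0) v z))"
      unfolding good_def using measurable_compose[OF measurable_insG_const[OF v(1)] D_const_m[OF g]] by simp
    then show ?thesis by blast
  qed
  \<comment> \<open>One inserted variable \<open>v\<close> has to serve almost all \<open>t\<close>
    at once: only then do the primitives of \<open>D (unip t)\<close> depend measurably on
    \<open>t\<close>.\<close>
  obtain v where v: "v \<in> SL2" and vg: "AE t in ?T. AE z in ?M2. D (unip t) z = d_up (Suc 0) (\<lambda>z. D (unip t) (insG (Suc 0) v z)) z"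
  proof -
    have m1: "(\<lambda>x. d_up (Suc 0) (\<lambda>z. D (unip (fst x)) (insG (Suc 0) (fst (snd x)) z)) (snd (snd x)))
      \<in> borel_measurable (?T \<Otimes>\<^sub>M (haar \<Otimes>\<^sub>M ?M2))"
      unfolding d_up_1 by measurable
    have m2: "(\<lambda>x. D (unip (fst x)) (snd (snd x))) \<in> borel_measurable (?T \<Otimes>\<^sub>M (haar \<Otimes>\<^sub>M ?M2))"
      by measurable
    have "AE t in ?T. AE w in haar \<Otimes>\<^sub>M ?M2. D (unip t) (snd w) = d_up (Suc 0) (\<lambda>z. D (unip t) (insG (Suc 0) (fst w) z)) (snd w)"
    proof (rule AE_I2)
      fix t :: 'k
      have "t \<in> space ?T" by simp
      from measurable_compose[OF measurable_Pair1'[OF this] m1] measurable_compose[OF measurable_Pair1'[OF this] m2]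
      show "AE w in haar \<Otimes>\<^sub>M ?M2. D (unip t) (snd w) = d_up (Suc 0) (\<lambda>z. D (unip t) (insG (Suc 0) (fst w) z)) (snd w)"
        using plain[OF unip_SL2[of t]] by (intro AE_Tonelli[OF \<sigma>G \<sigma>P]) simp_all
    qed
    then have "AE x in ?T \<Otimes>\<^sub>M (haar \<Otimes>\<^sub>M ?M2). D (unip (fst x)) (snd (snd x)) =
        d_up (Suc 0) (\<lambda>z. D (unip (fst x)) (insG (Suc 0) (fst (snd x)) z)) (snd (snd x))"
      using m1 m2 by (intro AE_Tonelli[OF \<sigma>T sigma_finite_pair[OF \<sigma>G \<sigma>P]]) simp_all
    from nonsing_AE[OF nonsing_exchange[OF \<sigma>G \<sigma>T \<sigma>P] this]
    have "AE x in haar \<Otimes>\<^sub>M (?T \<Otimes>\<^sub>M ?M2). D (unip (fst (snd x))) (snd (snd x)) =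
        d_up (Suc 0) (\<lambda>z. D (unip (fst (snd x))) (insG (Suc 0) (fst x) z)) (snd (snd x))"
      by (simp add: case_prod_beta')
    from AE_Fubini[OF \<sigma>G sigma_finite_pair[OF \<sigma>T \<sigma>P] this]
    obtain v where v: "v \<in> SL2" "AE x in ?T \<Otimes>\<^sub>M ?M2. D (unip (fst x)) (snd x) =
        d_up (Suc 0) (\<lambda>z. D (unip (fst x)) (insG (Suc 0) v z)) (snd x)"
      by (rule AE_haar_obtain) simp
    show ?thesis using that[OF v(1)] AE_Fubini[OF \<sigma>T \<sigma>P v(2)] by simp
  qed
  define m where "m t z = D (unip t) (insG (Suc 0) v z)" for t z
  have [measurable]: "v \<in> space haar" using v by (simp add: space_haar)
  have mm[measurable (raw)]: "(\<lambda>x. m (t x) (z x)) \<in> borel_measurable A" if "t \<in> borel_measurable A" "z \<in> A \<rightarrow>\<^sub>M ?M1"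
    for t z and A :: "'x measure"
    unfolding m_def using that by measurable
  have m_const: "m t \<in> borel_measurable ?M1" for t
    unfolding m_def[abs_def] by (rule measurable_compose[OF measurable_insG_const[OF v] D_const_m[OF unip_SL2]])
  have good_m: "AE t in ?T. good (unip t) (m t)"
    using vg by eventually_elim (use m_const in \<open>simp add: good_def m_def[abs_def]\<close>)
  \<comment> \<open>The entry \<open>g$1$2\<close> recovers \<open>t\<close> from
    \<open>unip t\<close>. So \<phi> is the measurable family \<open>m\<close> along almost all of
    \<open>Unip\<close>, and an arbitrary choice of primitives elsewhere.\<close>
  define \<phi> where "\<phi> g = (if good g (m (g$1$2)) then m (g$1$2) else (SOME \<phi>. good g \<phi>))" for g
  have \<phi>: "good g (\<phi> g)" if "g \<in> SL2" for g
    using someI_ex[OF ex[OF that]] by (auto simp: \<phi>_def)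
  have \<phi>m: "\<phi> g \<in> borel_measurable ?M1" if "g \<in> SL2" for g using \<phi>[OF that] by (simp add: good_def)
  have \<phi>_AE: "AE t in ?T. \<phi> (unip t) = m t"
    using good_m by eventually_elim (simp add: \<phi>_def unip_def)
  \<comment> \<open>Since \<open>D (g ** h)\<close> is \<open>D g\<close> translated by
    \<open>h\<close> plus \<open>D h\<close>, both sides are primitives of the same cochain, hence
    differ by a constant.\<close>
  have "\<exists>k. AE z in ?M1. \<phi> (g ** h) z = \<phi> g (?a1 h z) + \<phi> h z + k" if g: "g \<in> SL2" and h: "h \<in> SL2" for g h
  proof -
    have d: "AE z in ?M2. D g' z = d_up (Suc 0) (\<phi> g') z" if "g' \<in> SL2" for g'
      using \<phi>[OF that] by (simp add: good_def)
    have "\<exists>k. AE z in ?M1. \<phi> (g ** h) z - \<phi> g (?a1 h z) - \<phi> h z = k"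
    proof (rule d_up_1_zero_imp_const)
      show "(\<lambda>z. \<phi> (g ** h) z - \<phi> g (?a1 h z) - \<phi> h z) \<in> borel_measurable ?M1"
        using \<phi>m[OF h] \<phi>m[OF SL2_mult[OF g h]] measurable_compose[OF measurable_act_const[OF h] \<phi>m[OF g]] by simp
      show "AE z in ?M2. d_up (Suc 0) (\<lambda>z. \<phi> (g ** h) z - \<phi> g (?a1 h z) - \<phi> h z) z = 0"
        using d[OF SL2_mult[OF g h]] nonsing_AE[OF nonsing_act[OF h] d[OF g]] d[OF h]
        by eventually_elim (simp add: d_up_diff d_up_act D_def act_act)
    qed
    then obtain k where "AE z in ?M1. \<phi> (g ** h) z - \<phi> g (?a1 h z) - \<phi> h z = k" by blast
    then have "AE z in ?M1. \<phi> (g ** h) z = \<phi> g (?a1 h z) + \<phi> h z + k" by eventually_elim simp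
    then show ?thesis by blast
  qed
  then have "\<exists>k. g \<in> SL2 \<longrightarrow> h \<in> SL2 \<longrightarrow> (AE z in ?M1. \<phi> (g ** h) z = \<phi> g (?a1 h z) + \<phi> h z + k)" for g h by blast
  then have "\<forall>g. \<exists>k. \<forall>h. g \<in> SL2 \<longrightarrow> h \<in> SL2 \<longrightarrow> (AE z in ?M1. \<phi> (g ** h) z = \<phi> g (?a1 h z) + \<phi> h z + k h)"
    by (intro allI choice) blast
  from choice[OF this] obtain \<kappa> where \<kappa>: "\<And>g h. g \<in> SL2 \<Longrightarrow> h \<in> SL2 \<Longrightarrow> AE z in ?M1. \<phi> (g ** h) z = \<phi> g (?a1 h z) + \<phi> h z + \<kappa> g h"
    by blast
  have \<kappa>_shift: "AE z in ?M1. \<phi> (g ** h) (?a1 k z) = \<phi> g (?a1 (h ** k) z) + \<phi> h (?a1 k z) + \<kappa> g h"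
    if "g \<in> SL2" "h \<in> SL2" "k \<in> SL2" for g h k
    using nonsing_AE[OF nonsing_act[OF that(3)] \<kappa>[OF that(1,2)]] by (simp add: act_act)
  have coc: "\<kappa> g h + \<kappa> (g ** h) k = \<kappa> h k + \<kappa> g (h ** k)" if g: "g \<in> SL2" and h: "h \<in> SL2" and k: "k \<in> SL2" for g h k
  proof -
    have "AE z in ?M1. \<kappa> g h + \<kappa> (g ** h) k = \<kappa> h k + \<kappa> g (h ** k)"
      using \<kappa>[OF SL2_mult[OF g h] k] \<kappa>_shift[OF g h k] \<kappa>[OF g SL2_mult[OF h k]] \<kappa>[OF h k]
    proof eventually_elim
      case (elim z)
      have "g ** h ** k = g ** (h ** k)" by (simp add: matrix_mul_assoc)
      then show ?case using elim by simp
    qed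
    then show ?thesis by (rule AE_pts_const)
  qed
  define a :: "'k^2^2" where "a = vector [vector [of_real (sqrt 2), 0], vector [0, inverse (of_real (sqrt 2))]]"
  have r2: "of_real (sqrt 2) * of_real (sqrt 2) = (2 :: 'k)" "(of_real (sqrt 2) :: 'k) \<noteq> 0"
    by (simp_all flip: of_real_mult)
  have a: "a \<in> SL2" using r2(2) by (simp add: SL2_iff a_def)
  have au: "a ** unip t = unip (t + t) ** a" for t
  proof -
    have "of_real (sqrt 2) * t = (of_real (sqrt 2) * of_real (sqrt 2)) * t * inverse (of_real (sqrt 2))"
      using r2(2) by (simp add: field_simps)
    then have "of_real (sqrt 2) * t = (t + t) * inverse (of_real (sqrt 2))" unfolding r2(1) by (simp add: algebra_simps)
    then show ?thesis by (simp add: mat2 a_def unip_def)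
  qed
  define \<rho> where "\<rho> t = \<kappa> (unip t) (unip t) - (\<kappa> a (unip t) - \<kappa> (unip (t + t)) a)" for t
  have \<kappa>\<rho>: "\<kappa> (unip s) (unip t) = \<rho> s + \<rho> t - \<rho> (s + t)" for s t
    by (rule doubling_invariant_cocycle_trivial[OF coc a au \<rho>_def])
  have \<phi>'_add: "AE z in ?M1. \<phi> (unip (s + t)) z + \<rho> (s + t) = (\<phi> (unip s) (?a1 (unip t) z) + \<rho> s) + (\<phi> (unip t) z + \<rho> t)" for s t
    using \<kappa>[OF unip_SL2 unip_SL2, of s t] by eventually_elim (simp add: unip_add \<kappa>\<rho>)
  \<comment> \<open>This is \<open>\<rho> t\<close> with the three values of \<kappa> expressed
    through \<phi> at the point \<open>z\<close>. The terms at \<open>a ** unip t\<close> and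
    \<open>unip (t + t) ** a\<close> cancel by \<open>au\<close>, and \<open>m\<close> replaces
    \<phi> on \<open>Unip\<close>, which makes the expression jointly measurable.\<close>
  define R where "R t z = m (t + t) z - m t (?a1 (unip t) z) + \<phi> a (?a1 (unip t) z) - m (t + t) (?a1 a z) - \<phi> a z" for t z
  have \<phi>am[measurable]: "\<phi> a \<in> borel_measurable ?M1" by (rule \<phi>m[OF a])
  have [measurable]: "a \<in> space haar" using a by (simp add: space_haar)
  have Rm: "(\<lambda>w. R (fst w) (snd w)) \<in> borel_measurable (?T \<Otimes>\<^sub>M ?M1)" unfolding R_def by measurable
  have "AE t in ?T. AE z in ?M1. \<rho> t = R t z"
    using \<phi>_AE AE_double[OF \<phi>_AE]
  proof eventually_elim
    case (elim t)
    note e = elim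
    from \<kappa>[OF unip_SL2 unip_SL2, of t t] \<kappa>[OF a unip_SL2, of t] \<kappa>[OF unip_SL2 a, of "t + t"]
    show ?case
    proof eventually_elim
      case (elim z)
      then show ?case unfolding R_def \<rho>_def unip_add au e by linarith
    qed
  qed
  then obtain z' where z': "z' \<in> space ?M1" "AE t in ?T. \<rho> t = R t z'"
    using AE_parameter_selection[OF \<sigma>T \<sigma>P pts_obtain Rm] by blast
  define r where "r t = R t z'" for t
  have [measurable]: "r \<in> borel_measurable borel"
    using measurable_compose[OF measurable_Pair2'[OF z'(1)] Rm] by (simp add: r_def[abs_def])
  \<comment> \<open>A jointly measurable version of the split family
    \<open>\<phi> (unip t) z + \<rho> t\<close>, which by \<open>\<phi>'_add\<close> is an honest
    cocycle on \<open>Unip\<close>.\<close>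
  define \<Psi> where "\<Psi> t z = m t z + r t" for t z
  have \<Psi>m[measurable (raw)]: "(\<lambda>x. \<Psi> (t x) (z x)) \<in> borel_measurable A" if "t \<in> borel_measurable A" "z \<in> A \<rightarrow>\<^sub>M ?M1"
    for t z and A :: "'x measure"
    unfolding \<Psi>_def using that by measurable
  define good' where "good' t \<longleftrightarrow> (\<forall>z. \<Psi> t z = \<phi> (unip t) z + \<rho> t)" for t
  have good': "AE t in ?T. good' t"
    using \<phi>_AE z'(2) by eventually_elim (simp add: good'_def \<Psi>_def r_def)
  \<comment> \<open>The cocycle identity at the parameters \<open>s - nu (fst z 0) - t\<close> and
    \<open>t\<close>. For a fixed \<open>s\<close> the first two terms are values of one function,
    at \<open>z\<close> and at its translate by \<open>unip t\<close>, because \<open>nu\<close>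
    moves by \<open>t\<close>. Thus \<Psi> becomes a coboundary.\<close>
  let ?E = "\<lambda>t s z. \<Psi> (s - nu (fst z 0)) z = \<Psi> (s - nu (fst z 0) - t) (?a1 (unip t) z) + \<Psi> t z"
  have "AE t in ?T. AE w in ?T \<Otimes>\<^sub>M ?M1. ?E t (fst w) (snd w)"
    using good'
  proof eventually_elim
    case (elim t)
    have "AE \<tau> in ?T. AE z in ?M1. \<Psi> (\<tau> + t) z = \<Psi> \<tau> (?a1 (unip t) z) + \<Psi> t z"
      using good' AE_translate[OF good', of t]
    proof eventually_elim
      case (elim \<tau>)
      note e = elim[unfolded good'_def, rule_format] \<open>good' t\<close>[unfolded good'_def, rule_format]
      from \<phi>'_add[of \<tau> t] show ?case
        by eventually_elim (simp only: e)
    qed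
    then have X1: "AE w in ?T \<Otimes>\<^sub>M ?M1. \<Psi> (fst w + t) (snd w) = \<Psi> (fst w) (?a1 (unip t) (snd w)) + \<Psi> t (snd w)"
      by (intro AE_Tonelli[OF \<sigma>T \<sigma>P]) simp_all
    have X2: "nonsing (?T \<Otimes>\<^sub>M ?M1) (?T \<Otimes>\<^sub>M ?M1) (\<lambda>(s, z). ((- nu (fst z 0) - t) + s, z))"
    proof (rule nonsing_pair_left[OF \<sigma>P \<sigma>T \<sigma>T])
      show "(\<lambda>(s, z). (- nu (fst z 0) - t) + s) \<in> ?T \<Otimes>\<^sub>M ?M1 \<rightarrow>\<^sub>M ?T"
        unfolding case_prod_beta' by simp
      show "nonsing ?T ?T (\<lambda>s. (- nu (fst z 0) - t) + s)" for z :: "'k point"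
        by (rule nonsing_lborel_affine[where f="\<lambda>x. x" and g="\<lambda>x. x"]) (simp_all add: linear_ident)
    qed
    from nonsing_AE[OF X2 X1] show ?case
      by eventually_elim (simp add: case_prod_beta' algebra_simps)
  qed
  then have "AE x in ?T \<Otimes>\<^sub>M (?T \<Otimes>\<^sub>M ?M1). ?E (fst x) (fst (snd x)) (snd (snd x))"
    by (intro AE_Tonelli[OF \<sigma>T sigma_finite_pair[OF \<sigma>T \<sigma>P]]) simp_all
  from nonsing_AE[OF nonsing_exchange[OF \<sigma>T \<sigma>T \<sigma>P] this]
  have "AE x in ?T \<Otimes>\<^sub>M (?T \<Otimes>\<^sub>M ?M1). ?E (fst (snd x)) (fst x) (snd (snd x))"
    by (simp add: case_prod_beta')
  from AE_Fubini[OF \<sigma>T sigma_finite_pair[OF \<sigma>T \<sigma>P] this]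
  obtain s where s: "AE w in ?T \<Otimes>\<^sub>M ?M1. ?E (fst w) s (snd w)"
    by (rule AE_lborel_obtain) simp
  define \<Phi> where "\<Phi> z = - \<Psi> (s - nu (fst z 0)) z" for z
  have \<Phi>m: "\<Phi> \<in> borel_measurable ?M1" unfolding \<Phi>_def[abs_def] by measurable
  have \<Phi>: "AE t in ?T. AE z in ?M1. \<Phi> (?a1 (unip t) z) - \<Phi> z = \<Psi> t z"
    using AE_Fubini[OF \<sigma>T \<sigma>P s]
  proof eventually_elim
    case (elim t)
    then show ?case using AE_space
    proof eventually_elim
      case (elim z)
      have "fst z 0 \<in> SL2" using elim(2) by (rule space_pts_G) simp
      then have eq: "s - nu (fst (?a1 (unip t) z) 0) = s - nu (fst z 0) - t" by (simp add: fst_act nu_unip)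
      show ?case unfolding \<Phi>_def eq using elim(1)[unfolded fst_conv snd_conv] by linarith
    qed
  qed
  define f where "f z = b z - d_up (Suc 0) \<Phi> z" for z
  have fm: "f \<in> borel_measurable ?M2"
    using \<Phi>m unfolding f_def d_up_1 by measurable
  have "f \<in> L0inv Unip (Suc (Suc 0)) 0"
  proof (rule L0inv_UnipI[OF fm])
    show "AE t in lborel. AE z in ?M2. f (act (Suc (Suc 0)) 0 (unip t) z) = f z"
      using \<Phi> good'
    proof eventually_elim
      case (elim t)
      have \<Psi>\<phi>: "\<Psi> t = (\<lambda>z. \<phi> (unip t) z + \<rho> t)" using elim(2) by (simp add: good'_def fun_eq_iff)
      from d_up_AE_cong[OF elim(1)] \<phi>[OF unip_SL2[of t]]
      have "AE z in ?M2. d_up (Suc 0) (\<lambda>z. \<Phi> (?a1 (unip t) z) - \<Phi> z) z = d_up (Suc 0) (\<Psi> t) z"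
        "AE z in ?M2. D (unip t) z = d_up (Suc 0) (\<phi> (unip t)) z" by (simp_all add: good_def)
      \<comment> \<open>The constant \<open>\<rho> t\<close> disappears under the differential, so
        \<Phi> changes by exactly what \<open>b\<close> lacks in invariance.\<close>
      then show ?case
        by eventually_elim (simp add: \<Psi>\<phi> f_def D_def d_up_diff d_up_act d_up_add d_up_const)
    qed
  qed
  moreover have "AE z in ?M3. c z = d_up (Suc (Suc 0)) f z"
    using cb by eventually_elim (simp add: f_def[abs_def] d_up_diff d_up_d_up)
  ultimately show ?thesis by blast
qed

section \<open>Quotients of groups of functions\<close>

definition fun_subgroup :: "('a \<Rightarrow> real) set \<Rightarrow> bool" where
  "fun_subgroup S \<longleftrightarrow> (\<lambda>_. 0) \<in> S \<and> (\<forall>f\<in>S. \<forall>g\<in>S. (\<lambda>z. f z - g z) \<in> S)"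

lemma fun_subgroup_zero: "fun_subgroup S \<Longrightarrow> (\<lambda>_. 0) \<in> S"
  and fun_subgroup_diff: "fun_subgroup S \<Longrightarrow> f \<in> S \<Longrightarrow> g \<in> S \<Longrightarrow> (\<lambda>z. f z - g z) \<in> S"
  by (auto simp: fun_subgroup_def)

lemma fun_subgroup_uminus: "fun_subgroup S \<Longrightarrow> f \<in> S \<Longrightarrow> (\<lambda>z. - f z) \<in> S"
  using fun_subgroup_diff[of S "\<lambda>_. 0" f] fun_subgroup_zero[of S] by simp

lemma fun_subgroup_add: "fun_subgroup S \<Longrightarrow> f \<in> S \<Longrightarrow> g \<in> S \<Longrightarrow> (\<lambda>z. f z + g z) \<in> S"
  using fun_subgroup_diff[of S f "\<lambda>z. - g z"] fun_subgroup_uminus[of S g] by simp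

lemma fun_group_simps [simp]:
  "carrier (fun_group S) = S" "mult (fun_group S) f g = (\<lambda>z. f z + g z)" "one (fun_group S) = (\<lambda>_. 0)"
  by (simp_all add: fun_group_def)

lemma fun_group_comm_group: "fun_subgroup S \<Longrightarrow> comm_group (fun_group S)"
proof (rule comm_groupI)
  fix f assume S: "fun_subgroup S" and f: "f \<in> carrier (fun_group S)"
  then show "\<exists>g\<in>carrier (fun_group S). g \<otimes>\<^bsub>fun_group S\<^esub> f = \<one>\<^bsub>fun_group S\<^esub>"
    by (intro bexI[of _ "\<lambda>z. - f z"]) (auto intro: fun_subgroup_uminus)
qed (auto intro: fun_subgroup_add fun_subgroup_zero simp: ac_simps)

lemma fun_group_inv:
  assumes "fun_subgroup S" "f \<in> S" shows "inv\<^bsub>fun_group S\<^esub> f = (\<lambda>z. - f z)"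
proof -
  have G: "Group.group (fun_group S)" by (rule comm_group.axioms(2)[OF fun_group_comm_group[OF assms(1)]])
  show ?thesis
  proof (rule group.inv_equality[OF G])
    show "(\<lambda>z. - f z) \<otimes>\<^bsub>fun_group S\<^esub> f = \<one>\<^bsub>fun_group S\<^esub>" unfolding fun_group_simps by simp
    show "f \<in> carrier (fun_group S)" "(\<lambda>z. - f z) \<in> carrier (fun_group S)"
      unfolding fun_group_simps using assms(2) fun_subgroup_uminus[OF assms] by blast+
  qed
qed

lemma fun_group_normal:
  assumes S: "fun_subgroup S" and B: "fun_subgroup B" "B \<subseteq> S" shows "normal B (fun_group S)"
proof -
  have G: "Group.group (fun_group S)" by (rule comm_group.axioms(2)[OF fun_group_comm_group[OF S]])
  have "subgroup B (fun_group S)"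
  proof (rule group.subgroupI[OF G])
    show "B \<subseteq> carrier (fun_group S)" "B \<noteq> {}"
      unfolding fun_group_simps using B(2) fun_subgroup_zero[OF B(1)] by blast+
    show "inv\<^bsub>fun_group S\<^esub> f \<in> B" if "f \<in> B" for f
      unfolding fun_group_inv[OF S subsetD[OF B(2) that]] by (rule fun_subgroup_uminus[OF B(1) that])
    show "f \<otimes>\<^bsub>fun_group S\<^esub> g \<in> B" if "f \<in> B" "g \<in> B" for f g
      unfolding fun_group_simps by (rule fun_subgroup_add[OF B(1) that])
  qed
  then show ?thesis by (rule comm_group.subgroup_imp_normal[OF fun_group_comm_group[OF S]])
qed

abbreviation coset :: "('a \<Rightarrow> real) set \<Rightarrow> ('a \<Rightarrow> real) set \<Rightarrow> ('a \<Rightarrow> real) \<Rightarrow> ('a \<Rightarrow> real) set" where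
  "coset Z B f \<equiv> B #>\<^bsub>fun_group Z\<^esub> f"

lemma coset_iff: "g \<in> coset Z B f \<longleftrightarrow> (\<lambda>z. g z - f z) \<in> B"
proof
  assume "(\<lambda>z. g z - f z) \<in> B"
  moreover have "g = (\<lambda>z. (g z - f z) + f z)" by simp
  ultimately show "g \<in> coset Z B f" unfolding r_coset_def fun_group_simps by blast
qed (auto simp: r_coset_def)

lemma coset_eq_iff:
  assumes B: "fun_subgroup B"
  shows "coset Z B f = coset Z B g \<longleftrightarrow> (\<lambda>z. f z - g z) \<in> B"
proof
  assume "coset Z B f = coset Z B g"
  moreover have "f \<in> coset Z B f" using fun_subgroup_zero[OF B] by (simp add: coset_iff)
  ultimately show "(\<lambda>z. f z - g z) \<in> B" by (simp add: coset_iff)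
next
  assume d: "(\<lambda>z. f z - g z) \<in> B"
  show "coset Z B f = coset Z B g"
  proof (rule Set.set_eqI)
    fix h
    have "(\<lambda>z. h z - g z) \<in> B" if "(\<lambda>z. h z - f z) \<in> B" using fun_subgroup_add[OF B that d] by simp
    moreover have "(\<lambda>z. h z - f z) \<in> B" if "(\<lambda>z. h z - g z) \<in> B" using fun_subgroup_diff[OF B that d] by simp
    ultimately show "h \<in> coset Z B f \<longleftrightarrow> h \<in> coset Z B g" by (auto simp: coset_iff)
  qed
qed

lemma coset_zero: "fun_subgroup B \<Longrightarrow> coset Z B f = B \<longleftrightarrow> f \<in> B"
proof -
  assume B: "fun_subgroup B"
  have "coset Z B (\<lambda>_. 0) = B" by (rule Set.set_eqI) (simp add: coset_iff)
  then show ?thesis using coset_eq_iff[OF B, of Z f "\<lambda>_. 0"] by simp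
qed

lemma carrier_quotient: "carrier (fun_group Z Mod B) = coset Z B ` Z"
  by (simp add: carrier_FactGroup)

lemma quotient_group:
  assumes "fun_subgroup Z" "fun_subgroup B" "B \<subseteq> Z" shows "group (fun_group Z Mod B)"
  using normal.factorgroup_is_group[OF fun_group_normal[OF assms]] .

lemma quotient_mult:
  assumes "fun_subgroup Z" "fun_subgroup B" "B \<subseteq> Z" "f \<in> Z" "g \<in> Z"
  shows "coset Z B f \<otimes>\<^bsub>fun_group Z Mod B\<^esub> coset Z B g = coset Z B (\<lambda>z. f z + g z)"
  using normal.rcos_sum[OF fun_group_normal[OF assms(1-3)], of f g] assms(4,5) by simp

text \<open>The map on representatives respects sums only modulo \<open>B'\<close>: for
  \<open>incl\<close> it is an arbitrary choice of related cocycles.\<close>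

lemma quotient_hom:
  assumes Z: "fun_subgroup Z" "fun_subgroup B" "B \<subseteq> Z" and Z': "fun_subgroup Z'" "fun_subgroup B'" "B' \<subseteq> Z'"
    and J: "\<And>f. f \<in> Z \<Longrightarrow> J f \<in> Z'" "\<And>f. f \<in> Z \<Longrightarrow> I (coset Z B f) = coset Z' B' (J f)"
    and add: "\<And>f g. f \<in> Z \<Longrightarrow> g \<in> Z \<Longrightarrow> (\<lambda>z. J (\<lambda>z. f z + g z) z - (J f z + J g z)) \<in> B'"
  shows "I \<in> hom (fun_group Z Mod B) (fun_group Z' Mod B')"
proof (rule homI)
  fix x assume "x \<in> carrier (fun_group Z Mod B)"
  then show "I x \<in> carrier (fun_group Z' Mod B')" by (auto simp: carrier_quotient J)
next
  fix x y assume "x \<in> carrier (fun_group Z Mod B)" "y \<in> carrier (fun_group Z Mod B)"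
  then obtain f g where fg: "f \<in> Z" "g \<in> Z" "x = coset Z B f" "y = coset Z B g" by (auto simp: carrier_quotient)
  have "I (x \<otimes>\<^bsub>fun_group Z Mod B\<^esub> y) = coset Z' B' (J (\<lambda>z. f z + g z))"
    unfolding fg quotient_mult[OF Z fg(1,2)] by (rule J(2)[OF fun_subgroup_add[OF Z(1) fg(1,2)]])
  also have "\<dots> = coset Z' B' (\<lambda>z. J f z + J g z)" unfolding coset_eq_iff[OF Z'(2)] by (rule add[OF fg(1,2)])
  also have "\<dots> = I x \<otimes>\<^bsub>fun_group Z' Mod B'\<^esub> I y"
    unfolding fg J(2)[OF fg(1)] J(2)[OF fg(2)] by (rule quotient_mult[OF Z' J(1)[OF fg(1)] J(1)[OF fg(2)], symmetric])
  finally show "I (x \<otimes>\<^bsub>fun_group Z Mod B\<^esub> y) = I x \<otimes>\<^bsub>fun_group Z' Mod B'\<^esub> I y" .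
qed

text \<open>The general lemmas count variables with \<open>Suc\<close>, the diagram chase with
  numerals; these equations pass from the former to the latter.\<close>

lemma nat_succs: "Suc 0 = 1" "Suc 1 = 2" "Suc 2 = 3" "Suc 3 = 4" "n + 1 = Suc n" "n + 2 = Suc (Suc n)"
  by simp_all

section \<open>Cocycles and coboundaries\<close>

lemma Z_grp_iff: "f \<in> Z_grp L n \<longleftrightarrow> f \<in> L0inv L (Suc n) 0 \<and> (AE z in pts (Suc (Suc n)) 0. d_up (Suc n) f z = 0)"
  unfolding Z_grp_def nat_succs by blast

lemma B_grp_iff: "f \<in> B_grp L n \<longleftrightarrow> f \<in> L0inv L (Suc n) 0 \<and> (\<exists>b\<in>L0inv L n 0. AE z in pts (Suc n) 0. f z = d_up n b z)"
  unfolding B_grp_def nat_succs by blast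

lemma Z_hom_iff: "f \<in> Z_hom n \<longleftrightarrow> f \<in> L0inv SL2 0 (Suc n) \<and> (AE z in pts 0 (Suc (Suc n)). d_right 0 (Suc n) f z = 0)"
  unfolding Z_hom_def nat_succs by blast

lemma B_hom_iff: "f \<in> B_hom n \<longleftrightarrow> f \<in> L0inv SL2 0 (Suc n) \<and> (\<exists>b\<in>L0inv SL2 0 n. AE z in pts 0 (Suc n). f z = d_right 0 n b z)"
  unfolding B_hom_def nat_succs by blast

lemma fun_subgroup_Z_grp: "fun_subgroup (Z_grp L n)"
  unfolding fun_subgroup_def Z_grp_iff
proof (intro conjI ballI)
  fix f g :: "'a cochain"
  assume f: "f \<in> Z_grp L n" and g: "g \<in> Z_grp L n"
  then show "(\<lambda>z. f z - g z) \<in> L0inv L (Suc n) 0" by (auto simp: Z_grp_iff intro: L0inv_diff)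
  have "AE z in pts (Suc (Suc n)) 0. d_up (Suc n) f z = 0" "AE z in pts (Suc (Suc n)) 0. d_up (Suc n) g z = 0"
    using f g by (auto simp: Z_grp_iff)
  then show "AE z in pts (Suc (Suc n)) 0. d_up (Suc n) (\<lambda>z. f z - g z) z = 0"
    by eventually_elim (simp add: d_up_diff)
qed (simp_all add: L0inv_zero d_up_zero)

lemma fun_subgroup_B_grp: "fun_subgroup (B_grp L n)"
  unfolding fun_subgroup_def B_grp_iff
proof (intro conjI ballI)
  fix f g :: "'a cochain"
  assume f: "f \<in> B_grp L n" and g: "g \<in> B_grp L n"
  then show "(\<lambda>z. f z - g z) \<in> L0inv L (Suc n) 0" by (auto simp: B_grp_iff intro: L0inv_diff)
  obtain b b' where b: "b \<in> L0inv L n 0" "b' \<in> L0inv L n 0" "AE z in pts (Suc n) 0. f z = d_up n b z" "AE z in pts (Suc n) 0. g z = d_up n b' z"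
    using f g by (auto simp: B_grp_iff)
  from b(3,4) have "AE z in pts (Suc n) 0. f z - g z = d_up n (\<lambda>z. b z - b' z) z"
    by eventually_elim (simp add: d_up_diff)
  then show "\<exists>b\<in>L0inv L n 0. AE z in pts (Suc n) 0. f z - g z = d_up n b z"
    using L0inv_diff[OF b(1,2)] by blast
next
  show "\<exists>b\<in>L0inv L n 0. AE z in pts (Suc n) 0. 0 = d_up n b z"
    by (rule bexI[OF _ L0inv_zero]) (simp add: d_up_zero)
qed (rule L0inv_zero)

lemma fun_subgroup_Z_hom: "fun_subgroup (Z_hom n)"
  unfolding fun_subgroup_def Z_hom_iff
proof (intro conjI ballI)
  fix f g :: "'a cochain"
  assume f: "f \<in> Z_hom n" and g: "g \<in> Z_hom n"
  then show "(\<lambda>z. f z - g z) \<in> L0inv SL2 0 (Suc n)" by (auto simp: Z_hom_iff intro: L0inv_diff)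
  have "AE z in pts 0 (Suc (Suc n)). d_right 0 (Suc n) f z = 0" "AE z in pts 0 (Suc (Suc n)). d_right 0 (Suc n) g z = 0"
    using f g by (auto simp: Z_hom_iff)
  then show "AE z in pts 0 (Suc (Suc n)). d_right 0 (Suc n) (\<lambda>z. f z - g z) z = 0"
    by eventually_elim (simp add: d_right_diff)
qed (simp_all add: L0inv_zero d_right_zero)

lemma fun_subgroup_B_hom: "fun_subgroup (B_hom n)"
  unfolding fun_subgroup_def B_hom_iff
proof (intro conjI ballI)
  fix f g :: "'a cochain"
  assume f: "f \<in> B_hom n" and g: "g \<in> B_hom n"
  then show "(\<lambda>z. f z - g z) \<in> L0inv SL2 0 (Suc n)" by (auto simp: B_hom_iff intro: L0inv_diff)
  obtain b b' where b: "b \<in> L0inv SL2 0 n" "b' \<in> L0inv SL2 0 n" "AE z in pts 0 (Suc n). f z = d_right 0 n b z" "AE z in pts 0 (Suc n). g z = d_right 0 n b' z"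
    using f g by (auto simp: B_hom_iff)
  from b(3,4) have "AE z in pts 0 (Suc n). f z - g z = d_right 0 n (\<lambda>z. b z - b' z) z"
    by eventually_elim (simp add: d_right_diff)
  then show "\<exists>b\<in>L0inv SL2 0 n. AE z in pts 0 (Suc n). f z - g z = d_right 0 n b z"
    using L0inv_diff[OF b(1,2)] by blast
next
  show "\<exists>b\<in>L0inv SL2 0 n. AE z in pts 0 (Suc n). 0 = d_right 0 n b z"
    by (rule bexI[OF _ L0inv_zero]) (simp add: d_right_zero)
qed (rule L0inv_zero)

lemma B_grp_subset_Z_grp: "B_grp L n \<subseteq> Z_grp L n"
proof
  fix f assume f: "f \<in> B_grp L n"
  then obtain b where "AE z in pts (Suc n) 0. f z = d_up n b z" by (auto simp: B_grp_iff)
  from d_up_AE_cong[OF this] have "AE z in pts (Suc (Suc n)) 0. d_up (Suc n) f z = 0"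
    by eventually_elim (simp add: d_up_d_up)
  then show "f \<in> Z_grp L n" using f by (simp add: Z_grp_iff B_grp_iff)
qed

lemma B_hom_subset_Z_hom: "B_hom n \<subseteq> Z_hom n"
proof
  fix f assume f: "f \<in> B_hom n"
  then obtain b where "AE z in pts 0 (Suc n). f z = d_right 0 n b z" by (auto simp: B_hom_iff)
  from d_right_AE_cong[OF this] have "AE z in pts 0 (Suc (Suc n)). d_right 0 (Suc n) f z = 0"
    by eventually_elim (simp add: d_right_d_right)
  then show "f \<in> Z_hom n" using f by (simp add: Z_hom_iff B_hom_iff)
qed

lemmas grp_subgroups = fun_subgroup_Z_grp fun_subgroup_B_grp B_grp_subset_Z_grp
lemmas hom_subgroups = fun_subgroup_Z_hom fun_subgroup_B_hom B_hom_subset_Z_hom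

text \<open>The augmentation only adds a variable on which nothing depends, and fixing this variable
  at a generic value removes it again.\<close>

lemma up_inject:
  assumes "AE z in pts 1 q. d_up 0 f z = 0" shows "AE z in pts 0 q. f z = 0"
proof -
  have "AE w in haar \<Otimes>\<^sub>M pts 0 q. d_up 0 f (insG 0 (fst w) (snd w)) = 0"
    using nonsing_AE[OF nonsing_insG assms[unfolded One_nat_def]] by (simp add: case_prod_beta')
  from AE_Fubini[OF sigma_finite_haar sigma_finite_pts this]
  obtain u where "AE z in pts 0 q. d_up 0 f (insG 0 u z) = 0" by (rule AE_haar_obtain) simp
  then show ?thesis using AE_space
  proof eventually_elim
    case (elim z)
    then have "faceG 0 0 (insG 0 u z) = z" by (intro faceG_insG_0) (auto simp: space_pts PiE_iff)
    then show ?case using elim by (simp add: d_up_eq)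
  qed
qed

lemma right_inject:
  assumes "AE z in pts m 1. d_right m 0 f z = 0" shows "AE z in pts m 0. f z = 0"
proof -
  have "AE w in haar \<Otimes>\<^sub>M pts m 0. d_right m 0 f (insV 0 (fst w *v e1) (snd w)) = 0"
    using nonsing_AE[OF nonsing_orbit_insV assms[unfolded One_nat_def]] by (simp add: case_prod_beta')
  from AE_Fubini[OF sigma_finite_haar sigma_finite_pts this]
  obtain h where "AE z in pts m 0. d_right m 0 f (insV 0 (h *v e1) z) = 0" by (rule AE_haar_obtain) simp
  then show ?thesis using AE_space
  proof eventually_elim
    case (elim z)
    then have "faceV 0 0 (insV 0 (h *v e1) z) = z" by (intro faceV_insV_0) (auto simp: space_pts PiE_iff)
    then show ?case using elim by (simp add: d_right_eq)
  qed
qed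

lemmas up_exact_0 = up_exact[where m=0, unfolded nat_succs]
lemmas up_exact_1 = up_exact[where m=1, unfolded nat_succs]
lemmas right_exact_11 = right_exact[where m=0 and q=1, unfolded nat_succs]
lemmas right_exact_20 = right_exact[where m=1 and q=0, unfolded nat_succs]
lemmas d_up_cong_0 = d_up_AE_cong[where m=0, unfolded nat_succs]
lemmas d_up_cong_1 = d_up_AE_cong[where m=1, unfolded nat_succs]
lemmas d_up_cong_2 = d_up_AE_cong[where m=2, unfolded nat_succs]
lemmas d_right_cong_0 = d_right_AE_cong[where q=0, unfolded nat_succs]
lemmas d_right_cong_1 = d_right_AE_cong[where q=1, unfolded nat_succs]
lemmas d_right_cong_2 = d_right_AE_cong[where q=2, unfolded nat_succs]
lemmas d_right_cong_3 = d_right_AE_cong[where q=3, unfolded nat_succs]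
lemmas L0inv_up_0 = L0inv_d_up[where m=0, unfolded nat_succs]
lemmas L0inv_up_1 = L0inv_d_up[where m=1, unfolded nat_succs]
lemmas L0inv_right_0 = L0inv_d_right[where q=0, unfolded nat_succs]
lemmas L0inv_right_1 = L0inv_d_right[where q=1, unfolded nat_succs]
lemmas L0inv_right_2 = L0inv_d_right[where q=2, unfolded nat_succs]
lemmas dd_up = d_up_d_up[where m=0, unfolded nat_succs] d_up_d_up[where m=1, unfolded nat_succs] d_up_d_up[where m=2, unfolded nat_succs]
lemmas dd_right = d_right_d_right[where q=0, unfolded nat_succs] d_right_d_right[where q=1, unfolded nat_succs] d_right_d_right[where q=2, unfolded nat_succs]
lemmas d_comm = d_up_d_right[where m=0, unfolded nat_succs] d_up_d_right[where m=1, unfolded nat_succs] d_up_d_right[where m=2, unfolded nat_succs]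

lemma Z_grp_1: "f \<in> Z_grp L 1 \<longleftrightarrow> f \<in> L0inv L 2 0 \<and> (AE z in pts 3 0. d_up 2 f z = 0)"
  unfolding Z_grp_iff nat_succs ..

lemma Z_grp_2: "f \<in> Z_grp L 2 \<longleftrightarrow> f \<in> L0inv L 3 0 \<and> (AE z in pts 4 0. d_up 3 f z = 0)"
  unfolding Z_grp_iff nat_succs ..

lemma B_grp_1: "f \<in> B_grp L 1 \<longleftrightarrow> f \<in> L0inv L 2 0 \<and> (\<exists>b\<in>L0inv L 1 0. AE z in pts 2 0. f z = d_up 1 b z)"
  unfolding B_grp_iff nat_succs ..

lemma B_grp_2: "f \<in> B_grp L 2 \<longleftrightarrow> f \<in> L0inv L 3 0 \<and> (\<exists>b\<in>L0inv L 2 0. AE z in pts 3 0. f z = d_up 2 b z)"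
  unfolding B_grp_iff nat_succs ..

lemma Z_hom_2: "f \<in> Z_hom 2 \<longleftrightarrow> f \<in> L0inv SL2 0 3 \<and> (AE z in pts 0 4. d_right 0 3 f z = 0)"
  unfolding Z_hom_iff nat_succs ..

lemma B_hom_2: "f \<in> B_hom 2 \<longleftrightarrow> f \<in> L0inv SL2 0 3 \<and> (\<exists>b\<in>L0inv SL2 0 2. AE z in pts 0 3. f z = d_right 0 2 b z)"
  unfolding B_hom_iff nat_succs ..

section \<open>The diagram chase\<close>

text \<open>A staircase through the double complex from \<open>a\<close> to \<omega>. The vertical
  differential of \<open>a\<close> is left open so that two kinds of staircase are covered: it is
  zero if \<open>a\<close> is induced from a cocycle of \<open>Unip\<close>, and
  \<open>- d_right 3 0 c\<close> if the staircase continues to a cocycle \<open>c\<close> of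
  \<open>SL2\<close>.\<close>

definition zigzag :: "'k::{real_normed_field,euclidean_space} cochain \<Rightarrow> 'k cochain \<Rightarrow> 'k cochain \<Rightarrow> bool" where
  "zigzag \<omega> \<beta> a \<longleftrightarrow> \<omega> \<in> L0inv SL2 0 3 \<and> \<beta> \<in> L0inv SL2 1 2 \<and> a \<in> L0inv SL2 2 1 \<and>
     (AE z in pts 1 3. d_up 0 \<omega> z = d_right 1 2 \<beta> z) \<and> (AE z in pts 2 2. d_up 1 \<beta> z = d_right 2 1 a z)"

lemma zigzagD:
  assumes "zigzag \<omega> \<beta> a"
  shows "\<omega> \<in> L0inv SL2 0 3" "\<beta> \<in> L0inv SL2 1 2" "a \<in> L0inv SL2 2 1"
    "AE z in pts 1 3. d_up 0 \<omega> z = d_right 1 2 \<beta> z" "AE z in pts 2 2. d_up 1 \<beta> z = d_right 2 1 a z"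
  using assms by (simp_all only: zigzag_def)

lemma zigzag_diff:
  assumes 1: "zigzag \<omega> \<beta> a" and 2: "zigzag \<omega>' \<beta>' a'"
  shows "zigzag (\<lambda>z. \<omega> z - \<omega>' z) (\<lambda>z. \<beta> z - \<beta>' z) (\<lambda>z. a z - a' z)"
  unfolding zigzag_def
proof (intro conjI L0inv_diff zigzagD(1-3)[OF 1] zigzagD(1-3)[OF 2])
  show "AE z in pts 1 3. d_up 0 (\<lambda>z. \<omega> z - \<omega>' z) z = d_right 1 2 (\<lambda>z. \<beta> z - \<beta>' z) z"
    using zigzagD(4)[OF 1] zigzagD(4)[OF 2] by eventually_elim (simp only: d_up_diff d_right_diff)
  show "AE z in pts 2 2. d_up 1 (\<lambda>z. \<beta> z - \<beta>' z) z = d_right 2 1 (\<lambda>z. a z - a' z) z"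
    using zigzagD(5)[OF 1] zigzagD(5)[OF 2] by eventually_elim (simp only: d_up_diff d_right_diff)
qed

lemma zigzag_cocycle:
  assumes "zigzag \<omega> \<beta> a" shows "\<omega> \<in> Z_hom 2"
  unfolding Z_hom_2
proof (intro conjI zigzagD(1)[OF assms] up_inject)
  show "AE z in pts 1 4. d_up 0 (d_right 0 3 \<omega>) z = 0"
    using d_right_cong_3[OF zigzagD(4)[OF assms]] by eventually_elim (simp only: d_comm dd_right minus_zero)
qed

text \<open>Two steps through exact columns. The condition on \<open>d_up 2 a\<close> holds for both
  kinds of staircase, since a horizontal coboundary is a horizontal cocycle.\<close>

lemma zigzag_exists:
  assumes a: "a \<in> L0inv SL2 2 1" and d: "AE z in pts 3 2. d_right 3 1 (d_up 2 a) z = 0"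
  shows "\<exists>\<omega> \<beta>. zigzag \<omega> \<beta> a"
proof -
  have "AE z in pts 3 2. d_up 2 (d_right 2 1 a) z = 0"
    using d by eventually_elim (simp only: d_comm minus_zero)
  from up_exact_1[OF L0inv_right_1[OF a] order_refl this]
  obtain \<beta> where \<beta>: "\<beta> \<in> L0inv SL2 1 2" "AE z in pts 2 2. d_right 2 1 a z = d_up 1 \<beta> z" by blast
  have "AE z in pts 2 3. d_up 1 (d_right 1 2 \<beta>) z = 0"
    using d_right_cong_2[OF \<beta>(2)]
    proof eventually_elim
      case (elim z)
      then show ?case unfolding d_comm dd_right by linarith
    qed
  from up_exact_0[OF L0inv_right_2[OF \<beta>(1)] _ this]
  obtain \<omega> where "\<omega> \<in> L0inv SL2 0 3" "AE z in pts 1 3. d_right 1 2 \<beta> z = d_up 0 \<omega> z" by auto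
  then have "zigzag \<omega> \<beta> a" using \<beta> a by (simp add: zigzag_def eq_commute[of "d_up _ _ _"])
  then show ?thesis by blast
qed

text \<open>Well-definedness of \<open>incl\<close>: the primitive \<open>b\<close> is carried along
  the staircase to a primitive \<gamma> of \<omega>, with a sign because the differentials
  anticommute.\<close>

lemma zigzag_coboundary:
  assumes z: "zigzag \<omega> \<beta> a" and b: "b \<in> L0inv SL2 1 1" and ab: "AE z in pts 2 1. a z = d_up 1 b z"
  shows "\<omega> \<in> B_hom 2"
proof -
  have "AE z in pts 2 2. d_up 1 (\<lambda>z. \<beta> z + d_right 1 1 b z) z = 0"
    using zigzagD(5)[OF z] d_right_cong_1[OF ab]
    proof eventually_elim
      case (elim z)
      then show ?case unfolding d_up_add d_comm by linarith
    qed
  from up_exact_0[OF L0inv_add[OF zigzagD(2)[OF z] L0inv_right_1[OF b]] order_refl this]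
  obtain \<gamma> where \<gamma>: "\<gamma> \<in> L0inv SL2 0 2" "AE z in pts 1 2. \<beta> z + d_right 1 1 b z = d_up 0 \<gamma> z" by blast
  have "AE z in pts 1 3. d_up 0 (\<lambda>z. \<omega> z - d_right 0 2 (\<lambda>z. - \<gamma> z) z) z = 0"
    using zigzagD(4)[OF z] d_right_cong_2[OF \<gamma>(2)]
    proof eventually_elim
      case (elim z)
      then show ?case unfolding d_up_diff d_right_uminus d_up_uminus d_comm d_right_add dd_right by linarith
    qed
  from up_inject[OF this] have "AE z in pts 0 3. \<omega> z = d_right 0 2 (\<lambda>z. - \<gamma> z) z" by eventually_elim simp
  then show ?thesis unfolding B_hom_2 using zigzagD(1)[OF z] L0inv_uminus[OF \<gamma>(1)] by blast
qed

text \<open>The chase in the other direction, along the exact rows. What remains of \<open>a\<close>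
  modulo vertical coboundaries is a cochain \<open>e\<close> of \<open>SL2\<close> alone.\<close>

lemma zigzag_zero:
  assumes z: "zigzag \<omega> \<beta> a" and \<omega>: "AE z in pts 0 3. \<omega> z = 0"
  shows "\<exists>b\<in>L0inv SL2 1 1. \<exists>e\<in>L0inv SL2 2 0. AE z in pts 2 1. a z + d_up 1 b z = d_right 2 0 e z"
proof -
  have "AE z in pts 1 3. d_right 1 2 \<beta> z = 0"
    using zigzagD(4)[OF z] d_up_cong_0[OF \<omega>] by eventually_elim (simp only: d_up_zero)
  from right_exact_11[OF zigzagD(2)[OF z] this]
  obtain b where b: "b \<in> L0inv SL2 1 1" "AE z in pts 1 2. \<beta> z = d_right 1 1 b z" by blast
  have "AE z in pts 2 2. d_right 2 1 (\<lambda>z. a z + d_up 1 b z) z = 0"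
    using zigzagD(5)[OF z] d_up_cong_1[OF b(2)]
    proof eventually_elim
      case (elim z)
      then show ?case unfolding d_right_add d_comm by linarith
    qed
  from right_exact_20[OF L0inv_add[OF zigzagD(3)[OF z] L0inv_up_1[OF b(1)]] this]
  show ?thesis using b(1) by blast
qed

lemma zigzag_of_coboundary:
  assumes \<omega>: "\<omega> \<in> B_hom 2" shows "\<exists>\<beta>. zigzag \<omega> \<beta> (\<lambda>_. 0)"
proof -
  obtain \<gamma> where \<gamma>: "\<gamma> \<in> L0inv SL2 0 2" "AE z in pts 0 3. \<omega> z = d_right 0 2 \<gamma> z" and \<omega>': "\<omega> \<in> L0inv SL2 0 3"
    using \<omega> by (auto simp: B_hom_2)
  have "zigzag \<omega> (\<lambda>z. - d_up 0 \<gamma> z) (\<lambda>_. 0)"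
    unfolding zigzag_def
  proof (intro conjI L0inv_uminus L0inv_up_0 L0inv_zero \<gamma>(1) \<omega>')
    show "AE z in pts 1 3. d_up 0 \<omega> z = d_right 1 2 (\<lambda>z. - d_up 0 \<gamma> z) z"
      using d_up_cong_0[OF \<gamma>(2)] by eventually_elim (simp only: d_comm d_right_uminus)
    show "AE z in pts 2 2. d_up 1 (\<lambda>z. - d_up 0 \<gamma> z) z = d_right 2 1 (\<lambda>_. 0) z"
      by (rule AE_I2) (simp only: d_up_uminus dd_up d_right_zero minus_zero)
  qed
  then show ?thesis by blast
qed

text \<open>The obstruction left by \<open>zigzag_zero\<close> is a 1-cocycle of \<open>SL2\<close>;
  this is where the vanishing of the first cohomology of \<open>SL2\<close> enters.\<close>

lemma zigzag_injective:
  assumes z: "zigzag \<omega> \<beta> a" and \<omega>: "\<omega> \<in> B_hom 2" and a: "AE z in pts 3 1. d_up 2 a z = 0"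
  shows "\<exists>b\<in>L0inv SL2 1 1. AE z in pts 2 1. a z = d_up 1 b z"
proof -
  obtain \<beta>' where z': "zigzag \<omega> \<beta>' (\<lambda>_. 0)" using zigzag_of_coboundary[OF \<omega>] by blast
  have "AE z in pts 0 3. \<omega> z - \<omega> z = 0" by simp
  from zigzag_zero[OF zigzag_diff[OF z z'] this]
  obtain b c where b: "b \<in> L0inv SL2 1 1" and c: "c \<in> L0inv SL2 2 0" and abc: "AE z in pts 2 1. a z - 0 + d_up 1 b z = d_right 2 0 c z"
    by blast
  have "AE z in pts 3 1. d_right 3 0 (d_up 2 c) z = 0"
    using d_up_cong_2[OF abc] a
    proof eventually_elim
      case (elim z)
      then show ?case unfolding d_up_add d_up_diff dd_up d_comm d_up_zero by linarith
    qed
  from right_inject[OF this] have "AE z in pts 3 0. d_up 2 c z = 0" .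
  from H1_SL2_trivial[unfolded nat_succs, OF c this]
  obtain e where e: "e \<in> L0inv SL2 1 0" "AE z in pts 2 0. c z = d_up 1 e z" by blast
  have "AE z in pts 2 1. a z = d_up 1 (\<lambda>z. - (b z + d_right 1 0 e z)) z"
    using abc d_right_cong_0[OF e(2)]
    proof eventually_elim
      case (elim z)
      then show ?case unfolding d_up_uminus d_up_add d_comm by linarith
    qed
  then show ?thesis using L0inv_uminus[OF L0inv_add[OF b L0inv_right_0[OF e(1)]]] by blast
qed

text \<open>All staircases from the same \<omega> continue to cohomologous cochains of
  \<open>SL2\<close>. Evaluation can therefore be computed from any staircase instead of the
  standard one.\<close>

lemma zigzag_compare:
  assumes 1: "zigzag \<omega> \<beta> a" and 2: "zigzag \<omega> \<beta>' a'"
    and c: "AE z in pts 3 1. d_up 2 a z = - d_right 3 0 c z" and c': "AE z in pts 3 1. d_up 2 a' z = - d_right 3 0 c' z"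
  shows "\<exists>e\<in>L0inv SL2 2 0. AE z in pts 3 0. c z - c' z = d_up 2 e z"
proof -
  have "AE z in pts 0 3. \<omega> z - \<omega> z = 0" by simp
  from zigzag_zero[OF zigzag_diff[OF 1 2] this]
  obtain b e where b: "b \<in> L0inv SL2 1 1" and e: "e \<in> L0inv SL2 2 0"
    and abe: "AE z in pts 2 1. a z - a' z + d_up 1 b z = d_right 2 0 e z"
    by blast
  have "AE z in pts 3 1. d_right 3 0 (\<lambda>z. c z - c' z - d_up 2 e z) z = 0"
    using d_up_cong_2[OF abe] c c'
    proof eventually_elim
      case (elim z)
      then show ?case unfolding d_up_add d_up_diff dd_up d_comm d_right_diff by linarith
    qed
  from right_inject[OF this] have "AE z in pts 3 0. c z - c' z = d_up 2 e z" by eventually_elim simp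
  then show ?thesis using e by blast
qed

text \<open>Pulling back one cochain of the plane along these maps fills a whole antidiagonal of the
  double complex, with more and more of its variables moved to the group.\<close>

definition orb :: "nat \<Rightarrow> nat \<Rightarrow> 'k::{real_normed_field,euclidean_space} point \<Rightarrow> 'k point" where
  "orb m q z = (\<lambda>_. undefined, append_tup m q (\<lambda>i\<in>{..<m}. fst z i *v e1) (snd z))"

lemma nonsing_orb: "nonsing (pts m q) (pts 0 (m + q)) (orb m q)"
proof -
  note X = sigma_finite_PiM_plane note Y = sigma_finite_PiM_haar
  have 1: "nonsing (pts m q) ((\<Pi>\<^sub>M i\<in>{..<m}. plane) \<Otimes>\<^sub>M (\<Pi>\<^sub>M i\<in>{..<q}. plane)) (\<lambda>(y, x). (\<lambda>i\<in>{..<m}. y i *v e1, x))"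
    unfolding pts_def
    by (rule nonsing_map_fst[OF Y X X nonsing_PiM_map[OF sigma_finite_haar sigma_finite_plane nonsing_orbit[OF e1_nonzero]]])
  have 2: "nonsing (\<Pi>\<^sub>M i\<in>{..<m + q}. plane) (pts 0 (m + q)) (\<lambda>x. (\<lambda>_. undefined, x))"
  proof (rule nonsingI)
    show "(\<lambda>x. (\<lambda>_. undefined, x)) \<in> (\<Pi>\<^sub>M i\<in>{..<m + q}. plane) \<rightarrow>\<^sub>M pts 0 (m + q)"
      by (rule measurable_Pair_pts) (simp_all add: space_PiM)
    fix P assume "AE z in pts 0 (m + q). P z"
    from AE_Fubini[OF Y X this[unfolded pts_def]]
    show "AE x in \<Pi>\<^sub>M i\<in>{..<m + q}. plane. P (\<lambda>_. undefined, x)" unfolding lessThan_0 AE_PiM_empty .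
  qed
  show ?thesis
    using nonsing_compose[OF nonsing_compose[OF 1 nonsing_append_tup[OF sigma_finite_plane]] 2]
    by (simp add: orb_def[abs_def] case_prod_beta')
qed

lemma orb_act: "orb m q (act m q g z) = act 0 (m + q) g (orb m q z)"
  by (auto simp: orb_def act_def append_tup_def case_prod_beta' fun_eq_iff matrix_vector_mul_assoc)

lemma faceV_orb_G: "j \<le> m \<Longrightarrow> faceV (m + Suc q) j (orb (Suc m) (Suc q) z) = orb m (Suc q) (faceG m j z)"
  by (auto simp: faceV_def faceG_def orb_def append_tup_def face_def fun_eq_iff)

lemma faceV_orb_V: "j \<le> q \<Longrightarrow> faceV (m + Suc q) (Suc m + j) (orb (Suc m) (Suc q) z) = orb (Suc m) q (faceV q j z)"
  by (auto simp: faceV_def faceG_def orb_def append_tup_def face_def fun_eq_iff Suc_diff_Suc)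

lemma sum_atMost_split: "(\<Sum>j\<le>m + Suc q. g j) = (\<Sum>j\<le>m. g j) + (\<Sum>j\<le>q. g (Suc m + j) :: real)"
  by (induction q) (simp_all add: add.assoc)

text \<open>The sign of the horizontal differential is the one that makes the pull-backs of a
  cochain along the orbit maps fit together.\<close>

lemma d_right_orb:
  "d_right 0 (m + Suc q) \<omega> (orb (Suc m) (Suc q) z) =
    d_up m (\<lambda>z. \<omega> (orb m (Suc q) z)) z + d_right (Suc m) q (\<lambda>z. \<omega> (orb (Suc m) q z)) z"
proof -
  have 1: "(\<Sum>j\<le>m. (-1) ^ j * \<omega> (faceV (m + Suc q) j (orb (Suc m) (Suc q) z))) = (\<Sum>j\<le>m. (-1) ^ j * \<omega> (orb m (Suc q) (faceG m j z)))"
    by (rule sum.cong) (simp_all only: atMost_iff faceV_orb_G)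
  have 2: "(\<Sum>j\<le>q. (-1) ^ (Suc m + j) * \<omega> (faceV (m + Suc q) (Suc m + j) (orb (Suc m) (Suc q) z))) =
      (-1) ^ Suc m * (\<Sum>j\<le>q. (-1) ^ j * \<omega> (orb (Suc m) q (faceV q j z)))"
    unfolding sum_distrib_left by (rule sum.cong) (simp_all only: atMost_iff faceV_orb_V power_add mult.assoc)
  show ?thesis unfolding d_right_eq d_up_eq sum_atMost_split 1 2 by simp
qed

lemma nat_sums: "0 + 3 = (3::nat)" "1 + 3 = (4::nat)"
  by simp_all

lemma d_right_orb_zero:
  assumes "AE z in pts 0 (Suc m + Suc q). d_right 0 (m + Suc q) \<omega> z = 0"
  shows "AE z in pts (Suc m) (Suc q). d_up m (\<lambda>z. \<omega> (orb m (Suc q) z)) z = - d_right (Suc m) q (\<lambda>z. \<omega> (orb (Suc m) q z)) z"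
  using nonsing_AE[OF nonsing_orb assms] unfolding d_right_orb by eventually_elim simp

lemma orbit_eval_orb: "orbit_eval 2 \<omega> = (\<lambda>z. \<omega> (orb 3 0 z))"
proof
  fix z :: "'a point"
  have "orb 3 0 z = (restrict (fst z) {}, \<lambda>j\<in>{..<2 + 1}. fst z j *v e1)"
    by (auto simp: orb_def append_tup_def restrict_def fun_eq_iff)
  then show "orbit_eval 2 \<omega> z = \<omega> (orb 3 0 z)" by (simp only: orbit_eval_def case_prod_beta')
qed

lemma L0inv_orb: "\<omega> \<in> L0inv L 0 (m + q) \<Longrightarrow> (\<lambda>z. \<omega> (orb m q z)) \<in> L0inv L m q"
  by (rule L0inv_pullback[OF _ nonsing_orb orb_act])

text \<open>The cocycle identity of \<omega>, restricted to points whose first variables come from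
  the group, splits by \<open>d_right_orb\<close> into a vertical and a horizontal differential. For
  one, two and three group variables this gives the steps of a staircase that ends in
  \<open>orbit_eval\<close>.\<close>

lemma standard_zigzag:
  assumes \<omega>: "\<omega> \<in> Z_hom 2"
  shows "zigzag \<omega> (\<lambda>z. - \<omega> (orb 1 2 z)) (\<lambda>z. \<omega> (orb 2 1 z))"
    and "AE z in pts 3 1. d_up 2 (\<lambda>z. \<omega> (orb 2 1 z)) z = - d_right 3 0 (orbit_eval 2 \<omega>) z"
    and "orbit_eval 2 \<omega> \<in> L0inv SL2 3 0"
proof -
  have \<omega>': "\<omega> \<in> L0inv SL2 0 3" "AE z in pts 0 4. d_right 0 3 \<omega> z = 0" using \<omega> by (simp_all only: Z_hom_2)
  note 0 = d_right_orb_zero[where m=0 and q=2 and \<omega>=\<omega>, unfolded nat_succs nat_sums, OF \<omega>'(2)]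
  note 1 = d_right_orb_zero[where m=1 and q=1 and \<omega>=\<omega>, unfolded nat_succs nat_sums, OF \<omega>'(2)]
  note 2 = d_right_orb_zero[where m=2 and q=0 and \<omega>=\<omega>, unfolded nat_succs nat_sums, OF \<omega>'(2)]
  note l = L0inv_orb[where m=1 and q=2, unfolded nat_succs nat_sums, OF \<omega>'(1)]
    L0inv_orb[where m=2 and q=1, unfolded nat_succs nat_sums, OF \<omega>'(1)]
  show "zigzag \<omega> (\<lambda>z. - \<omega> (orb 1 2 z)) (\<lambda>z. \<omega> (orb 2 1 z))"
    unfolding zigzag_def
  proof (intro conjI \<omega>'(1) L0inv_uminus l)
    show "AE z in pts 1 3. d_up 0 \<omega> z = d_right 1 2 (\<lambda>z. - \<omega> (orb 1 2 z)) z"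
      using 0 AE_space
    proof eventually_elim
      case (elim z)
      have "snd z \<in> extensional {..<3}" using elim(2) by (simp add: space_pts PiE_iff)
      then have "orb 0 3 (faceG 0 0 z) = faceG 0 0 z"
        by (auto simp: orb_def append_tup_def faceG_def face_def fun_eq_iff extensional_def)
      then have "d_up 0 (\<lambda>z. \<omega> (orb 0 3 z)) z = d_up 0 \<omega> z" by (simp add: d_up_eq)
      then show ?case using elim(1) unfolding d_right_uminus by simp
    qed
    show "AE z in pts 2 2. d_up 1 (\<lambda>z. - \<omega> (orb 1 2 z)) z = d_right 2 1 (\<lambda>z. \<omega> (orb 2 1 z)) z"
      using 1 by eventually_elim (simp only: d_up_uminus minus_minus)
  qed
  show "AE z in pts 3 1. d_up 2 (\<lambda>z. \<omega> (orb 2 1 z)) z = - d_right 3 0 (orbit_eval 2 \<omega>) z"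
    unfolding orbit_eval_orb by (rule 2)
  show "orbit_eval 2 \<omega> \<in> L0inv SL2 3 0"
    unfolding orbit_eval_orb by (rule L0inv_orb) (use \<omega>'(1) in simp)
qed

lemma orbit_eval_Z_grp:
  assumes \<omega>: "\<omega> \<in> Z_hom 2" shows "orbit_eval 2 \<omega> \<in> Z_grp SL2 2"
  unfolding Z_grp_2
proof (intro conjI standard_zigzag(3)[OF \<omega>] right_inject)
  show "AE z in pts 4 1. d_right 4 0 (d_up 3 (orbit_eval 2 \<omega>)) z = 0"
    using d_up_AE_cong[OF standard_zigzag(2)[OF \<omega>], unfolded nat_succs]
  proof eventually_elim
    case (elim z)
    then show ?case unfolding dd_up d_up_uminus d_up_d_right[where m=3, unfolded nat_succs] by linarith
  qed
qed

text \<open>The evaluation of \<omega> is read off from an arbitrary staircase, by comparison with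
  the standard one.\<close>

lemma orbit_eval_compare:
  assumes z: "zigzag \<omega> \<beta> a" and c: "c \<in> L0inv SL2 3 0" "AE z in pts 3 1. d_up 2 a z = - d_right 3 0 c z"
  shows "(\<lambda>z. orbit_eval 2 \<omega> z - c z) \<in> B_grp SL2 2"
proof -
  note \<omega> = zigzag_cocycle[OF z]
  show ?thesis unfolding B_grp_2
    using zigzag_compare[OF standard_zigzag(1)[OF \<omega>] z standard_zigzag(2)[OF \<omega>] c(2)]
      L0inv_diff[OF standard_zigzag(3)[OF \<omega>] c(1)] by blast
qed

lemma orbit_eval_B_grp:
  assumes \<omega>: "\<omega> \<in> B_hom 2" shows "orbit_eval 2 \<omega> \<in> B_grp SL2 2"
proof -
  obtain \<beta> where z: "zigzag \<omega> \<beta> (\<lambda>_. 0)" using zigzag_of_coboundary[OF \<omega>] by blast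
  have "AE z in pts 3 1. d_up 2 (\<lambda>_. 0) z = - d_right 3 0 (\<lambda>_. 0) z" by (simp add: d_up_zero d_right_zero)
  from orbit_eval_compare[OF z L0inv_zero this] show ?thesis by simp
qed

section \<open>The maps on classes\<close>

definition incl_rel :: "'k::{real_normed_field,euclidean_space} cochain \<Rightarrow> 'k cochain \<Rightarrow> bool" where
  "incl_rel f \<omega> \<longleftrightarrow> (\<exists>a \<beta>. shapiro 2 f a \<and> zigzag \<omega> \<beta> a)"

lemma incl_eq: "incl A = (\<Union>\<omega>\<in>{\<omega>. \<exists>f\<in>A. incl_rel f \<omega>}. class_hom 2 \<omega>)"
proof -
  have "\<omega> \<in> Z_hom 2 \<and> (\<exists>f\<in>A. \<exists>a \<beta>. shapiro 2 f a \<and> \<beta> \<in> L0inv SL2 1 2 \<and>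
       (AE z in pts 2 2. d_up 1 \<beta> z = d_right 2 1 a z) \<and> (AE z in pts 1 3. d_up 0 \<omega> z = d_right 1 2 \<beta> z))
    \<longleftrightarrow> (\<exists>f\<in>A. incl_rel f \<omega>)" for \<omega>
    unfolding incl_rel_def using zigzag_cocycle[of \<omega>] zigzagD[of \<omega>] shapiro_L0inv(2)[of 2] Z_hom_2[of \<omega>] zigzag_def[of \<omega>]
    by meson
  then show ?thesis unfolding incl_def by simp
qed

lemma incl_rel_diff:
  assumes "incl_rel f \<omega>" "incl_rel f' \<omega>'" shows "incl_rel (\<lambda>z. f z - f' z) (\<lambda>z. \<omega> z - \<omega>' z)"
  using assms shapiro_diff zigzag_diff unfolding incl_rel_def by blast

lemma incl_rel_zero: "incl_rel (\<lambda>_. 0) (\<lambda>_. 0)"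
proof -
  have "zigzag (\<lambda>_. 0) (\<lambda>_. 0) (\<lambda>_. 0)" by (simp add: zigzag_def L0inv_zero d_up_zero d_right_zero)
  then show ?thesis using shapiro_zero unfolding incl_rel_def by blast
qed

lemma incl_rel_add:
  assumes "incl_rel f \<omega>" "incl_rel f' \<omega>'" shows "incl_rel (\<lambda>z. f z + f' z) (\<lambda>z. \<omega> z + \<omega>' z)"
  using incl_rel_diff[OF assms(1) incl_rel_diff[OF incl_rel_zero assms(2)]] by simp

lemma incl_rel_cocycle: "incl_rel f \<omega> \<Longrightarrow> \<omega> \<in> Z_hom 2"
  using zigzag_cocycle unfolding incl_rel_def by blast

lemma shapiro_cocycle:
  assumes f: "f \<in> Z_grp Unip 1" and fa: "shapiro 2 f a" shows "AE z in pts 3 1. d_up 2 a z = 0"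
proof -
  have "AE z in pts 3 0. d_up 2 f z = 0" using f by (simp only: Z_grp_1)
  then show ?thesis
    using shapiro_AE_eq[OF shapiro_d_up[OF fa] shapiro_zero] unfolding nat_succs by blast
qed

lemma incl_rel_exists:
  assumes f: "f \<in> Z_grp Unip 1" shows "\<exists>\<omega>. incl_rel f \<omega>"
proof -
  have f': "f \<in> L0inv Unip 2 0" using f by (simp only: Z_grp_1)
  obtain a where a: "shapiro 2 f a" using shapiro_exists[where m=1, unfolded nat_succs, OF f'] by blast
  have "AE z in pts 3 2. d_right 3 1 (d_up 2 a) z = 0"
    using d_right_cong_1[OF shapiro_cocycle[OF f a]] by eventually_elim (simp only: d_right_zero)
  from zigzag_exists[OF shapiro_L0inv(2)[OF a] this] show ?thesis using a unfolding incl_rel_def by blast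
qed

lemma incl_rel_coboundary:
  assumes f: "f \<in> B_grp Unip 1" and r: "incl_rel f \<omega>" shows "\<omega> \<in> B_hom 2"
proof -
  obtain a \<beta> where a: "shapiro 2 f a" and z: "zigzag \<omega> \<beta> a" using r unfolding incl_rel_def by blast
  obtain b where b: "b \<in> L0inv Unip 1 0" "AE z in pts 2 0. f z = d_up 1 b z" using f by (auto simp only: B_grp_1)
  obtain b' where b': "shapiro 1 b b'" using shapiro_exists[where m=0, unfolded nat_succs, OF b(1)] by blast
  have "AE z in pts 2 1. a z = d_up 1 b' z"
    using shapiro_AE_eq[OF a shapiro_d_up[OF b', unfolded nat_succs]] b(2) by blast
  from zigzag_coboundary[OF z shapiro_L0inv(2)[OF b'] this] show ?thesis .
qed

lemma incl_rel_injective: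
  assumes f: "f \<in> Z_grp Unip 1" and r: "incl_rel f \<omega>" and \<omega>: "\<omega> \<in> B_hom 2" shows "f \<in> B_grp Unip 1"
proof -
  obtain a \<beta> where a: "shapiro 2 f a" and z: "zigzag \<omega> \<beta> a" using r unfolding incl_rel_def by blast
  obtain b where b: "b \<in> L0inv SL2 1 1" "AE z in pts 2 1. a z = d_up 1 b z"
    using zigzag_injective[OF z \<omega> shapiro_cocycle[OF f a]] by blast
  obtain b' where b': "shapiro 1 b' b" using unshapiro_exists[where m=0, unfolded nat_succs, OF b(1)] by blast
  have "AE z in pts 2 0. f z = d_up 1 b' z"
    using shapiro_AE_eq[OF a shapiro_d_up[OF b', unfolded nat_succs]] b(2) by blast
  then show ?thesis using f shapiro_L0inv(1)[OF b'] unfolding Z_grp_1 B_grp_1 by blast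
qed

text \<open>Differences of related pairs are related, and what is related to a coboundary is a
  coboundary; hence all classes in the union defining \<open>incl\<close> coincide.\<close>

lemma incl_class:
  assumes f: "f \<in> Z_grp Unip 1" and r: "incl_rel f \<omega>"
  shows "incl (class_grp Unip 1 f) = class_hom 2 \<omega>"
proof -
  have 1: "class_hom 2 \<omega>' = class_hom 2 \<omega>" if "f' \<in> class_grp Unip 1 f" "incl_rel f' \<omega>'" for f' \<omega>'
  proof -
    have "(\<lambda>z. f' z - f z) \<in> B_grp Unip 1" using that(1) unfolding class_grp_def coset_iff .
    from incl_rel_coboundary[OF this incl_rel_diff[OF that(2) r]]
    show ?thesis unfolding class_hom_def coset_eq_iff[OF fun_subgroup_B_hom] .
  qed
  have "f \<in> class_grp Unip 1 f"
    unfolding class_grp_def coset_iff using fun_subgroup_zero[OF fun_subgroup_B_grp] by simp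
  then show ?thesis unfolding incl_eq using 1 r by blast
qed

lemma eval_class:
  assumes \<omega>: "\<omega> \<in> Z_hom 2"
  shows "eval_class 2 (class_hom 2 \<omega>) = class_grp SL2 2 (orbit_eval 2 \<omega>)"
proof -
  have 1: "class_grp SL2 2 (orbit_eval 2 \<omega>') = class_grp SL2 2 (orbit_eval 2 \<omega>)" if "\<omega>' \<in> class_hom 2 \<omega>" for \<omega>'
  proof -
    have "(\<lambda>z. \<omega>' z - \<omega> z) \<in> B_hom 2" using that unfolding class_hom_def coset_iff .
    from orbit_eval_B_grp[OF this]
    show ?thesis unfolding class_grp_def coset_eq_iff[OF fun_subgroup_B_grp] by (simp only: orbit_eval_orb)
  qed
  have "\<omega> \<in> class_hom 2 \<omega>"
    unfolding class_hom_def coset_iff using fun_subgroup_zero[OF fun_subgroup_B_hom] by simp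
  then show ?thesis unfolding eval_class_def using 1 by blast
qed

section \<open>Exactness of the sequence\<close>

lemma group_H_grp: "Group.group (H_grp L n)"
  unfolding H_grp_def by (rule quotient_group[OF grp_subgroups])

lemma group_H_hom: "Group.group (H_hom n)"
  unfolding H_hom_def by (rule quotient_group[OF hom_subgroups])

lemma carrier_H_grp: "carrier (H_grp L n) = class_grp L n ` Z_grp L n"
  unfolding H_grp_def carrier_quotient class_grp_def[abs_def] ..

lemma carrier_H_hom: "carrier (H_hom n) = class_hom n ` Z_hom n"
  unfolding H_hom_def carrier_quotient class_hom_def[abs_def] ..

lemma incl_hom: "incl \<in> hom (H_grp Unip 1) (H_hom 2)"
proof -
  define J where "J f = (SOME \<omega>. incl_rel f \<omega>)" for f :: "'a cochain"
  have J: "incl_rel f (J f)" if "f \<in> Z_grp Unip 1" for f :: "'a cochain"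
    unfolding J_def using incl_rel_exists[OF that] by (rule someI_ex)
  show ?thesis unfolding H_grp_def H_hom_def
  proof (rule quotient_hom[OF grp_subgroups hom_subgroups])
    fix f :: "'a cochain" assume f: "f \<in> Z_grp Unip 1"
    show "J f \<in> Z_hom 2" by (rule incl_rel_cocycle[OF J[OF f]])
    show "incl (coset (Z_grp Unip 1) (B_grp Unip 1) f) = coset (Z_hom 2) (B_hom 2) (J f)"
      using incl_class[OF f J[OF f]] unfolding class_grp_def class_hom_def .
  next
    fix f g :: "'a cochain" assume f: "f \<in> Z_grp Unip 1" and g: "g \<in> Z_grp Unip 1"
    have "incl_rel (\<lambda>_. 0) (\<lambda>z. J (\<lambda>z. f z + g z) z - (J f z + J g z))"
      using incl_rel_diff[OF J[OF fun_subgroup_add[OF fun_subgroup_Z_grp f g]] incl_rel_add[OF J[OF f] J[OF g]]] by simp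
    from incl_rel_coboundary[OF fun_subgroup_zero[OF fun_subgroup_B_grp] this]
    show "(\<lambda>z. J (\<lambda>z. f z + g z) z - (J f z + J g z)) \<in> B_hom 2" .
  qed
qed

lemma eval_class_hom: "eval_class 2 \<in> hom (H_hom 2) (H_grp SL2 2)"
  unfolding H_grp_def H_hom_def
proof (rule quotient_hom[OF hom_subgroups grp_subgroups, where J="orbit_eval 2"])
  fix \<omega> :: "'a cochain" assume \<omega>: "\<omega> \<in> Z_hom 2"
  show "orbit_eval 2 \<omega> \<in> Z_grp SL2 2" by (rule orbit_eval_Z_grp[OF \<omega>])
  show "eval_class 2 (coset (Z_hom 2) (B_hom 2) \<omega>) = coset (Z_grp SL2 2) (B_grp SL2 2) (orbit_eval 2 \<omega>)"
    using eval_class[OF \<omega>] unfolding class_grp_def class_hom_def .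
next
  fix f g :: "'a cochain"
  have "(\<lambda>z. orbit_eval 2 (\<lambda>z. f z + g z) z - (orbit_eval 2 f z + orbit_eval 2 g z)) = (\<lambda>_. 0)"
    unfolding orbit_eval_orb by simp
  then show "(\<lambda>z. orbit_eval 2 (\<lambda>z. f z + g z) z - (orbit_eval 2 f z + orbit_eval 2 g z)) \<in> B_grp SL2 2"
    using fun_subgroup_zero[OF fun_subgroup_B_grp] by simp
qed

lemma incl_inj: "inj_on incl (carrier (H_grp Unip 1))"
proof (rule inj_onI)
  fix x y :: "'a cochain set" assume "x \<in> carrier (H_grp Unip 1)" "y \<in> carrier (H_grp Unip 1)" and eq: "incl x = incl y"
  then obtain f g where f: "f \<in> Z_grp Unip 1" "x = class_grp Unip 1 f" and g: "g \<in> Z_grp Unip 1" "y = class_grp Unip 1 g"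
    by (auto simp: carrier_H_grp)
  obtain \<omega> \<omega>' where r: "incl_rel f \<omega>" "incl_rel g \<omega>'" using incl_rel_exists f(1) g(1) by blast
  have "class_hom 2 \<omega> = class_hom 2 \<omega>'" using eq unfolding f(2) g(2) incl_class[OF f(1) r(1)] incl_class[OF g(1) r(2)] .
  then have "(\<lambda>z. \<omega> z - \<omega>' z) \<in> B_hom 2" unfolding class_hom_def coset_eq_iff[OF fun_subgroup_B_hom] .
  from incl_rel_injective[OF fun_subgroup_diff[OF fun_subgroup_Z_grp f(1) g(1)] incl_rel_diff[OF r] this]
  show "x = y" unfolding f(2) g(2) class_grp_def coset_eq_iff[OF fun_subgroup_B_grp] .
qed

text \<open>Restricted to \<open>Unip\<close>, a 2-cocycle \<open>c\<close> of \<open>SL2\<close>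
  has a primitive \<open>f\<close>. The cochain induced by \<open>f\<close> has the augmentation of
  \<open>c\<close> as vertical differential, so it starts a staircase to some \<omega> and, by
  \<open>orbit_eval_compare\<close>, \<omega> evaluates to the class of \<open>c\<close>.\<close>

lemma eval_class_surj: "eval_class 2 ` carrier (H_hom 2) = carrier (H_grp SL2 2)"
proof (rule equalityI)
  show "eval_class 2 ` carrier (H_hom 2) \<subseteq> carrier (H_grp SL2 2 :: 'a cochain set monoid)"
    using eval_class_hom by (auto simp: hom_def)
  show "carrier (H_grp SL2 2 :: 'a cochain set monoid) \<subseteq> eval_class 2 ` carrier (H_hom 2)"
  proof
    fix x :: "'a cochain set" assume "x \<in> carrier (H_grp SL2 2)"
    then obtain c where c: "c \<in> Z_grp SL2 2" and x: "x = class_grp SL2 2 c" by (auto simp: carrier_H_grp)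
    have c': "c \<in> L0inv SL2 3 0" "AE z in pts 4 0. d_up 3 c z = 0" using c by (simp_all only: Z_grp_2)
    obtain f where f: "f \<in> L0inv Unip 2 0" "AE z in pts 3 0. c z = d_up 2 f z"
      using H2_restriction_trivial[unfolded nat_succs, OF c'] by blast
    obtain a where a: "shapiro 2 f a" using shapiro_exists[where m=1, unfolded nat_succs, OF f(1)] by blast
    have "AE z in pts 3 1. c (faceV 0 0 z) = d_up 2 a z"
      using shapiro_AE_eq[OF shapiro_restriction[OF c'(1)] shapiro_d_up[OF a, unfolded nat_succs]] f(2) by blast
    then have ac: "AE z in pts 3 1. d_up 2 a z = - d_right 3 0 c z"
      by eventually_elim (simp add: d_right_eq)
    have "AE z in pts 3 2. d_right 3 1 (d_up 2 a) z = 0"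
      using d_right_cong_1[OF ac] by eventually_elim (simp only: d_right_uminus dd_right minus_zero)
    from zigzag_exists[OF shapiro_L0inv(2)[OF a] this]
    obtain \<omega> \<beta> where z: "zigzag \<omega> \<beta> a" by blast
    have "class_grp SL2 2 (orbit_eval 2 \<omega>) = class_grp SL2 2 c"
      using orbit_eval_compare[OF z c'(1) ac] unfolding class_grp_def coset_eq_iff[OF fun_subgroup_B_grp] .
    then have "eval_class 2 (class_hom 2 \<omega>) = x" unfolding x eval_class[OF zigzag_cocycle[OF z]] .
    then show "x \<in> eval_class 2 ` carrier (H_hom 2)"
      using zigzag_cocycle[OF z] by (auto simp: carrier_H_hom)
  qed
qed

lemma one_H_grp: "\<one>\<^bsub>H_grp L n\<^esub> = B_grp L n"
  by (simp add: H_grp_def)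

text \<open>If the evaluation of \<omega> is a coboundary, its standard staircase can be corrected
  to start at a vertical cocycle, which is induced from \<open>Unip\<close>. Conversely, the
  staircase of a cocycle of \<open>Unip\<close> continues by zero on \<open>SL2\<close>.\<close>

lemma eval_kernel: "kernel (H_hom 2) (H_grp SL2 2) (eval_class 2) = incl ` carrier (H_grp Unip 1)"
proof (rule equalityI; rule subsetI)
  fix x :: "'a cochain set" assume "x \<in> kernel (H_hom 2) (H_grp SL2 2) (eval_class 2)"
  then obtain \<omega> where \<omega>: "\<omega> \<in> Z_hom 2" "x = class_hom 2 \<omega>" and e: "eval_class 2 x = B_grp SL2 2"
    by (auto simp: kernel_def carrier_H_hom one_H_grp)
  have "orbit_eval 2 \<omega> \<in> B_grp SL2 2"
    using e unfolding \<omega>(2) eval_class[OF \<omega>(1)] class_grp_def coset_zero[OF fun_subgroup_B_grp] .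
  then obtain c where c: "c \<in> L0inv SL2 2 0" "AE z in pts 3 0. orbit_eval 2 \<omega> z = d_up 2 c z" by (auto simp only: B_grp_2)
  note z = standard_zigzag[OF \<omega>(1)]
  \<comment> \<open>The correction leaves the horizontal differential unchanged and cancels the
    vertical one.\<close>
  define a where "a z = \<omega> (orb 2 1 z) - d_right 2 0 c z" for z
  have a: "a \<in> L0inv SL2 2 1"
    unfolding a_def[abs_def] by (intro L0inv_diff zigzagD(3)[OF z(1)] L0inv_right_0 c(1))
  have z': "zigzag \<omega> (\<lambda>z. - \<omega> (orb 1 2 z)) a"
    unfolding zigzag_def
  proof (intro conjI a zigzagD(1,2,4)[OF z(1)])
    show "AE z in pts 2 2. d_up 1 (\<lambda>z. - \<omega> (orb 1 2 z)) z = d_right 2 1 a z"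
      using zigzagD(5)[OF z(1)] unfolding a_def[abs_def] d_right_diff dd_right diff_zero .
  qed
  have "AE z in pts 3 1. d_up 2 a z = 0"
    using z(2) d_right_cong_0[OF c(2)]
  proof eventually_elim
    case (elim z)
    then show ?case unfolding a_def[abs_def] d_up_diff d_comm by linarith
  qed
  moreover obtain f where f: "shapiro 2 f a" using unshapiro_exists[where m=1, unfolded nat_succs, OF a] by blast
  ultimately have "AE z in pts 3 0. d_up 2 f z = 0"
    using shapiro_AE_eq[OF shapiro_d_up[OF f] shapiro_zero] unfolding nat_succs by blast
  then have f': "f \<in> Z_grp Unip 1" using shapiro_L0inv(1)[OF f] unfolding Z_grp_1 by blast
  have "incl_rel f \<omega>" using f z' unfolding incl_rel_def by blast
  then have "incl (class_grp Unip 1 f) = x" using incl_class[OF f'] \<omega>(2) by blast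
  then show "x \<in> incl ` carrier (H_grp Unip 1)" using f' by (auto simp: carrier_H_grp)
next
  fix x :: "'a cochain set" assume x: "x \<in> incl ` carrier (H_grp Unip 1)"
  then obtain f where f: "f \<in> Z_grp Unip 1" and xf: "x = incl (class_grp Unip 1 f)" by (auto simp: carrier_H_grp)
  obtain \<omega> where r: "incl_rel f \<omega>" using incl_rel_exists[OF f] by blast
  then obtain a \<beta> where a: "shapiro 2 f a" and z: "zigzag \<omega> \<beta> a" unfolding incl_rel_def by blast
  have "AE z in pts 3 1. d_up 2 a z = - d_right 3 0 (\<lambda>_. 0) z"
    using shapiro_cocycle[OF f a] by eventually_elim (simp add: d_right_zero)
  from orbit_eval_compare[OF z L0inv_zero this] have "orbit_eval 2 \<omega> \<in> B_grp SL2 2" by simp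
  then have "class_grp SL2 2 (orbit_eval 2 \<omega>) = B_grp SL2 2"
    unfolding class_grp_def coset_zero[OF fun_subgroup_B_grp] .
  moreover have "x = class_hom 2 \<omega>" unfolding xf by (rule incl_class[OF f r])
  ultimately show "x \<in> kernel (H_hom 2) (H_grp SL2 2) (eval_class 2)"
    using zigzag_cocycle[OF z] by (auto simp: kernel_def carrier_H_hom one_H_grp eval_class)
qed

theorem short_exact_sequence_incl_eval:
  "short_exact_sequence (H_grp SL2 2) (H_hom 2) (H_grp Unip 1) (eval_class 2) incl"
  unfolding short_exact_sequence_iff
proof (intro conjI)
  show "exact_seq ([H_grp SL2 2, H_hom 2, H_grp Unip 1], [eval_class 2, incl])"
    by (intro exact_seq.extension exact_seq.unity group_hom.intro group_hom_axioms.intro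
       group_H_grp group_H_hom incl_hom eval_class_hom eval_kernel)
  show "eval_class 2 \<in> epi (H_hom 2) (H_grp SL2 2)" using eval_class_hom eval_class_surj by (simp add: epi_def)
  show "incl \<in> mon (H_grp Unip 1) (H_hom 2)" using incl_hom incl_inj by (simp add: mon_def)
qed

section \<open>The classes of linear forms\<close>

definition equivariant :: "('k::{real_normed_field,euclidean_space} \<Rightarrow> real) \<Rightarrow> ('k^2^2 \<Rightarrow> real) set" where
  "equivariant \<alpha> = {F \<in> borel_measurable haar. \<forall>t. \<forall>g\<in>SL2. F (unip t ** g) = \<alpha> t + F g}"

lemma equivariant_cochain: "(\<lambda>(y, x). F (y 1) - F (y 0)) = d_up 1 (\<lambda>z. F (fst z 0))"
  by (auto simp: d_up_eq faceG_def face_def)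

lemma equivariant_measurable:
  "F \<in> equivariant \<alpha> \<Longrightarrow> (\<lambda>z. F (fst z 0)) \<in> borel_measurable (pts (Suc m) q)"
  by (rule measurable_compose[of _ _ haar]) (auto simp: equivariant_def)

lemma equivariant_act:
  assumes "F \<in> equivariant \<alpha>" "z \<in> space (pts (Suc m) q)"
  shows "F (fst (act (Suc m) q (unip t) z) 0) = \<alpha> t + F (fst z 0)"
  using assms space_pts_G[OF assms(2) zero_less_Suc] by (simp add: equivariant_def fst_act)

lemma equivariant_diff:
  assumes F: "F \<in> equivariant \<alpha>" and F': "F' \<in> equivariant \<alpha>"
  shows "(\<lambda>z. F (fst z 0) - F' (fst z 0)) \<in> L0inv Unip (Suc m) q"
proof (rule strict_L0inv)
  show "strict Unip (Suc m) q (\<lambda>z. F (fst z 0) - F' (fst z 0))"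
    unfolding strict_def using equivariant_measurable[OF F] equivariant_measurable[OF F']
    by (auto simp: Unip_def equivariant_act[OF F] equivariant_act[OF F'])
qed

lemma equivariant_cocycle:
  assumes F: "F \<in> equivariant \<alpha>"
  shows "(\<lambda>(y, x). F (y 1) - F (y 0)) \<in> Z_grp Unip 1"
proof -
  let ?F = "\<lambda>z. F (fst z 0)"
  have "d_up (Suc 0) ?F \<in> borel_measurable (pts (Suc (Suc 0)) 0)"
    using equivariant_measurable[OF F, of 0 0] unfolding d_up_1[abs_def] by measurable
  moreover have "d_up (Suc 0) ?F (act (Suc (Suc 0)) 0 (unip t) z) = d_up (Suc 0) ?F z"
    if z: "z \<in> space (pts (Suc (Suc 0)) 0)" for t z
  proof -
    have "faceG (Suc 0) j z \<in> space (pts (Suc 0) 0)" for j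
      using measurable_space[OF measurable_faceG[OF measurable_ident_sets[OF refl]] z] .
    then show ?thesis unfolding d_up_1 by (simp add: act_faceG equivariant_act[OF F])
  qed
  ultimately have "strict Unip (Suc (Suc 0)) 0 (d_up (Suc 0) ?F)" unfolding strict_def Unip_def by blast
  from strict_L0inv[OF this] have "d_up 1 ?F \<in> L0inv Unip 2 0" unfolding nat_succs .
  then show ?thesis unfolding equivariant_cochain Z_grp_1 by (simp only: dd_up) simp
qed

lemma equivariant_nu: "linear \<alpha> \<Longrightarrow> (\<lambda>g. \<alpha> (nu g)) \<in> equivariant \<alpha>"
proof -
  assume \<alpha>: "linear \<alpha>"
  note [measurable] = linear_borel[OF \<alpha>]
  have "(\<lambda>g. nu g) \<in> borel_measurable haar" by (rule measurable_nu) simp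
  then have "(\<lambda>g. \<alpha> (nu g)) \<in> borel_measurable haar" by measurable
  then show ?thesis by (auto simp: equivariant_def nu_unip linear_add[OF \<alpha>])
qed

text \<open>Two admissible functions differ by a \<open>Unip\<close>-invariant one, so their
  cochains differ by its coboundary. The class can thus be computed with \<open>nu\<close> or with
  \<open>iwasawa\<close>, as convenient.\<close>

lemma lin_class_eq:
  assumes F: "F \<in> equivariant \<alpha>" shows "lin_class \<alpha> = class_grp Unip 1 (\<lambda>(y, x). F (y 1) - F (y 0))"
proof -
  have "class_grp Unip 1 (\<lambda>(y, x). F' (y 1) - F' (y 0)) = class_grp Unip 1 (\<lambda>(y, x). F (y 1) - F (y 0))"
    if F': "F' \<in> equivariant \<alpha>" for F'
    unfolding class_grp_def coset_eq_iff[OF fun_subgroup_B_grp] B_grp_1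
  proof (intro conjI bexI)
    show "(\<lambda>z. (case z of (y, x) \<Rightarrow> F' (y 1) - F' (y 0)) - (case z of (y, x) \<Rightarrow> F (y 1) - F (y 0))) \<in> L0inv Unip 2 0"
      using L0inv_diff equivariant_cocycle[OF F] equivariant_cocycle[OF F'] unfolding Z_grp_1 by blast
    show "(\<lambda>z. F' (fst z 0) - F (fst z 0)) \<in> L0inv Unip 1 0"
      using equivariant_diff[OF F' F, of 0 0] unfolding nat_succs .
    show "AE z in pts 2 0. (case z of (y, x) \<Rightarrow> F' (y 1) - F' (y 0)) - (case z of (y, x) \<Rightarrow> F (y 1) - F (y 0)) =
        d_up 1 (\<lambda>z. F' (fst z 0) - F (fst z 0)) z"
      unfolding d_up_diff equivariant_cochain[symmetric] by simp
  qed
  then show ?thesis unfolding lin_class_def equivariant_def[symmetric] using F by blast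
qed

text \<open>The representatives built from \<open>nu\<close> are additive in \<alpha> on the
  nose.\<close>

lemma lin_class_iso: "lin_class \<in> iso (fun_group {\<alpha> :: 'k::{real_normed_field,euclidean_space} \<Rightarrow> real. linear \<alpha>}) (H_grp Unip 1)"
proof -
  define F where "F \<alpha> = d_up 1 (\<lambda>z. \<alpha> (nu (fst z 0)))" for \<alpha> :: "'k \<Rightarrow> real"
  have cls: "lin_class \<alpha> = class_grp Unip 1 (F \<alpha>)" if "linear \<alpha>" for \<alpha>
    unfolding lin_class_eq[OF equivariant_nu[OF that]] equivariant_cochain[of "\<lambda>g. \<alpha> (nu g)"] F_def ..
  have Z: "F \<alpha> \<in> Z_grp Unip 1" if "linear \<alpha>" for \<alpha>
    using equivariant_cocycle[OF equivariant_nu[OF that]] unfolding equivariant_cochain[of "\<lambda>g. \<alpha> (nu g)"] F_def .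
  have F_add: "F (\<lambda>t. \<alpha> t + \<beta> t) = (\<lambda>z. F \<alpha> z + F \<beta> z)" for \<alpha> \<beta> unfolding F_def d_up_add ..
  have F_diff: "F (\<lambda>t. \<alpha> t - \<beta> t) = (\<lambda>z. F \<alpha> z - F \<beta> z)" for \<alpha> \<beta> unfolding F_def d_up_diff ..
  have "lin_class \<in> hom (fun_group {\<alpha> :: 'k \<Rightarrow> real. linear \<alpha>}) (H_grp Unip 1)"
  proof (rule homI)
    fix \<alpha> :: "'k \<Rightarrow> real" assume "\<alpha> \<in> carrier (fun_group {\<alpha>. linear \<alpha>})"
    then show "lin_class \<alpha> \<in> carrier (H_grp Unip 1)" using Z cls by (auto simp: carrier_H_grp)
  next
    fix \<alpha> \<beta> :: "'k \<Rightarrow> real" assume "\<alpha> \<in> carrier (fun_group {\<alpha>. linear \<alpha>})" "\<beta> \<in> carrier (fun_group {\<alpha>. linear \<alpha>})"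
    then have l: "linear \<alpha>" "linear \<beta>" by auto
    have "lin_class (\<alpha> \<otimes>\<^bsub>fun_group {\<alpha>. linear \<alpha>}\<^esub> \<beta>) = class_grp Unip 1 (\<lambda>z. F \<alpha> z + F \<beta> z)"
      using cls[OF linear_compose_add[OF l]] by (simp add: F_add)
    also have "\<dots> = lin_class \<alpha> \<otimes>\<^bsub>H_grp Unip 1\<^esub> lin_class \<beta>"
      unfolding cls[OF l(1)] cls[OF l(2)] H_grp_def class_grp_def
      by (rule quotient_mult[OF grp_subgroups Z[OF l(1)] Z[OF l(2)], symmetric])
    finally show "lin_class (\<alpha> \<otimes>\<^bsub>fun_group {\<alpha>. linear \<alpha>}\<^esub> \<beta>) = lin_class \<alpha> \<otimes>\<^bsub>H_grp Unip 1\<^esub> lin_class \<beta>" .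
  qed
  moreover have "inj_on lin_class {\<alpha> :: 'k \<Rightarrow> real. linear \<alpha>}"
  proof (rule inj_onI)
    fix \<alpha> \<beta> :: "'k \<Rightarrow> real" assume "\<alpha> \<in> {\<alpha>. linear \<alpha>}" "\<beta> \<in> {\<alpha>. linear \<alpha>}" and eq: "lin_class \<alpha> = lin_class \<beta>"
    then have l: "linear \<alpha>" "linear \<beta>" by auto
    have "F (\<lambda>t. \<alpha> t - \<beta> t) \<in> B_grp Unip 1"
      using eq unfolding cls[OF l(1)] cls[OF l(2)] class_grp_def coset_eq_iff[OF fun_subgroup_B_grp] F_diff .
    then obtain b where "b \<in> L0inv Unip 1 0" "AE z in pts 2 0. F (\<lambda>t. \<alpha> t - \<beta> t) z = d_up 1 b z" by (auto simp only: B_grp_1)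
    from linear_class_injective[unfolded nat_succs, OF linear_compose_sub[OF l] this[unfolded F_def]]
    show "\<alpha> = \<beta>" by (simp add: fun_eq_iff)
  qed
  moreover have "lin_class ` {\<alpha> :: 'k \<Rightarrow> real. linear \<alpha>} = carrier (H_grp Unip 1)"
  proof (rule equalityI; rule subsetI)
    fix x :: "'k cochain set" assume "x \<in> carrier (H_grp Unip 1)"
    then obtain f where f: "f \<in> Z_grp Unip 1" and x: "x = class_grp Unip 1 f" by (auto simp: carrier_H_grp)
    have f': "f \<in> L0inv Unip 2 0" "AE z in pts 3 0. d_up 2 f z = 0" using f by (simp_all only: Z_grp_1)
    from H1_Unip_representative[unfolded nat_succs, OF f']
    obtain \<alpha> b where \<alpha>: "linear \<alpha>" and b: "b \<in> L0inv Unip 1 0" "AE z in pts 2 0. f z = F \<alpha> z + d_up 1 b z"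
      unfolding F_def by blast
    have "AE z in pts 2 0. f z - F \<alpha> z = d_up 1 b z" using b(2) by eventually_elim simp
    moreover have "(\<lambda>z. f z - F \<alpha> z) \<in> L0inv Unip 2 0"
      using L0inv_diff f'(1) Z[OF \<alpha>] unfolding Z_grp_1 by blast
    ultimately have "(\<lambda>z. f z - F \<alpha> z) \<in> B_grp Unip 1" unfolding B_grp_1 using b(1) by blast
    then have "x = lin_class \<alpha>" unfolding x cls[OF \<alpha>] class_grp_def coset_eq_iff[OF fun_subgroup_B_grp] .
    then show "x \<in> lin_class ` {\<alpha>. linear \<alpha>}" using \<alpha> by blast
  qed (use Z cls in \<open>auto simp: carrier_H_grp\<close>)
  ultimately show ?thesis by (simp add: iso_def bij_betw_def)
qed

section \<open>The explicit cocycle\<close>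

text \<open>The rows of the inverse of a matrix in \<open>SL2\<close> are its columns, exchanged and
  turned by this map up to sign. This is how products of the vectors themselves come out of the rows
  of an inverse frame.\<close>

definition quarter_turn :: "'k::{real_normed_field,euclidean_space}^2 \<Rightarrow> 'k^2" where
  "quarter_turn v = vector [v$2, - v$1]"

text \<open>The common ground of the real and the Hermitian product. Only real scalars leave the
  second variable, where the Hermitian product is conjugate linear.\<close>

locale hermitian_product =
  fixes sp :: "'k::{real_normed_field,euclidean_space}^2 \<Rightarrow> 'k^2 \<Rightarrow> 'k"
  assumes sp_add: "sp (u + v) w = sp u w + sp v w"
    and sp_scale: "sp (c *s u) w = c * sp u w"
    and sp_scaleR: "sp u (r *\<^sub>R w) = r *\<^sub>R sp u w"
    and sp_self: "sp v v = of_real ((norm v)\<^sup>2)"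
    and sp_turn: "sp (quarter_turn u) (quarter_turn v) = sp u v"
    and sp_measurable: "(\<lambda>p. sp (fst p) (snd p)) \<in> borel_measurable (borel \<Otimes>\<^sub>M borel)"
begin

lemma norm_turn: "norm (quarter_turn v) = norm (v :: 'k^2)"
proof -
  have "of_real ((norm (quarter_turn v))\<^sup>2) = (of_real ((norm v)\<^sup>2) :: 'k)"
    using sp_turn[of v v] by (simp only: sp_self)
  then have "(norm (quarter_turn v))\<^sup>2 = (norm v)\<^sup>2" by (simp only: of_real_eq_iff)
  then show ?thesis by simp
qed

lemma borel_measurable_sp [measurable (raw)]:
  assumes [measurable]: "u \<in> borel_measurable A" "v \<in> borel_measurable A"
  shows "(\<lambda>a. sp (u a) (v a)) \<in> borel_measurable A"
proof -
  have "(\<lambda>a. (u a, v a)) \<in> A \<rightarrow>\<^sub>M borel \<Otimes>\<^sub>M borel" by measurable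
  from measurable_compose[OF this sp_measurable] show ?thesis by simp
qed

text \<open>If \<open>g\<close> is unipotent times positive diagonal times unitary, its second row
  is a multiple of the second row of the unitary factor, whose rows are orthonormal. Projecting the
  first row of \<open>g\<close> onto the second therefore isolates the entry of the unipotent
  factor.\<close>

definition iwasawa :: "'k^2^2 \<Rightarrow> 'k" where
  "iwasawa g = sp (g$1) (g$2 /\<^sub>R (norm (g$2))\<^sup>2)"

lemma iwasawa_unip:
  assumes g: "g \<in> SL2" shows "iwasawa (unip t ** g) = t + iwasawa g"
proof -
  have rows: "(unip t ** g)$1 = g$1 + t *s g$2" "(unip t ** g)$2 = g$2"
    by (simp_all add: mat2 unip_def)
  have "norm (g$2) \<noteq> 0" using g by (auto simp: SL2_iff)
  then have N: "inverse ((norm (g$2))\<^sup>2) * (norm (g$2))\<^sup>2 = 1" by simp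
  have "inverse ((norm (g$2))\<^sup>2) *\<^sub>R (t * of_real ((norm (g$2))\<^sup>2)) = t * of_real (inverse ((norm (g$2))\<^sup>2) * (norm (g$2))\<^sup>2)"
    unfolding of_real_mult scaleR_conv_of_real by (rule mult.left_commute)
  also have "\<dots> = t" unfolding N by simp
  finally show ?thesis
    unfolding iwasawa_def rows sp_add sp_scale sp_scaleR sp_self scaleR_add_right by (simp add: add.commute)
qed

lemma iwasawa_equivariant:
  assumes \<alpha>: "linear \<alpha>" shows "(\<lambda>g. \<alpha> (iwasawa g)) \<in> equivariant \<alpha>"
proof -
  note [measurable] = linear_borel[OF \<alpha>]
  have [measurable]: "(\<lambda>g :: 'k^2^2. g) \<in> borel_measurable haar" by (rule measurable_haar_borel) simp
  have "iwasawa \<in> borel_measurable haar" unfolding iwasawa_def[abs_def] by measurable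
  then have "(\<lambda>g. \<alpha> (iwasawa g)) \<in> borel_measurable haar" by measurable
  then show ?thesis by (auto simp: equivariant_def iwasawa_unip linear_add[OF \<alpha>])
qed

lemma iwasawa_frame:
  assumes d: "det2 v w \<noteq> 0"
  shows "iwasawa (adj (frame v w)) = - sp ((1 / det2 v w) *s w) (v /\<^sub>R (norm v)\<^sup>2)"
proof -
  have 1: "adj (frame v w) $ 1 = (1 / det2 v w) *s quarter_turn w"
    using d by (simp add: frame_def quarter_turn_def vec_eq_iff forall_2)
  have 2: "adj (frame v w) $ 2 = (- 1) *\<^sub>R quarter_turn v"
    using d by (simp add: frame_def quarter_turn_def vec_eq_iff forall_2)
  show ?thesis unfolding iwasawa_def 1 2 sp_scale sp_scaleR sp_turn norm_scaleR norm_turn by simp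
qed

definition edge :: "('k \<Rightarrow> real) \<Rightarrow> 'k^2 \<Rightarrow> 'k^2 \<Rightarrow> real" where
  "edge \<alpha> v w = \<alpha> (sp ((1 / det2 v w) *s v) (w /\<^sub>R (norm w)\<^sup>2)) + \<alpha> (sp ((1 / det2 v w) *s w) (v /\<^sub>R (norm v)\<^sup>2))"

definition frame_cochain :: "('k \<Rightarrow> real) \<Rightarrow> 'k^2^2 \<Rightarrow> 'k^2 \<Rightarrow> 'k^2 \<Rightarrow> real" where
  "frame_cochain \<alpha> y v w = \<alpha> (iwasawa (adj (frame w v) ** y)) - \<alpha> (iwasawa (adj (frame v w) ** y))"

lemma det2_swap: "det2 w v = - det2 v w"
  by (simp add: det2_eq mult.commute)

lemma frame_cochain_1:
  assumes \<alpha>: "linear \<alpha>" and d: "det2 v w \<noteq> 0"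
  shows "frame_cochain \<alpha> (mat 1) v w = edge \<alpha> v w"
proof -
  have d': "det2 w v \<noteq> 0" using d by (simp add: det2_swap[of w v])
  have "sp ((1 / det2 w v) *s v) (w /\<^sub>R (norm w)\<^sup>2) = - sp ((1 / det2 v w) *s v) (w /\<^sub>R (norm w)\<^sup>2)"
    unfolding det2_swap[of w v] sp_scale by simp
  then show ?thesis
    unfolding frame_cochain_def edge_def matrix_mul_rid iwasawa_frame[OF d] iwasawa_frame[OF d']
    by (simp add: linear_neg[OF \<alpha>])
qed

lemma frame_e1: "det2 v w \<noteq> 0 \<Longrightarrow> frame v w *v e1 = v"
  by (simp add: frame_def mat2)

text \<open>Both sides are the value at the coset of \<open>h\<close> of the cochain that Eckmann--Shapiro induction
  makes from a representative of the class of \<open>\<alpha>\<close>.\<close>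

lemma equivariant_coset:
  assumes F: "F \<in> equivariant \<alpha>" and h: "h \<in> SL2" "h' \<in> SL2" "h *v e1 = h' *v e1" and y: "y \<in> SL2" "y' \<in> SL2"
  shows "F (adj h ** y) - F (adj h ** y') = F (adj h' ** y) - F (adj h' ** y')"
proof -
  have "adj h ** h' \<in> Unip"
  proof (rule SL2_stabilizer)
    show "(adj h ** h') *v e1 = e1"
      using adj_cancel(3)[OF h(1), of e1] by (simp add: matrix_vector_mul_assoc[symmetric] h(3))
  qed (intro SL2_mult adj_SL2 h)
  then obtain t where t: "adj h ** h' = unip t" by (auto simp: Unip_def)
  have "adj h = unip t ** adj h'" unfolding t[symmetric] by (simp add: matrix_mul_assoc[symmetric] adj_right[OF h(2)])
  then have "F (adj h ** x) = \<alpha> t + F (adj h' ** x)" if "x \<in> SL2" for x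
    using F SL2_mult[OF adj_SL2[OF h(2)] that] by (simp add: equivariant_def matrix_mul_assoc[symmetric])
  then show ?thesis using y by simp
qed

section \<open>The staircase of a linear form\<close>

context
  fixes \<alpha> :: "'k \<Rightarrow> real"
  assumes \<alpha>: "linear \<alpha>"
begin

abbreviation F where "F g \<equiv> \<alpha> (iwasawa g)"

abbreviation rep :: "'k cochain" where "rep \<equiv> (\<lambda>(y, x). F (y 1) - F (y 0))"

definition induced :: "'k cochain" where
  "induced z = F (adj (section_mat (snd z 0)) ** fst z 1) - F (adj (section_mat (snd z 0)) ** fst z 0)"

definition beta :: "'k cochain" where
  "beta z = frame_cochain \<alpha> (fst z 0) (snd z 0) (snd z 1)"

lemmas F_equivariant = iwasawa_equivariant[OF \<alpha>]

lemma F_measurable [measurable (raw)]: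
  assumes "g \<in> A \<rightarrow>\<^sub>M haar" shows "(\<lambda>a. F (g a)) \<in> borel_measurable A"
  using measurable_compose[OF assms, of "\<lambda>g. \<alpha> (iwasawa g)" borel] F_equivariant by (simp add: equivariant_def)

lemma induced_eq:
  assumes "h \<in> SL2" "h *v e1 = snd z 0" "fst z 0 \<in> SL2" "fst z 1 \<in> SL2" "snd z 0 \<noteq> 0"
  shows "induced z = F (adj h ** fst z 1) - F (adj h ** fst z 0)"
  unfolding induced_def
  by (rule equivariant_coset[OF F_equivariant section_mat(1)[OF assms(5)] assms(1) _ assms(4,3)])
    (simp add: section_mat(2)[OF assms(5)] assms(2))

lemma shapiro_induced: "shapiro 2 rep induced"
  unfolding shapiro_iff
proof (intro conjI AE_I2)
  show "rep \<in> L0inv Unip 2 0" using equivariant_cocycle[OF F_equivariant] unfolding Z_grp_1 by blast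
  have z: "fst z 0 \<in> SL2" "fst z 1 \<in> SL2" "snd z 0 \<noteq> 0" if "z \<in> space (pts 2 1)" for z :: "'k point"
    using space_pts_G[OF that, of 0] space_pts_G[OF that, of 1] space_pts_V[OF that, of 0] by simp_all
  show "induced \<in> L0inv SL2 2 1"
  proof (rule strict_L0inv, unfold strict_def, intro conjI ballI)
    show "induced \<in> borel_measurable (pts 2 1)" unfolding induced_def[abs_def] by measurable
    fix g :: "'k^2^2" and z :: "'k point" assume g: "g \<in> SL2" and zs: "z \<in> space (pts 2 1)"
    let ?h = "section_mat (snd z 0)"
    note s = section_mat[OF z(3)[OF zs]]
    have "induced (act 2 1 g z) = F (adj (g ** ?h) ** (g ** fst z 1)) - F (adj (g ** ?h) ** (g ** fst z 0))"
      using induced_eq[of "g ** ?h" "act 2 1 g z"] s g z[OF zs]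
      by (simp add: fst_act snd_act SL2_mult matrix_vector_mul_assoc[symmetric] mult_nonzero)
    also have "\<dots> = induced z"
      unfolding induced_def adj_mult matrix_mul_assoc[symmetric] adj_cancel(1)[OF g] ..
    finally show "induced (act 2 1 g z) = induced z" .
  qed
  fix w :: "('k^2^2) \<times> 'k point" assume "w \<in> space (haar \<Otimes>\<^sub>M pts 2 0)"
  then have w: "fst w \<in> SL2" "snd w \<in> space (pts 2 0)" by (auto simp: space_pair_measure space_haar)
  have "fst (snd w) 0 \<in> SL2" "fst (snd w) 1 \<in> SL2" using w(2) by (auto intro: space_pts_G)
  then show "induced (insV 0 (fst w *v e1) (snd w)) = rep (act 2 0 (adj (fst w)) (snd w))"
    using induced_eq[of "fst w" "insV 0 (fst w *v e1) (snd w)"] w(1) mult_nonzero[OF w(1) e1_nonzero]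
    by (simp add: insV_def ins_def fst_act case_prod_beta')
qed

lemma beta_L0inv: "beta \<in> L0inv SL2 1 2"
  unfolding L0inv_def
proof (intro CollectI conjI ballI)
  show "beta \<in> borel_measurable (pts 1 2)"
    unfolding beta_def[abs_def] frame_cochain_def by measurable
  fix g :: "'k^2^2" assume g: "g \<in> SL2"
  have "AE z in (pts 1 2 :: 'k point measure). det2 (snd z 0) (snd z 1) \<noteq> 0" by (rule AE_pts_det2) simp
  then show "AE z in pts 1 2. beta (act 1 2 g z) = beta z"
  proof eventually_elim
    case (elim z)
    then have d: "det2 (snd z 0) (snd z 1) \<noteq> 0" "det2 (snd z 1) (snd z 0) \<noteq> 0"
      using det2_swap[of "snd z 1" "snd z 0"] by simp_all
    show ?case
      by (simp add: beta_def frame_cochain_def fst_act snd_act frame_mult[OF g d(1)[simplified]] frame_mult[OF g d(2)[simplified]]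
        adj_mult[of g] matrix_mul_assoc[symmetric] adj_cancel(1)[OF g])
  qed
qed

text \<open>The first column of \<open>frame v w\<close> is \<open>v\<close>, so it lies in the same
  coset as \<open>section_mat v\<close>, and likewise \<open>frame w v\<close> for \<open>w\<close>.
  Differences of \<open>F\<close> depend only on the coset, by
  \<open>equivariant_coset\<close>.\<close>

lemma frame_cochain_diff:
  assumes d: "det2 v w \<noteq> 0" and y: "y \<in> SL2" "y' \<in> SL2"
  shows "frame_cochain \<alpha> y v w - frame_cochain \<alpha> y' v w =
    (F (adj (section_mat w) ** y) - F (adj (section_mat w) ** y')) - (F (adj (section_mat v) ** y) - F (adj (section_mat v) ** y'))"
proof -
  have d': "det2 w v \<noteq> 0" using d by (simp add: det2_swap[of w v])
  have nz: "v \<noteq> 0" "w \<noteq> 0" using d by (auto simp: det2_eq)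
  have "F (adj (frame v w) ** y) - F (adj (frame v w) ** y') = F (adj (section_mat v) ** y) - F (adj (section_mat v) ** y')"
    by (rule equivariant_coset[OF F_equivariant frame_SL2 section_mat(1)[OF nz(1)] _ y]) (simp only: frame_e1[OF d] section_mat(2)[OF nz(1)])
  moreover have "F (adj (frame w v) ** y) - F (adj (frame w v) ** y') = F (adj (section_mat w) ** y) - F (adj (section_mat w) ** y')"
    by (rule equivariant_coset[OF F_equivariant frame_SL2 section_mat(1)[OF nz(2)] _ y]) (simp only: frame_e1[OF d'] section_mat(2)[OF nz(2)])
  ultimately show ?thesis unfolding frame_cochain_def by linarith
qed

lemma d_up_beta: "AE z in pts 2 2. d_up 1 beta z = d_right 2 1 induced z"
proof -
  have "AE z in (pts 2 2 :: 'k point measure). det2 (snd z 0) (snd z 1) \<noteq> 0" by (rule AE_pts_det2) simp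
  then show ?thesis using AE_space
  proof eventually_elim
    case (elim z)
    then have "fst z 0 \<in> SL2" "fst z 1 \<in> SL2" by (auto intro: space_pts_G)
    from frame_cochain_diff[OF elim(1) this(2,1)]
    show ?case by (simp add: d_up_eq d_right_eq faceG_def faceV_def face_def beta_def induced_def)
  qed
qed

lemma explicit_edge:
  "explicit_cocycle sp \<alpha> z = - edge \<alpha> (snd z 0) (snd z 1) + edge \<alpha> (snd z 0) (snd z 2) - edge \<alpha> (snd z 1) (snd z 2)"
  by (simp add: explicit_cocycle_def edge_def case_prod_beta' numeral_2_eq_2 lessThan_Suc)

lemma AE_det2_3:
  "AE z in (pts m 3 :: 'k point measure). det2 (snd z 0) (snd z 1) \<noteq> 0 \<and> det2 (snd z 0) (snd z 2) \<noteq> 0 \<and> det2 (snd z 1) (snd z 2) \<noteq> 0"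
proof -
  have p: "AE z in (pts m 2 :: 'k point measure). det2 (snd z 0) (snd z 1) \<noteq> 0" by (rule AE_pts_det2) simp
  have f: "nonsing (pts m 3) (pts m 2 :: 'k point measure) (faceV 2 j)" if "j \<le> 2" for j
    using nonsing_faceV[OF that, of m] unfolding nat_succs .
  have "AE z in (pts m 3 :: 'k point measure). det2 (snd z 0) (snd z 1) \<noteq> 0" by (rule AE_pts_det2) simp
  moreover have "AE z in (pts m 3 :: 'k point measure). det2 (snd (faceV 2 1 z) 0) (snd (faceV 2 1 z) 1) \<noteq> 0"
    by (rule nonsing_AE[OF f p]) simp
  moreover have "AE z in (pts m 3 :: 'k point measure). det2 (snd (faceV 2 0 z) 0) (snd (faceV 2 0 z) 1) \<noteq> 0"
    by (rule nonsing_AE[OF f p]) simp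
  ultimately show ?thesis
    by eventually_elim (simp add: faceV_def face_def numeral_2_eq_2)
qed

text \<open>Moving \<open>y\<close> to the identity changes the frame cochain by a function of
  \<open>w\<close> minus the same function of \<open>v\<close>. In the alternating sum over the
  three pairs these changes cancel, and at the identity the cochain is the bracket of the
  formula.\<close>

lemma d_up_explicit: "AE z in pts 1 3. d_up 0 (explicit_cocycle sp \<alpha>) z = d_right 1 2 beta z"
  using AE_det2_3 AE_space
proof eventually_elim
  case (elim z)
  have y: "fst z 0 \<in> SL2" using elim(2) by (auto intro: space_pts_G)
  note d = elim(1)[THEN conjunct1] elim(1)[THEN conjunct2, THEN conjunct1] elim(1)[THEN conjunct2, THEN conjunct2]
  have "frame_cochain \<alpha> (fst z 0) v w = edge \<alpha> v w +
    ((F (adj (section_mat w) ** fst z 0) - F (adj (section_mat w) ** mat 1)) - (F (adj (section_mat v) ** fst z 0) - F (adj (section_mat v) ** mat 1)))"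
    if "det2 v w \<noteq> 0" for v w
    using frame_cochain_diff[OF that y mat_1_SL2] frame_cochain_1[OF \<alpha> that] by linarith
  note e = this[OF d(1)] this[OF d(2)] this[OF d(3)]
  have r: "d_right 1 2 beta z = - (frame_cochain \<alpha> (fst z 0) (snd z 1) (snd z 2) - frame_cochain \<alpha> (fst z 0) (snd z 0) (snd z 2)
      + frame_cochain \<alpha> (fst z 0) (snd z 0) (snd z 1))"
    by (simp add: d_right_eq beta_def faceV_def face_def numeral_2_eq_2)
  have "d_up 0 (explicit_cocycle sp \<alpha>) z = explicit_cocycle sp \<alpha> z"
    by (simp add: d_up_eq faceG_def explicit_edge)
  then show ?case unfolding r e explicit_edge by linarith
qed

text \<open>Invariance is not visible in the formula, since norms and scalar products are not
  preserved by \<open>SL2\<close>. It is inherited from \<open>beta\<close>: the augmentation of the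
  formula is an invariant cochain, and augmentation is injective.\<close>

lemma explicit_L0inv: "explicit_cocycle sp \<alpha> \<in> L0inv SL2 0 3"
  unfolding L0inv_def
proof (intro CollectI conjI ballI)
  note [measurable] = linear_borel[OF \<alpha>]
  have s[measurable]: "(\<lambda>z. snd z i) \<in> borel_measurable (pts 0 3 :: 'k point measure)" if "i < 3" for i
    by (rule measurable_plane_borel) (use that in measurable)
  have sc[measurable (raw)]: "(\<lambda>z. c z *s v z) \<in> borel_measurable A"
    if [measurable]: "c \<in> borel_measurable A" "v \<in> borel_measurable A" for c :: "'k point \<Rightarrow> 'k" and v :: "'k point \<Rightarrow> 'k^2" and A
    by (rule borel_measurable_vec) (simp add: vector_scalar_mult_def)
  have "(\<lambda>z. edge \<alpha> (snd z i) (snd z j)) \<in> borel_measurable (pts 0 3 :: 'k point measure)" if [simp]: "i < 3" "j < 3" for i j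
    using s[OF that(1)] s[OF that(2)] unfolding edge_def by measurable
  then show "explicit_cocycle sp \<alpha> \<in> borel_measurable (pts 0 3)" unfolding explicit_edge[abs_def] by simp
  fix g :: "'k^2^2" assume g: "g \<in> SL2"
  have "AE z in pts 1 3. d_up 0 (\<lambda>z. explicit_cocycle sp \<alpha> (act 0 3 g z) - explicit_cocycle sp \<alpha> z) z = 0"
    using d_up_explicit nonsing_AE[OF nonsing_act[OF g] d_up_explicit] L0inv_AE[OF L0inv_right_2[OF beta_L0inv] g]
  proof eventually_elim
    case (elim z)
    then show ?case unfolding d_up_diff d_up_act nat_succs by linarith
  qed
  from up_inject[OF this] show "AE z in pts 0 3. explicit_cocycle sp \<alpha> (act 0 3 g z) = explicit_cocycle sp \<alpha> z"
    by eventually_elim simp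
qed

lemma explicit_incl_rel: "incl_rel rep (explicit_cocycle sp \<alpha>)"
proof -
  have "zigzag (explicit_cocycle sp \<alpha>) beta induced"
    unfolding zigzag_def
    by (intro conjI explicit_L0inv beta_L0inv shapiro_L0inv(2)[OF shapiro_induced] d_up_explicit d_up_beta)
  then show ?thesis using shapiro_induced unfolding incl_rel_def by blast
qed

lemma explicit_cocycle_class:
  "explicit_cocycle sp \<alpha> \<in> Z_hom 2 \<and> incl (lin_class \<alpha>) = class_hom 2 (explicit_cocycle sp \<alpha>)"
  using incl_rel_cocycle[OF explicit_incl_rel] incl_class[OF equivariant_cocycle[OF F_equivariant] explicit_incl_rel]
  unfolding lin_class_eq[OF F_equivariant] by blast

end

end

lemma norm_vec_2: "(norm (v :: 'k::real_normed_vector^2))\<^sup>2 = (norm (v$1))\<^sup>2 + (norm (v$2))\<^sup>2"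
  by (simp add: norm_vec_def L2_set_def sum_2)

interpretation real_inner: hermitian_product "(\<bullet>) :: real^2 \<Rightarrow> real^2 \<Rightarrow> real"
proof
  fix u v w :: "real^2" and c r :: real
  show "(u + v) \<bullet> w = u \<bullet> w + v \<bullet> w" by (rule inner_add_left)
  show "(c *s u) \<bullet> w = c * (u \<bullet> w)" by (simp add: inner_vec_def sum_2 algebra_simps)
  show "u \<bullet> (r *\<^sub>R w) = r *\<^sub>R (u \<bullet> w)" by simp
  show "v \<bullet> v = of_real ((norm v)\<^sup>2)" by (simp add: power2_norm_eq_inner)
  show "quarter_turn u \<bullet> quarter_turn v = u \<bullet> v" by (simp add: inner_vec_def sum_2 quarter_turn_def)
  show "(\<lambda>p. fst p \<bullet> snd p) \<in> borel_measurable (borel \<Otimes>\<^sub>M (borel :: (real^2) measure))" by measurable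
qed

interpretation herm: hermitian_product herm
proof
  fix u v w :: "complex^2" and c :: complex and r :: real
  show "herm (u + v) w = herm u w + herm v w" by (simp add: herm_def sum_2 algebra_simps)
  show "herm (c *s u) w = c * herm u w" by (simp add: herm_def sum_2 algebra_simps)
  show "herm u (r *\<^sub>R w) = r *\<^sub>R herm u w" by (simp add: herm_def sum_2 algebra_simps)
  show "herm v v = of_real ((norm v)\<^sup>2)"
    by (simp add: herm_def sum_2 norm_vec_2 flip: complex_norm_square)
  show "herm (quarter_turn u) (quarter_turn v) = herm u v" by (simp add: herm_def sum_2 quarter_turn_def)
  show "(\<lambda>p. herm (fst p) (snd p)) \<in> borel_measurable (borel \<Otimes>\<^sub>M borel)"
  proof -
    have "continuous_on UNIV (\<lambda>p. herm (fst p) (snd p))"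
      unfolding herm_def by (intro continuous_intros)
    from borel_measurable_continuous_onI[OF this] show ?thesis by (simp add: borel_prod)
  qed
qed

theorem theorem5:
  shows "(lin_class \<in> iso (fun_group {\<alpha> :: real \<Rightarrow> real. linear \<alpha>}) (H_grp Unip 1) \<and>
      short_exact_sequence (H_grp SL2 2) (H_hom 2) (H_grp (Unip :: (real^2^2) set) 1) (eval_class 2) incl \<and>
      (\<forall>\<alpha> :: real \<Rightarrow> real. linear \<alpha> \<longrightarrow>
         explicit_cocycle (\<bullet>) \<alpha> \<in> Z_hom 2 \<and>
         incl (lin_class \<alpha>) = class_hom 2 (explicit_cocycle (\<bullet>) \<alpha>)))
    \<and> (lin_class \<in> iso (fun_group {\<alpha> :: complex \<Rightarrow> real. linear \<alpha>}) (H_grp Unip 1) \<and>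
      short_exact_sequence (H_grp SL2 2) (H_hom 2) (H_grp (Unip :: (complex^2^2) set) 1) (eval_class 2) incl \<and>
      (\<forall>\<alpha> :: complex \<Rightarrow> real. linear \<alpha> \<longrightarrow>
         explicit_cocycle herm \<alpha> \<in> Z_hom 2 \<and>
         incl (lin_class \<alpha>) = class_hom 2 (explicit_cocycle herm \<alpha>)))"
  by (intro conjI allI impI lin_class_iso short_exact_sequence_incl_eval
      real_inner.explicit_cocycle_class[THEN conjunct1] real_inner.explicit_cocycle_class[THEN conjunct2]
      herm.explicit_cocycle_class[THEN conjunct1] herm.explicit_cocycle_class[THEN conjunct2])

end
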